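(* Let $(X,\mathbb R^d,\mu)$ be a (one-colour) uniformly discrete stationary ergodic point process on $\mathbb R^d$, and assume that $\mu$-almost surely the point sets of $X$ have finite local complexity. Then for all $k,t\in\mathbb R^d$, $$\left|e^{2\pi i k\cdot t}-1\right|\,\widehat{\dot\mu_1}(\{k\})^{1/2}\le 2\bigl(\dot\mu_1(\{0\})-\dot\mu_1(\{t\})\bigr).$$
   Context: $C_R$ is the open cube of edge length $R$ centred at $0$ in $\mathbb R^d$; $\ell$ is Lebesgue measure. $M_p$ is the set of positive Radon measures $\lambda$ on $\mathbb R^d$ with $\lambda(A)\in\{0,1,2,\dots\}$ for every relatively compact Borel set $A$, with the vague topology ($\lambda_n\to\lambda$ iff $\lambda_n(f)\to\lambda(f)$ for all $f\in C_c(\mathbb R^d)$) and its Borel $\sigma$-algebra; $\mathbb R^d$ acts by $(T_t\lambda)(A)=\lambda(-t+A)$. For $r>0$, $M_p(C_r,1)$ is the (compact) set of $\lambda\in M_p$ with $\lambda(a+C_r)\le1$ for all $a\in\mathbb R^d$. A (one-colour) uniformly discrete stationary ergodic point process $(X,\mathbb R^d,\mu)$ is a Borel probability measure $\mu$ on $M_p$, invariant and ergodic under all $T_t$, whose support $X$ is a closed subset of $M_p(C_r,1)$ for some $r>0$, with positive intensity, i.e. the constant $I$ with $\int_X\lambda(A)\,d\mu(\lambda)=I\ell(A)$ is positive. Each $\lambda\in X$ has the form $\lambda=\sum_{x\in\Lambda}\delta_x$ and is identified with the point set $\Lambda\subset\mathbb R^d$. $\Lambda$ has finite local complexity if $\Lambda-\Lambda$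 is closed and discrete (equivalently, for each $\rho>0$ there are only finitely many sets of the form $(-x+\Lambda)\cap B_\rho$ with $x\in\Lambda$, where $B_\rho$ is the ball of radius $\rho$ about $0$). The Palm measure $\dot\mu$ is the finite positive measure on $X$ given by $\dot\mu(D)=\frac1{\ell(B)}\int_X\sum_{x\in B}\lambda(\{x\})\mathbf 1_D(T_{-x}\lambda)\,d\mu(\lambda)$, independent of the choice of bounded Borel $B\subset\mathbb R^d$ with $\ell(B)>0$. Its first moment is the measure $\dot\mu_1$ on $\mathbb R^d$, $\dot\mu_1(A)=\int_X\lambda(A)\,d\dot\mu(\lambda)$; it is positive, positive definite and translation bounded, it is $\mu$-almost surely the autocorrelation of $\lambda\in X$, and its Fourier transform $\widehat{\dot\mu_1}$ (determined by $\widehat{\dot\mu_1}(f)=\dot\mu_1(\hat f)$ for rapidly decreasing $f$, $\hat f(y)=\int e^{-2\pi i x\cdot y}f(x)\,dx$) is a positive measure. The paper writes $\dot\mu_1(t)$, $\widehat{\dot\mu_1}(k)$ for $\dot\mu_1(\{t\})$, $\widehat{\dot\mu_1}(\{k\})$. *)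

theory Defs
  imports "HOL-Probability.Probability_Measure"
begin

section \<open>Counting measures and the vague topology\<close>

definition cube :: "real \<Rightarrow> 'a::euclidean_space set" where
  "cube R = {x. \<forall>b\<in>Basis. \<bar>x \<bullet> b\<bar> < R / 2}"

text \<open>
  Finiteness on relatively compact Borel sets (the Radon property) is implied by the
  values being natural numbers.
\<close>

definition Mp :: "'a::euclidean_space measure set" where
  "Mp = {\<xi>. sets \<xi> = sets borel \<and>
            (\<forall>A\<in>sets borel. compact (closure A) \<longrightarrow> emeasure \<xi> A \<in> \<nat>)}"

definition Mp_cube :: "real \<Rightarrow> 'a::euclidean_space measure set" where
  "Mp_cube r = {\<xi>\<in>Mp. \<forall>a. emeasure \<xi> ((+) a ` cube r) \<le> 1}"

definition Cc :: "('a::euclidean_space \<Rightarrow> real) set" where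
  "Cc = {f. continuous_on UNIV f \<and> compact (closure {x. f x \<noteq> 0})}"

text \<open>
  The coarsest topology on \<^const>\<open>Mp\<close> making every evaluation at a function in
  \<^const>\<open>Cc\<close> continuous. The generating sets for the zero function include
  \<^const>\<open>Mp\<close> itself, which is therefore the carrier of the topology.
\<close>

definition vague_topology :: "'a::euclidean_space measure topology" where
  "vague_topology = topology_generated_by
     {{\<xi>\<in>Mp. (\<integral>x. f x \<partial>\<xi>) \<in> U} | f U. f \<in> Cc \<and> open U}"

definition vague_borel :: "'a::euclidean_space measure measure" where
  "vague_borel = sigma Mp {U. openin vague_topology U}"

text \<open>The push-forward along \<open>x \<mapsto> t + x\<close>, so a Borel set \<open>A\<close> gets mass \<open>\<xi> (- t + A)\<close>.\<close>

definition translate :: "'a::euclidean_space \<Rightarrow> 'a measure \<Rightarrow> 'a measure" where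
  "translate t \<xi> = distr \<xi> borel ((+) t)"

definition points :: "'a::euclidean_space measure \<Rightarrow> 'a set" where
  "points \<xi> = {x. emeasure \<xi> {x} \<noteq> 0}"

definition finite_local_complexity :: "'a::euclidean_space set \<Rightarrow> bool" where
  "finite_local_complexity \<Lambda> \<longleftrightarrow>
     closed {x - y | x y. x \<in> \<Lambda> \<and> y \<in> \<Lambda>} \<and> discrete {x - y | x y. x \<in> \<Lambda> \<and> y \<in> \<Lambda>}"


section \<open>Uniformly discrete stationary ergodic point processes\<close>

text \<open>The support of a Borel measure on \<^const>\<open>Mp\<close>: the smallest closed set of full measure.\<close>

definition is_vague_support ::
    "'a::euclidean_space measure measure \<Rightarrow> 'a measure set \<Rightarrow> bool" where
  "is_vague_support \<mu> X \<longleftrightarrow>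
     closedin vague_topology X \<and> emeasure \<mu> (Mp - X) = 0 \<and>
     (\<forall>Y. closedin vague_topology Y \<and> emeasure \<mu> (Mp - Y) = 0 \<longrightarrow> X \<subseteq> Y)"

locale ergodic_point_process = prob_space \<mu>
  for \<mu> :: "'a::euclidean_space measure measure" +
  fixes X :: "'a measure set"
  assumes sets_eq: "sets \<mu> = sets vague_borel"
    and stationary: "\<And>t A. A \<in> sets \<mu> \<Longrightarrow> emeasure \<mu> (translate t -` A \<inter> Mp) = emeasure \<mu> A"
    and ergodic: "\<And>A. A \<in> sets \<mu> \<Longrightarrow> (\<forall>t. translate t -` A \<inter> Mp = A) \<Longrightarrow>
                    emeasure \<mu> A = 0 \<or> emeasure \<mu> A = 1"
    and support: "is_vague_support \<mu> X"
    and uniformly_discrete: "\<exists>r>0. X \<subseteq> Mp_cube r"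
    and positive_intensity:
      "\<exists>I::real. I > 0 \<and>
         (\<forall>A\<in>sets borel. (\<integral>\<^sup>+\<xi>\<in>X. emeasure \<xi> A \<partial>\<mu>) = ennreal I * emeasure lborel A)"


section \<open>Palm measure and its first moment\<close>

text \<open>
  The averaging set \<open>B\<close> is an explicit argument. For a stationary process the result is the
  same for all bounded Borel sets \<open>B\<close> of positive Lebesgue measure.
\<close>

definition palm_measure ::
    "'a::euclidean_space measure measure \<Rightarrow> 'a measure set \<Rightarrow> 'a set \<Rightarrow> 'a measure measure" where
  "palm_measure \<mu> X B = measure_of X {D \<in> sets vague_borel. D \<subseteq> X}
     (\<lambda>D. (\<integral>\<^sup>+\<xi>\<in>X. (\<Sum>\<^sub>\<infinity>x\<in>B. emeasure \<xi> {x} * indicator D (translate (- x) \<xi>)) \<partial>\<mu>)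
            / emeasure lborel B)"

definition first_moment :: "'a::euclidean_space measure measure \<Rightarrow> 'a measure" where
  "first_moment P = measure_of UNIV (sets borel) (\<lambda>A. \<integral>\<^sup>+\<xi>. emeasure \<xi> A \<partial>P)"


section \<open>Fourier transform of a measure\<close>

primrec iter_deriv ::
    "'a::euclidean_space list \<Rightarrow> ('a \<Rightarrow> complex) \<Rightarrow> 'a \<Rightarrow> complex" where
  "iter_deriv [] f = f"
| "iter_deriv (v # vs) f = (\<lambda>x. frechet_derivative (iter_deriv vs f) (at x) v)"

text \<open>
  Rapidly decreasing (Schwartz) functions. Differentiability of all iterated partial
  derivatives amounts to smoothness.
\<close>

definition schwartz :: "('a::euclidean_space \<Rightarrow> complex) \<Rightarrow> bool" where
  "schwartz f \<longleftrightarrow>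
     (\<forall>vs\<in>lists Basis.
        (\<forall>x. iter_deriv vs f differentiable (at x)) \<and>
        (\<forall>N::nat. \<exists>C. \<forall>x. (1 + norm x) ^ N * cmod (iter_deriv vs f x) \<le> C))"

definition fourier :: "('a::euclidean_space \<Rightarrow> complex) \<Rightarrow> 'a \<Rightarrow> complex" where
  "fourier f y = (\<integral>x. exp (- 2 * pi * \<i> * of_real (x \<bullet> y)) * f x \<partial>lborel)"

text \<open>
  The positive measure \<open>\<nu>\<close> is the Fourier transform of \<open>M\<close>. There is at most one such \<open>\<nu>\<close>,
  because integrability of Schwartz functions makes it finite on bounded sets.
\<close>

definition has_fourier_transform ::
    "'a::euclidean_space measure \<Rightarrow> 'a measure \<Rightarrow> bool" where
  "has_fourier_transform M \<nu> \<longleftrightarrow>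
     sets \<nu> = sets borel \<and>
     (\<forall>f. schwartz f \<longrightarrow>
        integrable \<nu> f \<and> integrable M (fourier f) \<and>
        (\<integral>x. f x \<partial>\<nu>) = (\<integral>y. fourier f y \<partial>M))"

end

(*
For a configuration xi let S_n(xi) be the sum of exp(2 pi i k.x) g_n(x) over its points x, where g_n
is the density of a centred Gaussian with variance of order n. By Campbell's formula and stationarity,
E Re(S_m conj S_n) is the integral of cos(2 pi k.y) g_{m+n}(y) against the first moment gamma of the
Palm measure, that is, the integral of exp(-pi (m+n)|x - k|^2) against its Fourier transform nu, which
tends to nu{k}. So S_n is Cauchy in L^2. Translating xi by t multiplies S_n by exp(2 pi i k.t), up to
an error that vanishes uniformly as n grows; hence the limit of |S_n| along an almost surely convergent
subsequence is invariant, and by ergodicity it is the constant sqrt(nu{k}).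

On the other hand |exp(2 pi i k.t) - 1| |S_n(xi)| is, up to the same error, the modulus of
S_n(t + xi) - S_n(xi), in which the common points of xi and t + xi cancel. The points that remain are
weighted by g_n and have expected total mass 2 (gamma{0} - gamma{t}), again by Campbell's formula.
*)

theory Submission
  imports Defs "HOL-Probability.Probability"
begin

text \<open>Gaussian weights are chosen because they are Schwartz functions, the only test functions
  through which \<open>has_fourier_transform\<close> speaks about \<open>\<nu>\<close>, and because
  their parameters add under convolution: the correlation of two sums then depends on m + n alone,
  and the Cauchy property needs nothing beyond convergence of the one function \<open>J\<close>.
  Ergodicity repairs a mismatch of moments: the cancellation argument bounds E|S_n| from above,
  whereas Campbell's formula computes E|S_n|^2. Jensen's inequality only gives E|S_n| \<le>
  sqrt(E|S_n|^2), the wrong direction; asymptotic constancy of |S_n| makes the two sides agree in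
  the limit. Two obstacles shape the technical part. The sums are infinite, so everything rests on a
  bound for the total Gaussian weight that is uniform over \<open>Mp_cube r\<close> and over all
  parameters at least 1. And the \<sigma>-algebra is generated by the vague open sets, whose
  defining subbasis is uncountable, so a countable family of test functions has to be found before
  maps into configurations can be shown measurable by testing evaluations.\<close>

section \<open>Gaussian kernels\<close>

text \<open>The normalised Gaussian density with covariance a / (2 * pi) times the identity. With
  this scaling it is the Fourier transform of exp (- pi * a * |x|^2), and the parameter is additive
  under convolution.\<close>

definition gauss :: "real \<Rightarrow> 'a::euclidean_space \<Rightarrow> real" where
  "gauss a x = exp (- pi * (norm x)\<^sup>2 / a) / sqrt a ^ DIM('a)"

lemma gauss_pos: "a > 0 \<Longrightarrow> gauss a x > 0"
  by (simp add: gauss_def)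

lemma gauss_nonneg: "a \<ge> 0 \<Longrightarrow> 0 \<le> gauss a x"
  by (simp add: gauss_def)

lemma gauss_measurable [measurable]: "gauss a \<in> borel_measurable borel"
  unfolding gauss_def by measurable

section \<open>Fourier transforms and convolutions of Gaussians\<close>

lemma integrable_gaussian_real:
  assumes "q > 0"
  shows "integrable lborel (\<lambda>x::real. exp (- pi * q * x\<^sup>2))"
proof -
  have "integrable lborel (\<lambda>x. normal_density 0 (1 / sqrt (2 * pi * q)) x * (1 / sqrt q))"
    using assms by (intro integrable_mult_left integrable_normal_density) simp
  also have "(\<lambda>x. normal_density 0 (1 / sqrt (2 * pi * q)) x * (1 / sqrt q)) = (\<lambda>x::real. exp (- pi * q * x\<^sup>2))"
    using assms by (auto simp: normal_density_def fun_eq_iff power_divide field_simps real_sqrt_mult real_sqrt_divide)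
  finally show ?thesis .
qed

text \<open>Rescaling by c = 1 / sqrt (2 * pi * q) turns the Gaussian into sqrt (2 * pi) times the
  standard normal density, so the integral is the characteristic function of the standard normal
  law, evaluated at - 2 * pi * c * y.\<close>

lemma fourier_gaussian_real:
  assumes "q > 0"
  shows "(\<integral>x. exp (- 2 * pi * \<i> * of_real (x * y)) * of_real (exp (- pi * q * x\<^sup>2)) \<partial>(lborel :: real measure))
          = of_real (exp (- pi * y\<^sup>2 / q) / sqrt q)"
proof -
  define c where "c = 1 / sqrt (2 * pi * q)"
  have c: "c > 0" and c2: "c\<^sup>2 = 1 / (2 * pi * q)" using assms by (auto simp: c_def power_divide)
  have "(\<integral>x. exp (- 2 * pi * \<i> * of_real (x * y)) * of_real (exp (- pi * q * x\<^sup>2)) \<partial>(lborel :: real measure))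
      = c *\<^sub>R (\<integral>u. exp (- 2 * pi * \<i> * of_real (c * u * y)) * of_real (exp (- pi * q * (c * u)\<^sup>2)) \<partial>lborel)"
    using c by (subst lborel_integral_real_affine[where c=c and t=0]) auto
  also have "(\<integral>u. exp (- 2 * pi * \<i> * of_real (c * u * y)) * of_real (exp (- pi * q * (c * u)\<^sup>2)) \<partial>lborel)
      = (\<integral>u. sqrt (2 * pi) *\<^sub>R (std_normal_density u *\<^sub>R iexp ((- 2 * pi * c * y) * u)) \<partial>lborel)"
    using assms by (intro Bochner_Integration.integral_cong)
      (auto simp: normal_density_def power_mult_distrib c2 scaleR_conv_of_real real_sqrt_mult field_simps)
  also have "\<dots> = sqrt (2 * pi) *\<^sub>R char std_normal_distribution (- 2 * pi * c * y)"
  proof -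
    have "(\<integral>u. sqrt (2 * pi) *\<^sub>R (std_normal_density u *\<^sub>R iexp ((- 2 * pi * c * y) * u)) \<partial>lborel)
        = sqrt (2 * pi) *\<^sub>R (\<integral>u. std_normal_density u *\<^sub>R iexp ((- 2 * pi * c * y) * u) \<partial>lborel)"
      by (rule integral_scaleR_right)
    also have "(\<integral>u. std_normal_density u *\<^sub>R iexp ((- 2 * pi * c * y) * u) \<partial>lborel) = char std_normal_distribution (- 2 * pi * c * y)"
      unfolding char_def by (subst integral_density) auto
    finally show ?thesis .
  qed
  also have "char std_normal_distribution (- 2 * pi * c * y) = of_real (exp (- pi * y\<^sup>2 / q))"
    using assms unfolding char_std_normal_distribution
    by (simp add: power_mult_distrib c2) (simp add: power2_eq_square field_simps)
  also have "c *\<^sub>R (sqrt (2 * pi) *\<^sub>R complex_of_real (exp (- pi * y\<^sup>2 / q))) = of_real (exp (- pi * y\<^sup>2 / q) / sqrt q)"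
    using assms by (simp add: c_def scaleR_conv_of_real real_sqrt_mult field_simps)
  finally show ?thesis .
qed

text \<open>Lebesgue measure is the image of a product of one-dimensional Lebesgue measures, so the
  finite product form of Fubini's theorem applies. This reduces Gaussian Fourier integrals to
  dimension one.\<close>

lemma lborel_integral_prod_Basis:
  fixes f :: "'a::euclidean_space \<Rightarrow> real \<Rightarrow> complex"
  assumes f: "\<And>b. b \<in> Basis \<Longrightarrow> integrable lborel (f b)"
  shows "(\<integral>x. (\<Prod>b\<in>Basis. f b (x \<bullet> b)) \<partial>(lborel :: 'a measure)) = (\<Prod>b\<in>Basis. \<integral>x. f b x \<partial>lborel)"
proof -
  interpret product_sigma_finite "\<lambda>b::'a. lborel :: real measure" ..
  have [measurable]: "\<And>b. b \<in> Basis \<Longrightarrow> f b \<in> borel_measurable borel"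
    using borel_measurable_integrable[OF f] by simp
  have eq: "(\<Sum>b'\<in>Basis. x b' *\<^sub>R b') \<bullet> b = x b" if "b \<in> Basis" for x and b :: 'a
    using that by simp
  have "(\<integral>x. (\<Prod>b\<in>Basis. f b (x \<bullet> b)) \<partial>(lborel :: 'a measure))
      = (\<integral>x. (\<Prod>b\<in>Basis. f b ((\<Sum>b'\<in>Basis. x b' *\<^sub>R b') \<bullet> b)) \<partial>(\<Pi>\<^sub>M b\<in>Basis. lborel))"
    by (subst lborel_eq, subst integral_distr) auto
  also have "\<dots> = (\<integral>x. (\<Prod>b\<in>Basis. f b (x b)) \<partial>(\<Pi>\<^sub>M b\<in>(Basis::'a set). lborel))"
    by (intro Bochner_Integration.integral_cong prod.cong) (auto simp: eq)
  also have "\<dots> = (\<Prod>b\<in>Basis. \<integral>x. f b x \<partial>lborel)"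
    by (intro product_integral_prod f) auto
  finally show ?thesis .
qed

lemma lborel_integral_shift:
  fixes f :: "'a::euclidean_space \<Rightarrow> 'b::{banach,second_countable_topology}"
  assumes [measurable]: "f \<in> borel_measurable borel"
  shows "(\<integral>x. f (t + x) \<partial>lborel) = (\<integral>x. f x \<partial>lborel)"
  by (subst (2) lborel_distr_plus[of t, symmetric], subst integral_distr) auto

lemma lborel_nn_integral_shift:
  fixes f :: "'a::euclidean_space \<Rightarrow> ennreal"
  assumes [measurable]: "f \<in> borel_measurable borel"
  shows "(\<integral>\<^sup>+x. f (t + x) \<partial>lborel) = (\<integral>\<^sup>+x. f x \<partial>lborel)"
  by (subst (2) lborel_distr_plus[of t, symmetric], subst nn_integral_distr) auto

lemma lborel_nn_integral_reflect:
  fixes f :: "'a::euclidean_space \<Rightarrow> ennreal"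
  assumes [measurable]: "f \<in> borel_measurable borel"
  shows "(\<integral>\<^sup>+x. f (- x) \<partial>lborel) = (\<integral>\<^sup>+x. f x \<partial>lborel)"
  by (subst (2) lborel_affine[of "-1" 0]) (auto simp: nn_integral_density nn_integral_distr)

lemma norm_sq_Basis: "(norm (x::'a::euclidean_space))\<^sup>2 = (\<Sum>b\<in>Basis. (x \<bullet> b)\<^sup>2)"
  unfolding power2_norm_eq_inner by (subst euclidean_inner) (simp add: power2_eq_square)

lemma fourier_gaussian_centered:
  fixes y :: "'a::euclidean_space"
  assumes "q > 0"
  shows "(\<integral>x. exp (- 2 * pi * \<i> * of_real (x \<bullet> y)) * of_real (exp (- pi * q * (norm x)\<^sup>2)) \<partial>(lborel :: 'a measure))
          = of_real (gauss q y)"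
proof -
  let ?f = "\<lambda>b::'a. \<lambda>u::real. exp (- 2 * pi * \<i> * of_real (u * (y \<bullet> b))) * complex_of_real (exp (- pi * q * u\<^sup>2))"
  have "exp (- 2 * pi * \<i> * of_real (x \<bullet> y)) * of_real (exp (- pi * q * (norm x)\<^sup>2)) = (\<Prod>b\<in>Basis. ?f b (x \<bullet> b))" for x :: 'a
    unfolding norm_sq_Basis
    by (subst euclidean_inner) (simp add: exp_sum prod.distrib sum_distrib_left flip: exp_of_real)
  then have "(\<integral>x. exp (- 2 * pi * \<i> * of_real (x \<bullet> y)) * of_real (exp (- pi * q * (norm x)\<^sup>2)) \<partial>(lborel :: 'a measure))
     = (\<Prod>b\<in>Basis. \<integral>u. ?f b u \<partial>lborel)"
    by (simp only:) (intro lborel_integral_prod_Basis,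
      rule Bochner_Integration.integrable_bound[OF integrable_gaussian_real[OF assms]],
      auto simp: norm_mult norm_exp_eq_Re)
  also have "\<dots> = (\<Prod>b\<in>(Basis::'a set). of_real (exp (- pi * (y \<bullet> b)\<^sup>2 / q) / sqrt q))"
    unfolding fourier_gaussian_real[OF assms] ..
  also have "\<dots> = of_real (gauss q y)"
    unfolding gauss_def norm_sq_Basis
    by (simp add: prod_dividef exp_sum sum_distrib_left sum_divide_distrib sum_negf[symmetric])
  finally show ?thesis .
qed

lemma fourier_gaussian:
  fixes k y :: "'a::euclidean_space"
  assumes "q > 0"
  shows "fourier (\<lambda>x. of_real (exp (- pi * q * (norm (x - k))\<^sup>2))) y
          = exp (- 2 * pi * \<i> * of_real (k \<bullet> y)) * of_real (gauss q y)"
proof -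
  have "fourier (\<lambda>x. of_real (exp (- pi * q * (norm (x - k))\<^sup>2))) y =
     (\<integral>x. exp (- 2 * pi * \<i> * of_real ((k + x) \<bullet> y)) * of_real (exp (- pi * q * (norm (k + x - k))\<^sup>2)) \<partial>(lborel :: 'a measure))"
    unfolding fourier_def by (subst lborel_integral_shift[where t=k]) auto
  also have "\<dots> = (\<integral>x. exp (- 2 * pi * \<i> * of_real (k \<bullet> y)) * (exp (- 2 * pi * \<i> * of_real (x \<bullet> y)) * of_real (exp (- pi * q * (norm x)\<^sup>2))) \<partial>(lborel :: 'a measure))"
    by (intro Bochner_Integration.integral_cong) (auto simp: inner_add_left algebra_simps simp flip: exp_add)
  also have "\<dots> = exp (- 2 * pi * \<i> * of_real (k \<bullet> y)) * of_real (gauss q y)"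
    by (subst integral_mult_right_zero) (simp only: fourier_gaussian_centered[OF assms])
  finally show ?thesis .
qed

lemma nn_integral_gauss:
  assumes "a > 0"
  shows "(\<integral>\<^sup>+x. ennreal (gauss a x) \<partial>(lborel :: 'a::euclidean_space measure)) = 1"
proof -
  have "(\<integral>\<^sup>+x. ennreal (gauss a x) \<partial>(lborel :: 'a measure))
     = (\<integral>\<^sup>+x. (\<Prod>b\<in>(Basis::'a set). ennreal (exp (- pi * (x \<bullet> b)\<^sup>2 / a) / sqrt a)) \<partial>lborel)"
    using assms unfolding gauss_def norm_sq_Basis
    by (intro nn_integral_cong, subst prod_ennreal)
      (simp_all add: prod_dividef exp_sum sum_distrib_left sum_divide_distrib sum_negf[symmetric])
  also have "\<dots> = (\<Prod>b\<in>(Basis::'a set). \<integral>\<^sup>+u. ennreal (exp (- pi * u\<^sup>2 / a) / sqrt a) \<partial>lborel)"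
    by (subst nn_integral_lborel_prod[symmetric]) auto
  also have "(\<integral>\<^sup>+u. ennreal (exp (- pi * u\<^sup>2 / a) / sqrt a) \<partial>lborel) = (\<integral>\<^sup>+u. ennreal (normal_density 0 (sqrt (a / (2 * pi))) u) \<partial>lborel)"
    using assms by (intro nn_integral_cong)
      (auto simp: normal_density_def field_simps real_sqrt_mult real_sqrt_divide)
  also have "\<dots> = 1"
    using assms integral_normal_density[of "sqrt (a / (2 * pi))" 0]
    by (subst nn_integral_eq_integral) (auto intro!: integrable_normal_density)
  finally show ?thesis by simp
qed

text \<open>Completing the square in z. The second factor on the right is a Gaussian of unit mass in
  z, with parameter a * b / (a + b) and a shifted centre, so integrating z out leaves
  \<open>gauss (a + b) s\<close>.\<close>

lemma gauss_mult_gauss: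
  fixes z s :: "'a::euclidean_space"
  assumes "a > 0" "b > 0"
  shows "gauss a z * gauss b (z + s) = gauss (a + b) s * gauss (a * b / (a + b)) ((a / (a + b)) *\<^sub>R s + z)"
proof -
  have 1: "(norm z)\<^sup>2 / a + (norm (z + s))\<^sup>2 / b
      = (norm s)\<^sup>2 / (a + b) + (norm ((a / (a + b)) *\<^sub>R s + z))\<^sup>2 / (a * b / (a + b))"
  proof -
    have n: "(norm (z + s))\<^sup>2 = z \<bullet> z + 2 * (z \<bullet> s) + s \<bullet> s"
      by (simp add: power2_norm_eq_inner inner_add inner_commute)
    have m: "(norm ((a / (a + b)) *\<^sub>R s + z))\<^sup>2 = (a / (a + b))\<^sup>2 * (s \<bullet> s) + 2 * (a / (a + b)) * (z \<bullet> s) + z \<bullet> z"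
      unfolding power2_norm_eq_inner by (simp add: inner_add inner_commute power2_eq_square)
    have ab: "a + b \<noteq> 0" using assms by auto
    \<comment> \<open>The scalar form of the identity, with Z, W, S in place of the three inner
      products. Treating a + b as one symbol c lets it be cleared as a single denominator.\<close>
    have E: "Z / a + (Z + 2 * W + S) / b = S / c + ((a / c)\<^sup>2 * S + 2 * (a / c) * W + Z) / (a * b / c)"
      if "c = a + b" "c \<noteq> 0" for c Z W S :: real
    proof -
      have "a * b * c * (Z / a + (Z + 2 * W + S) / b) = b * c * Z + a * c * (Z + 2 * W + S)"
        using assms by (simp add: field_simps)
      moreover have "a * b * c * (S / c + ((a / c)\<^sup>2 * S + 2 * (a / c) * W + Z) / (a * b / c)) = a * b * S + a * a * S + 2 * a * c * W + c * c * Z"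
        using assms that(2) by (simp add: field_simps power2_eq_square)
      moreover have "b * c * Z + a * c * (Z + 2 * W + S) = a * b * S + a * a * S + 2 * a * c * W + c * c * Z"
        unfolding that(1) by (simp add: algebra_simps)
      ultimately have "a * b * c * (Z / a + (Z + 2 * W + S) / b) = a * b * c * (S / c + ((a / c)\<^sup>2 * S + 2 * (a / c) * W + Z) / (a * b / c))" by simp
      then show ?thesis using assms that(2) by simp
    qed
    show ?thesis unfolding n m power2_norm_eq_inner[of z] power2_norm_eq_inner[of s] using E[OF refl ab] .
  qed
  have 2: "sqrt a ^ n * sqrt b ^ n = sqrt (a + b) ^ n * sqrt (a * b / (a + b)) ^ n" for n
    using assms by (simp add: power_mult_distrib[symmetric] real_sqrt_mult[symmetric])
  have "gauss a z * gauss b (z + s) = exp (- pi * ((norm z)\<^sup>2 / a + (norm (z + s))\<^sup>2 / b)) / (sqrt a ^ DIM('a) * sqrt b ^ DIM('a))"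
    by (simp add: gauss_def exp_add[symmetric] field_simps)
  also have "\<dots> = gauss (a + b) s * gauss (a * b / (a + b)) ((a / (a + b)) *\<^sub>R s + z)"
    unfolding 1 2 gauss_def times_divide_times_eq exp_add[symmetric] by (simp add: algebra_simps)
  finally show ?thesis .
qed

lemma nn_integral_gauss_mult_gauss:
  fixes s :: "'a::euclidean_space"
  assumes "a > 0" "b > 0"
  shows "(\<integral>\<^sup>+z. ennreal (gauss a z * gauss b (z + s)) \<partial>lborel) = ennreal (gauss (a + b) s)"
proof -
  have "(\<integral>\<^sup>+z. ennreal (gauss a z * gauss b (z + s)) \<partial>lborel)
      = ennreal (gauss (a + b) s) * (\<integral>\<^sup>+z. ennreal (gauss (a * b / (a + b)) ((a / (a + b)) *\<^sub>R s + z)) \<partial>lborel)"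
    using assms gauss_pos[of "a + b" s] unfolding gauss_mult_gauss[OF assms]
    by (subst nn_integral_cmult[symmetric]) (auto simp: ennreal_mult' intro!: nn_integral_cong)
  then show ?thesis
    using assms by (subst (asm) lborel_nn_integral_shift) (auto simp: nn_integral_gauss)
qed


section \<open>Gaussians as Schwartz functions\<close>

text \<open>By induction over sums and products, differentiation in a fixed direction stays within
  polynomials. This keeps all iterated derivatives of a Gaussian of the form polynomial times
  Gaussian.\<close>

lemma real_polynomial_function_has_derivative:
  assumes "real_polynomial_function p"
  shows "\<exists>p'. (\<forall>v. real_polynomial_function (\<lambda>x. p' x v)) \<and> (\<forall>x. (p has_derivative p' x) (at x))"
  using assms
proof induction
  case (linear f)
  then show ?case
    by (intro exI[of _ "\<lambda>x. f"]) (auto intro: bounded_linear_imp_has_derivative)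
next
  case (const c)
  then show ?case
    by (intro exI[of _ "\<lambda>x v. 0"]) auto
next
  case (add f g)
  then obtain f' g' where "\<forall>v. real_polynomial_function (\<lambda>x. f' x v)" "\<forall>x. (f has_derivative f' x) (at x)"
    "\<forall>v. real_polynomial_function (\<lambda>x. g' x v)" "\<forall>x. (g has_derivative g' x) (at x)" by blast
  then show ?case
    by (intro exI[of _ "\<lambda>x v. f' x v + g' x v"]) (auto intro: has_derivative_add)
next
  case (mult f g)
  then obtain f' g' where "\<forall>v. real_polynomial_function (\<lambda>x. f' x v)" "\<forall>x. (f has_derivative f' x) (at x)"
    "\<forall>v. real_polynomial_function (\<lambda>x. g' x v)" "\<forall>x. (g has_derivative g' x) (at x)" by blast
  with mult.hyps show ?case
    by (intro exI[of _ "\<lambda>x v. f x * g' x v + f' x v * g x"])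
      (auto intro: has_derivative_mult intro!: real_polynomial_function.intros(3,4))
qed

lemma real_polynomial_function_growth:
  assumes "real_polynomial_function p"
  shows "\<exists>C n. C \<ge> 0 \<and> (\<forall>x. \<bar>p x\<bar> \<le> C * (1 + norm x) ^ n)"
  using assms
proof induction
  case (linear f)
  then obtain K where K: "\<And>x. norm (f x) \<le> norm x * K" "K \<ge> 0"
    using bounded_linear.nonneg_bounded by blast
  have "\<bar>f x\<bar> \<le> K * (1 + norm x)" for x
    using K(1)[of x] K(2) by (simp add: algebra_simps)
  then show ?case using K(2) by (intro exI[of _ K] exI[of _ 1]) simp
next
  case (const c)
  then show ?case by (intro exI[of _ "\<bar>c\<bar>"] exI[of _ 0]) simp
next
  case (add f g)
  then obtain C n D m where f: "C \<ge> 0" "\<And>x. \<bar>f x\<bar> \<le> C * (1 + norm x) ^ n"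
    and g: "D \<ge> 0" "\<And>x. \<bar>g x\<bar> \<le> D * (1 + norm x) ^ m" by blast
  have "\<bar>f x + g x\<bar> \<le> (C + D) * (1 + norm x) ^ (max n m)" for x
  proof -
    have "\<bar>f x\<bar> \<le> C * (1 + norm x) ^ max n m"
      by (rule order_trans[OF f(2)]) (intro mult_left_mono power_increasing, use f in auto)
    moreover have "\<bar>g x\<bar> \<le> D * (1 + norm x) ^ max n m"
      by (rule order_trans[OF g(2)]) (intro mult_left_mono power_increasing, use g in auto)
    ultimately show ?thesis by (simp add: algebra_simps)
  qed
  then show ?case using f g by (intro exI[of _ "C + D"] exI[of _ "max n m"]) simp
next
  case (mult f g)
  then obtain C n D m where f: "C \<ge> 0" "\<And>x. \<bar>f x\<bar> \<le> C * (1 + norm x) ^ n"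
    and g: "D \<ge> 0" "\<And>x. \<bar>g x\<bar> \<le> D * (1 + norm x) ^ m" by blast
  have "\<bar>f x * g x\<bar> \<le> (C * D) * (1 + norm x) ^ (n + m)" for x
  proof -
    have "\<bar>f x\<bar> * \<bar>g x\<bar> \<le> (C * (1 + norm x) ^ n) * (D * (1 + norm x) ^ m)"
      by (intro mult_mono f g) (use f in auto)
    then show ?thesis by (simp add: abs_mult power_add algebra_simps)
  qed
  then show ?case using f g by (intro exI[of _ "C * D"] exI[of _ "n + m"]) simp
qed

text \<open>Raising 1 + c * u^2 / M \<le> exp (c * u^2 / M) to the power M shows that exp (c * u^2)
  dominates a multiple of (1 + u^2)^M, and hence of (1 + u)^m once 2 * M \<ge> m.\<close>

lemma polynomial_gaussian_decay:
  assumes "c > 0"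
  shows "\<exists>K. \<forall>u\<ge>0. (1 + u) ^ m * exp (- c * u\<^sup>2) \<le> (K :: real)"
proof -
  \<comment> \<open>The successor keeps M positive even for m = 0, so that dividing by M is
    legitimate. The factor L is at least 1 and at least M / c, which covers both summands of 1 +
    u^2.\<close>
  define M where "M = Suc m"
  define L where "L = max 1 (real M / c)"
  have L: "L \<ge> 1" "L \<ge> real M / c" by (auto simp: L_def)
  have M: "real M > 0" by (simp add: M_def)
  have "(1 + u) ^ m * exp (- c * u\<^sup>2) \<le> (2 * L) ^ M" if "u \<ge> 0" for u
  proof -
    have "(real M / c) * (c * u\<^sup>2 / M) \<le> L * (c * u\<^sup>2 / M)"
      using L assms by (intro mult_right_mono) auto
    moreover have "(real M / c) * (c * u\<^sup>2 / M) = u\<^sup>2"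
      using assms M by simp
    ultimately have "1 + u\<^sup>2 \<le> L * (1 + c * u\<^sup>2 / M)"
      using L unfolding distrib_left by linarith
    also have "\<dots> \<le> L * exp (c * u\<^sup>2 / M)"
      using L by (intro mult_left_mono exp_ge_add_one_self) auto
    finally have 1: "1 + u\<^sup>2 \<le> L * exp (c * u\<^sup>2 / M)" .
    have "(1 + u) ^ m \<le> (1 + u) ^ (2 * M)"
      using that by (intro power_increasing) (auto simp: M_def)
    also have "\<dots> = ((1 + u)\<^sup>2) ^ M" by (simp add: power_mult)
    also have "\<dots> \<le> (2 * (L * exp (c * u\<^sup>2 / M))) ^ M"
    proof (intro power_mono)
      have "(1 + u)\<^sup>2 \<le> 2 * (1 + u\<^sup>2)"
        using sum_squares_bound[of 1 u] by (simp add: power2_sum)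
      also have "\<dots> \<le> 2 * (L * exp (c * u\<^sup>2 / M))" using 1 by simp
      finally show "(1 + u)\<^sup>2 \<le> 2 * (L * exp (c * u\<^sup>2 / M))" .
    qed simp
    also have "\<dots> = (2 * L) ^ M * exp (c * u\<^sup>2)"
      using M by (simp add: power_mult_distrib mult.assoc flip: exp_of_nat_mult)
    finally show ?thesis
      by (simp add: exp_minus field_simps)
  qed
  then show ?thesis by blast
qed

lemma has_derivative_gaussian:
  fixes k x :: "'a::euclidean_space"
  shows "((\<lambda>x. exp (- pi * q * (norm (x - k))\<^sup>2)) has_derivative
          (\<lambda>v. (- 2 * pi * q * ((x - k) \<bullet> v)) * exp (- pi * q * (norm (x - k))\<^sup>2))) (at x)"
  unfolding power2_norm_eq_inner
  by (auto intro!: derivative_eq_intros simp: inner_commute algebra_simps)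

text \<open>In direction v, the derivative of p times the Gaussian has the new polynomial factor p'
  v - 2 * pi * q * ((x - k) \<bullet> v) * p.\<close>

lemma iter_deriv_gaussian:
  fixes k :: "'a::euclidean_space"
  shows "\<exists>p. real_polynomial_function p \<and>
     iter_deriv vs (\<lambda>x. of_real (exp (- pi * q * (norm (x - k))\<^sup>2)))
       = (\<lambda>x. complex_of_real (p x * exp (- pi * q * (norm (x - k))\<^sup>2)))"
proof (induction vs)
  case Nil
  then show ?case by (intro exI[of _ "\<lambda>x. 1"]) auto
next
  case (Cons v vs)
  let ?g = "\<lambda>x. exp (- pi * q * (norm (x - k))\<^sup>2)"
  from Cons.IH obtain p where p: "real_polynomial_function p"
    and eq: "iter_deriv vs (\<lambda>x. of_real (?g x))
       = (\<lambda>x. complex_of_real (p x * ?g x))" by blast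
  obtain p' where p': "\<And>v. real_polynomial_function (\<lambda>x. p' x v)" "\<And>x. (p has_derivative p' x) (at x)"
    using real_polynomial_function_has_derivative[OF p] by blast
  have d: "((\<lambda>x. complex_of_real (p x * ?g x)) has_derivative
     (\<lambda>v. of_real (p x * ((- 2 * pi * q * ((x - k) \<bullet> v)) * ?g x)
          + p' x v * ?g x))) (at x)" for x
    by (intro has_derivative_of_real has_derivative_mult p' has_derivative_gaussian)
  have "iter_deriv (v # vs) (\<lambda>x. of_real (?g x))
     = (\<lambda>x. of_real ((p x * (- 2 * pi * q * (x \<bullet> v - k \<bullet> v)) + p' x v) * ?g x))"
    unfolding iter_deriv.simps eq frechet_derivative_at[OF d, symmetric]
    by (simp add: algebra_simps)
  moreover have "real_polynomial_function (\<lambda>x. p x * (- 2 * pi * q * (x \<bullet> v - k \<bullet> v)) + p' x v)"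
    by (intro real_polynomial_function.intros(2-4) p p' real_polynomial_function_diff
        real_polynomial_function.intros(1)[OF bounded_linear_inner_left])
  ultimately show ?case by blast
qed

text \<open>These are the test functions later inserted into \<open>has_fourier_transform\<close>;
  the centre k is arbitrary so that the mass of a measure near any given frequency can be
  isolated.\<close>

lemma schwartz_gaussian:
  fixes k :: "'a::euclidean_space"
  assumes "q > 0"
  shows "schwartz (\<lambda>x. of_real (exp (- pi * q * (norm (x - k))\<^sup>2)))"
  unfolding schwartz_def
proof (intro ballI conjI allI)
  fix vs :: "'a list"
  let ?f = "\<lambda>x. complex_of_real (exp (- pi * q * (norm (x - k))\<^sup>2))"
  obtain p where p: "real_polynomial_function p"
    and eq: "iter_deriv vs ?f = (\<lambda>x. complex_of_real (p x * exp (- pi * q * (norm (x - k))\<^sup>2)))"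
    using iter_deriv_gaussian by blast
  show "iter_deriv vs ?f differentiable at x" for x
  proof -
    obtain p' where p': "\<And>x. (p has_derivative p' x) (at x)"
      using real_polynomial_function_has_derivative[OF p] by blast
    show ?thesis
      unfolding eq differentiable_def
      using has_derivative_of_real[OF has_derivative_mult[OF p' has_derivative_gaussian]] by blast
  qed
  show "\<exists>C. \<forall>x. (1 + norm x) ^ N * cmod (iter_deriv vs ?f x) \<le> C" for N
  proof -
    obtain C n where C: "C \<ge> 0" "\<And>x. \<bar>p x\<bar> \<le> C * (1 + norm x) ^ n"
      using real_polynomial_function_growth[OF p] by blast
    obtain K where K: "\<And>u. u \<ge> 0 \<Longrightarrow> (1 + u) ^ (N + n) * exp (- (pi * q) * u\<^sup>2) \<le> K"
      using polynomial_gaussian_decay[of "pi * q" "N + n"] assms by auto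
    have "(1 + norm x) ^ N * cmod (iter_deriv vs ?f x) \<le> C * (1 + norm k) ^ (N + n) * K" for x
    proof -
      \<comment> \<open>The polynomial weight is centred at 0 but the Gaussian at k. This
        submultiplicative estimate recentres the weight at the cost of a power of 1 + |k|.\<close>
      have le: "1 + norm x \<le> (1 + norm k) * (1 + norm (x - k))"
      proof -
        have "(1 + norm k) * (1 + norm (x - k)) = 1 + norm k + norm (x - k) + norm k * norm (x - k)"
          by (simp add: algebra_simps)
        moreover have "norm x \<le> norm k + norm (x - k)" using norm_triangle_ineq[of k "x - k"] by simp
        moreover have "0 \<le> norm k * norm (x - k)" by simp
        ultimately show ?thesis by linarith
      qed
      have "(1 + norm x) ^ N * cmod (iter_deriv vs ?f x)
          = (1 + norm x) ^ N * (\<bar>p x\<bar> * exp (- (pi * q) * (norm (x - k))\<^sup>2))"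
        unfolding eq norm_of_real by (simp add: abs_mult)
      also have "\<dots> \<le> (1 + norm x) ^ N * ((C * (1 + norm x) ^ n) * exp (- (pi * q) * (norm (x - k))\<^sup>2))"
        by (intro mult_left_mono mult_right_mono C) auto
      also have "\<dots> = C * ((1 + norm x) ^ (N + n) * exp (- (pi * q) * (norm (x - k))\<^sup>2))"
        by (simp add: power_add)
      also have "\<dots> \<le> C * (((1 + norm k) * (1 + norm (x - k))) ^ (N + n) * exp (- (pi * q) * (norm (x - k))\<^sup>2))"
        using le C by (intro mult_left_mono mult_right_mono power_mono) auto
      also have "\<dots> = C * (1 + norm k) ^ (N + n) * ((1 + norm (x - k)) ^ (N + n) * exp (- (pi * q) * (norm (x - k))\<^sup>2))"
        unfolding power_mult_distrib by (simp only: mult_ac)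
      also have "\<dots> \<le> C * (1 + norm k) ^ (N + n) * K"
        using C by (intro mult_left_mono K) auto
      finally show ?thesis .
    qed
    then show ?thesis by blast
  qed
qed

section \<open>Translates of Gaussians\<close>

text \<open>The function exp (- u^2) has Lipschitz constant 1, because its derivative is bounded in
  modulus by 2 * |u| * exp (- u^2) and 2 * |u| \<le> 1 + u^2 \<le> exp (u^2).\<close>

lemma abs_exp_minus_sq_diff_le:
  fixes \<alpha> \<beta> :: real
  shows "\<bar>exp (- \<alpha>\<^sup>2) - exp (- \<beta>\<^sup>2)\<bar> \<le> \<bar>\<alpha> - \<beta>\<bar>"
proof -
  have "norm (exp (- \<alpha>\<^sup>2) - exp (- \<beta>\<^sup>2)) \<le> 1 * norm (\<alpha> - \<beta>)"
  proof (rule field_differentiable_bound[where S=UNIV and f'="\<lambda>u. exp (- u\<^sup>2) * (- (2 * u))"])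
    fix u :: real
    show "((\<lambda>u. exp (- u\<^sup>2)) has_field_derivative exp (- u\<^sup>2) * (- (2 * u))) (at u within UNIV)"
      by (auto intro!: derivative_eq_intros)
    have "2 * \<bar>u\<bar> \<le> 1 + u\<^sup>2" using sum_squares_bound[of 1 "\<bar>u\<bar>"] by simp
    also have "\<dots> \<le> exp (u\<^sup>2)" by (rule exp_ge_add_one_self)
    finally show "norm (exp (- u\<^sup>2) * (- (2 * u))) \<le> 1"
      by (simp add: abs_mult exp_minus field_simps)
  qed auto
  then show ?thesis by simp
qed

text \<open>Up to normalisation \<open>gauss a\<close> is the square of exp (- (c * |x|)^2) with c =
  sqrt (pi / (2 * a)). In the difference of squares one factor is at most c * |t| and the other is a
  multiple of a sum of two values of \<open>gauss (2 * a)\<close>. Keeping the second factor makes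
  the error summable over infinitely many points, while c supplies the decay as a grows.\<close>

lemma gauss_shift_error:
  fixes x t :: "'a::euclidean_space"
  assumes "a > 0"
  shows "\<bar>gauss a (t + x) - gauss a x\<bar>
    \<le> sqrt (pi / (2 * a)) * norm t * sqrt 2 ^ DIM('a) * (gauss (2 * a) (t + x) + gauss (2 * a) x)"
proof -
  let ?c = "sqrt (pi / (2 * a))"
  define A B where "A = ?c * norm (t + x)" and "B = ?c * norm x"
  have c2: "?c\<^sup>2 = pi / (2 * a)" using assms by simp
  have g: "gauss a y = (exp (- (?c * norm y)\<^sup>2))\<^sup>2 / sqrt a ^ DIM('a)"
    and g2: "gauss (2 * a) y = exp (- (?c * norm y)\<^sup>2) / (sqrt 2 ^ DIM('a) * sqrt a ^ DIM('a))" for y :: 'a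
    using assms unfolding power_mult_distrib c2 gauss_def
    by (auto simp: exp_of_nat_mult[symmetric] real_sqrt_mult power_mult_distrib)
      (simp add: field_simps)?
  have "\<bar>exp (- A\<^sup>2) - exp (- B\<^sup>2)\<bar> \<le> \<bar>A - B\<bar>" by (rule abs_exp_minus_sq_diff_le)
  also have "\<bar>A - B\<bar> = ?c * \<bar>norm (t + x) - norm x\<bar>"
    using assms by (simp add: A_def B_def abs_mult right_diff_distrib[symmetric])
  also have "\<dots> \<le> ?c * norm t"
    using norm_triangle_ineq3[of "t + x" x] assms by (intro mult_left_mono) auto
  finally have AB: "\<bar>exp (- A\<^sup>2) - exp (- B\<^sup>2)\<bar> \<le> ?c * norm t" .
  have "\<bar>gauss a (t + x) - gauss a x\<bar> = \<bar>((exp (- A\<^sup>2))\<^sup>2 - (exp (- B\<^sup>2))\<^sup>2)\<bar> / sqrt a ^ DIM('a)"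
    using assms by (simp add: g A_def B_def diff_divide_distrib[symmetric])
  also have "\<dots> = \<bar>exp (- A\<^sup>2) - exp (- B\<^sup>2)\<bar> * (exp (- A\<^sup>2) + exp (- B\<^sup>2)) / sqrt a ^ DIM('a)"
    by (simp add: power2_eq_square square_diff_square_factored abs_mult mult.commute)
  also have "\<dots> \<le> ?c * norm t * (exp (- A\<^sup>2) + exp (- B\<^sup>2)) / sqrt a ^ DIM('a)"
    using assms by (intro divide_right_mono mult_right_mono AB add_nonneg_nonneg) auto
  also have "\<dots> = ?c * norm t * sqrt 2 ^ DIM('a) * (gauss (2 * a) (t + x) + gauss (2 * a) x)"
    unfolding A_def B_def g2 by (simp add: add_divide_distrib distrib_left mult.assoc)
  finally show ?thesis .
qed

text \<open>Since |x + u|^2 \<le> 2 * |x|^2 + 2 * |u|^2, doubling the parameter pays for moving the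
  argument by u. The condition a \<ge> 1 makes the constant independent of a.\<close>

lemma gauss_le_shifted:
  fixes x u :: "'a::euclidean_space"
  assumes "a \<ge> 1" "norm u \<le> D"
  shows "gauss a x \<le> sqrt 2 ^ DIM('a) * exp (pi * D\<^sup>2) * gauss (2 * a) (x + u)"
proof -
  have "(norm (x + u))\<^sup>2 \<le> (norm x + norm u)\<^sup>2"
    by (intro power_mono norm_triangle_ineq) auto
  also have "\<dots> \<le> 2 * (norm x)\<^sup>2 + 2 * (norm u)\<^sup>2"
    using sum_squares_bound[of "norm x" "norm u"] by (simp add: power2_sum)
  finally have 1: "(norm (x + u))\<^sup>2 / 2 - (norm x)\<^sup>2 \<le> (norm u)\<^sup>2" by simp
  have 2: "(norm u)\<^sup>2 \<le> D\<^sup>2" using assms by (intro power_mono) auto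
  have "- pi * (norm x)\<^sup>2 / a + pi * (norm (x + u))\<^sup>2 / (2 * a) = pi * ((norm (x + u))\<^sup>2 / 2 - (norm x)\<^sup>2) / a"
    using assms by (simp add: diff_divide_distrib right_diff_distrib)
  also have "\<dots> \<le> pi * D\<^sup>2 / a"
    using 1 2 assms by (intro divide_right_mono mult_left_mono) auto
  also have "\<dots> \<le> pi * D\<^sup>2" using assms mult_right_mono[of 1 a "D\<^sup>2"] by (simp add: field_simps)
  finally have "exp (- pi * (norm x)\<^sup>2 / a) \<le> exp (pi * D\<^sup>2 + (- pi * (norm (x + u))\<^sup>2 / (2 * a)))"
    by simp
  then show ?thesis
    using assms unfolding gauss_def exp_add by (simp add: real_sqrt_mult power_mult_distrib divide_right_mono)
qed

section \<open>Atoms of the Fourier transform\<close>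

text \<open>Dominated convergence with the Gaussian for q = 1 as majorant: as q grows the integrand
  shrinks to the indicator of k. The measure may be infinite, so integrability is a
  hypothesis.\<close>

lemma tendsto_integral_gaussian:
  fixes k :: "'a::euclidean_space"
  assumes sets: "sets \<nu> = sets borel"
    and int: "\<And>q. q > 0 \<Longrightarrow> integrable \<nu> (\<lambda>x. exp (- pi * q * (norm (x - k))\<^sup>2))"
  shows "((\<lambda>q. \<integral>x. exp (- pi * q * (norm (x - k))\<^sup>2) \<partial>\<nu>) \<longlongrightarrow> measure \<nu> {k}) at_top"
proof -
  have [measurable_cong]: "sets \<nu> = sets borel" by (rule sets)
  have *: "((\<lambda>q. \<integral>x. exp (- pi * q * (norm (x - k))\<^sup>2) \<partial>\<nu>) \<longlongrightarrow> (\<integral>x. indicat_real {k} x \<partial>\<nu>)) at_top"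
  proof (rule integral_dominated_convergence_at_top)
    show "integrable \<nu> (\<lambda>x. exp (- pi * 1 * (norm (x - k))\<^sup>2))" by (rule int) simp
    show "\<forall>\<^sub>F q in at_top. AE x in \<nu>. norm (exp (- pi * q * (norm (x - k))\<^sup>2)) \<le> exp (- pi * 1 * (norm (x - k))\<^sup>2)"
      using eventually_ge_at_top[of 1]
    proof eventually_elim
      case (elim q)
      have "pi * 1 * (norm (x - k))\<^sup>2 \<le> pi * q * (norm (x - k))\<^sup>2" for x
        using elim by (intro mult_right_mono mult_left_mono) auto
      then show ?case by simp
    qed
    show "AE x in \<nu>. ((\<lambda>q. exp (- pi * q * (norm (x - k))\<^sup>2)) \<longlongrightarrow> indicat_real {k} x) at_top"
    proof (rule AE_I2)
      fix x
      show "((\<lambda>q. exp (- pi * q * (norm (x - k))\<^sup>2)) \<longlongrightarrow> indicat_real {k} x) at_top"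
      proof (cases "x = k")
        case False
        define c where "c = pi * (norm (x - k))\<^sup>2"
        have "c > 0" using False by (simp add: c_def)
        then have "filterlim (\<lambda>q. q * c) at_top at_top"
          by (rule filterlim_at_top_mult_tendsto_pos[OF tendsto_const _ filterlim_ident])
        then have "((\<lambda>q. exp (- (q * c))) \<longlongrightarrow> 0) at_top"
          by (intro filterlim_compose[OF exp_at_bot] filterlim_compose[OF filterlim_uminus_at_bot_at_top])
        then show ?thesis using False by (simp add: c_def algebra_simps)
      qed simp
    qed
  qed measurable
  have "(\<integral>x. indicat_real {k} x \<partial>\<nu>) = measure \<nu> {k}"
    using sets_eq_imp_space_eq[OF sets] by simp
  with * show ?thesis by simp
qed

text \<open>The defining identity of the Fourier transform is tested on the Gaussian centred at k.
  Its transform is \<open>gauss q\<close> times a phase, whose real part is the cosine.\<close>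

lemma has_fourier_transform_gauss:
  fixes k :: "'a::euclidean_space"
  assumes ft: "has_fourier_transform M \<nu>" and sets: "sets M = sets borel" and q: "q > 0"
  shows "integrable M (gauss q)"
    and "(\<integral>y. cos (2 * pi * (k \<bullet> y)) * gauss q y \<partial>M) = (\<integral>x. exp (- pi * q * (norm (x - k))\<^sup>2) \<partial>\<nu>)"
    and "integrable \<nu> (\<lambda>x. exp (- pi * q * (norm (x - k))\<^sup>2))"
proof -
  have [measurable_cong]: "sets M = sets borel" by (rule sets)
  let ?f = "\<lambda>k x. complex_of_real (exp (- pi * q * (norm (x - k :: 'a))\<^sup>2))"
  have F: "fourier (?f k) = (\<lambda>y. exp (- 2 * pi * \<i> * of_real (k \<bullet> y)) * of_real (gauss q y))" for k
    using fourier_gaussian[OF q] by blast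
  have *: "integrable \<nu> (?f k)" "integrable M (fourier (?f k))" "(\<integral>x. ?f k x \<partial>\<nu>) = (\<integral>y. fourier (?f k) y \<partial>M)" for k
    using ft schwartz_gaussian[OF q, of k] unfolding has_fourier_transform_def by blast+
  \<comment> \<open>For the centre 0 the phase factor is 1, so the transform is the Gaussian
    itself.\<close>
  have "integrable M (\<lambda>y. Re (of_real (gauss q y)))"
    using *(2)[of 0] unfolding F by (intro integrable_Re) simp
  then show "integrable M (gauss q)" by simp
  have "integrable \<nu> (\<lambda>x. Re (?f k x))" by (intro integrable_Re *)
  then show "integrable \<nu> (\<lambda>x. exp (- pi * q * (norm (x - k))\<^sup>2))" by simp
  have "(\<integral>x. exp (- pi * q * (norm (x - k))\<^sup>2) \<partial>\<nu>) = Re (\<integral>x. ?f k x \<partial>\<nu>)" by simp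
  also have "\<dots> = (\<integral>y. Re (fourier (?f k) y) \<partial>M)"
    unfolding *(3) by (intro integral_Re[symmetric] *)
  also have "\<dots> = (\<integral>y. cos (2 * pi * (k \<bullet> y)) * gauss q y \<partial>M)"
    unfolding F by (simp add: Re_exp)
  finally show "(\<integral>y. cos (2 * pi * (k \<bullet> y)) * gauss q y \<partial>M) = (\<integral>x. exp (- pi * q * (norm (x - k))\<^sup>2) \<partial>\<nu>)" ..
qed

section \<open>Point measures\<close>

lemma Mp_sets: "\<xi> \<in> Mp \<Longrightarrow> sets \<xi> = sets borel"
  by (simp add: Mp_def)

lemma Mp_space: "\<xi> \<in> Mp \<Longrightarrow> space \<xi> = UNIV"
  using sets_eq_imp_space_eq[OF Mp_sets] by simp

lemma Mp_emeasure_Nats: "\<xi> \<in> Mp \<Longrightarrow> A \<in> sets borel \<Longrightarrow> bounded A \<Longrightarrow> emeasure \<xi> A \<in> \<nat>"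
  by (simp add: Mp_def)

lemma Mp_emeasure_finite: "\<xi> \<in> Mp \<Longrightarrow> A \<in> sets borel \<Longrightarrow> bounded A \<Longrightarrow> emeasure \<xi> A < \<infinity>"
  using Mp_emeasure_Nats[of \<xi> A] by (auto simp: Nats_def of_nat_less_top)

lemma CcD:
  assumes "f \<in> Cc"
  shows "continuous_on UNIV f" "bounded {x. f x \<noteq> 0}" "f \<in> borel_measurable borel"
  using assms by (auto simp: Cc_def intro: borel_measurable_continuous_onI bounded_subset[OF _ closure_subset])

lemma Cc_bounded:
  assumes "f \<in> Cc"
  shows "\<exists>K\<ge>0. \<forall>x. \<bar>f x\<bar> \<le> K"
proof -
  have "compact (f ` closure {x. f x \<noteq> 0})"
    using assms by (auto simp: Cc_def intro!: compact_continuous_image elim: continuous_on_subset)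
  then obtain K where K: "\<And>x. x \<in> closure {x. f x \<noteq> 0} \<Longrightarrow> \<bar>f x\<bar> \<le> K"
    by (metis bounded_iff compact_imp_bounded imageI real_norm_def)
  have "\<bar>f x\<bar> \<le> max K 0" for x
    using K[of x] closure_subset[of "{x. f x \<noteq> 0}"] by (cases "f x = 0") (auto simp: le_max_iff_disj)
  then show ?thesis by (intro exI[of _ "max K 0"]) auto
qed

lemma integrable_Cc:
  assumes \<xi>: "\<xi> \<in> Mp" and f: "f \<in> Cc"
  shows "integrable \<xi> f"
proof -
  have [measurable_cong]: "sets \<xi> = sets borel" using \<xi> by (rule Mp_sets)
  have [measurable]: "f \<in> borel_measurable borel" using CcD[OF f] by simp
  obtain K where K: "\<And>x. \<bar>f x\<bar> \<le> K" using Cc_bounded[OF f] by auto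
  have "emeasure \<xi> {x. f x \<noteq> 0} < \<infinity>" using CcD[OF f] by (intro Mp_emeasure_finite[OF \<xi>]) auto
  then show ?thesis
    by (intro integrableI_bounded_set[where A="{x. f x \<noteq> 0}" and B=K]) (auto simp: K)
qed

lemma sets_translate [simp, measurable_cong]: "sets (translate t \<xi>) = sets borel"
  by (simp add: translate_def)

lemma emeasure_translate:
  assumes "\<xi> \<in> Mp" "A \<in> sets borel"
  shows "emeasure (translate t \<xi>) A = emeasure \<xi> ((+) t -` A)"
proof -
  have [measurable_cong]: "sets \<xi> = sets borel" using assms(1) by (rule Mp_sets)
  show ?thesis
    using assms unfolding translate_def by (subst emeasure_distr) (auto simp: Mp_space)
qed

lemma nn_integral_translate:
  assumes "\<xi> \<in> Mp" and [measurable]: "f \<in> borel_measurable borel"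
  shows "(\<integral>\<^sup>+x. f x \<partial>translate t \<xi>) = (\<integral>\<^sup>+x. f (t + x) \<partial>\<xi>)"
proof -
  have [measurable_cong]: "sets \<xi> = sets borel" using assms(1) by (rule Mp_sets)
  show ?thesis unfolding translate_def by (subst nn_integral_distr) auto
qed

lemma integral_translate:
  fixes f :: "'a::euclidean_space \<Rightarrow> 'b::{banach, second_countable_topology}"
  assumes "\<xi> \<in> Mp" and [measurable]: "f \<in> borel_measurable borel"
  shows "(\<integral>x. f x \<partial>translate t \<xi>) = (\<integral>x. f (t + x) \<partial>\<xi>)"
proof -
  have [measurable_cong]: "sets \<xi> = sets borel" using assms(1) by (rule Mp_sets)
  show ?thesis unfolding translate_def by (subst integral_distr) auto
qed

lemma translate_in_Mp:
  assumes "\<xi> \<in> Mp"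
  shows "translate t \<xi> \<in> Mp"
proof -
  have "emeasure (translate t \<xi>) A \<in> \<nat>" if A: "A \<in> sets borel" "compact (closure A)" for A
  proof -
    have "(+) t -` A = (+) (- t) ` A"
      by (auto simp: image_iff) (metis add.commute diff_add_cancel uminus_add_conv_diff)
    then have "bounded ((+) t -` A)" using A by (simp add: bounded_translation_minus compact_closure)
    moreover have "(+) t -` A \<in> sets borel"
      using measurable_sets[of "(+) t" borel borel A] A by simp
    ultimately show ?thesis
      using A Mp_emeasure_Nats[OF assms] by (simp add: emeasure_translate[OF assms])
  qed
  then show ?thesis by (simp add: Mp_def)
qed

lemma translate_translate:
  assumes "\<xi> \<in> Mp"
  shows "translate s (translate t \<xi>) = translate (s + t) \<xi>"
proof -
  have [measurable_cong]: "sets \<xi> = sets borel" using assms by (rule Mp_sets)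
  have "(+) s \<circ> (+) t = (+) (s + t)" by (auto simp: add.assoc)
  then show ?thesis unfolding translate_def by (subst distr_distr) auto
qed

lemma translate_0: "\<xi> \<in> Mp \<Longrightarrow> translate 0 \<xi> = \<xi>"
  using distr_id2[of borel \<xi>] by (simp add: translate_def Mp_sets cong: distr_cong)

lemma open_cube [simp]: "open (cube r :: 'a::euclidean_space set)"
proof -
  have "cube r = (\<Inter>b\<in>(Basis::'a set). {x. \<bar>x \<bullet> b\<bar> < r / 2})" by (auto simp: cube_def)
  then show ?thesis
    by (auto intro!: open_INT open_Collect_less continuous_intros)
qed

lemma zero_in_cube: "r > 0 \<Longrightarrow> 0 \<in> cube r"
  by (simp add: cube_def)

lemma uminus_cube_iff [simp]: "- x \<in> cube r \<longleftrightarrow> x \<in> cube r"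
  by (simp add: cube_def)

lemma bounded_cube [simp]: "bounded (cube r :: 'a::euclidean_space set)"
proof (rule boundedI)
  fix x :: 'a assume "x \<in> cube r"
  then have "(\<Sum>b\<in>Basis. \<bar>x \<bullet> b\<bar>) \<le> (\<Sum>b\<in>(Basis::'a set). r / 2)"
    by (intro sum_mono) (auto simp: cube_def less_imp_le)
  then show "norm x \<le> DIM('a) * (r / 2)" using norm_le_l1[of x] by simp
qed

lemma Mp_cubeD: "\<xi> \<in> Mp_cube r \<Longrightarrow> \<xi> \<in> Mp"
  by (simp add: Mp_cube_def)

lemma Mp_cube_le_1: "\<xi> \<in> Mp_cube r \<Longrightarrow> emeasure \<xi> ((+) a ` cube r) \<le> 1"
  by (simp add: Mp_cube_def)

section \<open>Uniformly discrete configurations as countable point sets\<close>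

text \<open>The mass of a point is a natural number, and it is at most 1 because the cube centred at
  the point contains it.\<close>

lemma emeasure_singleton_cases:
  assumes "\<xi> \<in> Mp_cube r" "r > 0"
  shows "emeasure \<xi> {x} = 0 \<or> emeasure \<xi> {x} = 1"
proof -
  have \<xi>: "\<xi> \<in> Mp" using assms by (simp add: Mp_cubeD)
  have "emeasure \<xi> {x} \<le> emeasure \<xi> ((+) x ` cube r)"
    using zero_in_cube[OF assms(2)]
    by (intro emeasure_mono) (auto simp: Mp_sets[OF \<xi>] intro!: borel_open open_translation image_eqI[of _ _ 0])
  also have "\<dots> \<le> 1" using assms by (simp add: Mp_cube_le_1)
  finally have le: "emeasure \<xi> {x} \<le> 1" .
  obtain n where n: "emeasure \<xi> {x} = of_nat n" using Mp_emeasure_Nats[OF \<xi>, of "{x}"] by (auto simp: Nats_def)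
  with le have "of_nat n \<le> (of_nat 1 :: ennreal)" by simp
  then have "n \<le> 1" by (simp only: of_nat_le_iff)
  then have "n = 0 \<or> n = 1" by auto
  then show ?thesis using n by auto
qed

lemma emeasure_singleton_points:
  assumes "\<xi> \<in> Mp_cube r" "r > 0"
  shows "emeasure \<xi> {x} = indicator (points \<xi>) x"
  using emeasure_singleton_cases[OF assms, of x] by (auto simp: points_def indicator_def)

text \<open>The masses of shrinking balls decrease to the mass 0 of the centre. Being natural
  numbers, they are 0 as soon as they fall below 1.\<close>

lemma null_neighbourhood:
  assumes \<xi>: "\<xi> \<in> Mp" and x: "x \<notin> points \<xi>"
  shows "\<exists>U. open U \<and> x \<in> U \<and> emeasure \<xi> U = 0"
proof -
  define A where "A n = ball x (1 / Suc n)" for n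
  have sets: "A n \<in> sets \<xi>" for n by (simp add: A_def Mp_sets[OF \<xi>])
  have "decseq A" unfolding A_def by (intro decseq_SucI subset_ball) (simp add: field_simps)
  moreover have "emeasure \<xi> (A n) \<noteq> \<infinity>" for n
    using Mp_emeasure_finite[OF \<xi>, of "A n"] by (simp add: A_def less_top)
  ultimately have "(\<lambda>n. emeasure \<xi> (A n)) \<longlonglongrightarrow> emeasure \<xi> (\<Inter>n. A n)"
    using sets by (intro Lim_emeasure_decseq) auto
  moreover have "(\<Inter>n. A n) = {x}"
  proof -
    have "y = x" if "\<And>n. dist x y < 1 / Suc n" for y
    proof (rule ccontr)
      assume "y \<noteq> x"
      then obtain n where "1 / Suc n < dist x y" using nat_approx_posE[of "dist x y"] by auto
      with that[of n] show False by simp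
    qed
    then show ?thesis by (auto simp: A_def)
  qed
  ultimately have "(\<lambda>n. emeasure \<xi> (A n)) \<longlonglongrightarrow> 0" using x by (simp add: points_def)
  then have "eventually (\<lambda>n. emeasure \<xi> (A n) < 1) sequentially" by (rule order_tendstoD) simp
  then obtain n where n: "emeasure \<xi> (A n) < 1" by (auto simp: eventually_sequentially)
  obtain m where m: "emeasure \<xi> (A n) = of_nat m"
    using Mp_emeasure_Nats[OF \<xi>, of "A n"] by (auto simp: Nats_def A_def)
  with n have "of_nat m < (of_nat 1 :: ennreal)" by simp
  then have "m = 0" by (simp only: of_nat_less_iff)
  then show ?thesis using m by (intro exI[of _ "A n"]) (simp add: A_def)
qed

text \<open>The complement of the point set is the union of all open null sets. By the Lindelof
  property countably many of them suffice, so this union is itself an open null set.\<close>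

lemma AE_points:
  assumes \<xi>: "\<xi> \<in> Mp"
  shows "closed (points \<xi>)" "AE x in \<xi>. x \<in> points \<xi>"
proof -
  define F where "F = {U. open U \<and> emeasure \<xi> U = 0}"
  obtain F' where F': "F' \<subseteq> F" "countable F'" "\<Union>F' = \<Union>F"
    using Lindelof[of F] by (auto simp: F_def)
  have eq: "- points \<xi> = \<Union>F"
  proof (intro equalityI subsetI)
    fix x assume "x \<in> \<Union>F"
    then obtain U where "open U" "emeasure \<xi> U = 0" "x \<in> U" by (auto simp: F_def)
    then have "emeasure \<xi> {x} \<le> emeasure \<xi> U" by (intro emeasure_mono) (auto simp: Mp_sets[OF \<xi>])
    then show "x \<in> - points \<xi>" using \<open>emeasure \<xi> U = 0\<close> by (simp add: points_def)
  qed (use null_neighbourhood[OF \<xi>] in \<open>auto simp: F_def\<close>)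
  have "open (\<Union>F)" by (auto simp: F_def)
  then show "closed (points \<xi>)" using eq by (simp add: closed_def)
  have "(\<Union>U\<in>F'. U) \<in> null_sets \<xi>"
    using F' by (intro null_sets_UN') (auto simp: F_def null_sets_def Mp_sets[OF \<xi>])
  then have "emeasure \<xi> (- points \<xi>) = 0" using F' eq by auto
  moreover have "- points \<xi> \<in> sets \<xi>" using \<open>open (\<Union>F)\<close> eq by (simp add: Mp_sets[OF \<xi>])
  ultimately show "AE x in \<xi>. x \<in> points \<xi>"
    by (intro AE_I[of _ _ "- points \<xi>"]) auto
qed

lemma points_cube_eq:
  assumes \<xi>: "\<xi> \<in> Mp_cube r" "r > 0" and xy: "x \<in> points \<xi>" "y \<in> points \<xi>"
    "x \<in> (+) a ` cube r" "y \<in> (+) a ` cube r"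
  shows "x = y"
proof (rule ccontr)
  assume ne: "x \<noteq> y"
  have Mp: "\<xi> \<in> Mp" using \<xi> by (simp add: Mp_cubeD)
  have "emeasure \<xi> {x, y} = emeasure \<xi> {x} + emeasure \<xi> {y}"
    using ne plus_emeasure[of "{x}" \<xi> "{y}"] by (simp add: Mp_sets[OF Mp] insert_commute)
  also have "\<dots> = 2" using xy emeasure_singleton_points[OF \<xi>] by simp
  finally have "2 \<le> emeasure \<xi> ((+) a ` cube r)"
    using xy emeasure_mono[of "{x, y}" "(+) a ` cube r" \<xi>] by (simp add: Mp_sets[OF Mp] borel_open open_translation)
  also have "\<dots> \<le> 1" using \<xi> by (simp add: Mp_cube_le_1)
  finally show False by simp
qed

text \<open>By the Lindelof property countably many translated cubes cover the space, and each
  contains at most one point.\<close>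

lemma countable_points:
  fixes \<xi> :: "'a::euclidean_space measure"
  assumes \<xi>: "\<xi> \<in> Mp_cube r" "r > 0"
  shows "countable (points \<xi>)"
proof -
  obtain F' where F': "F' \<subseteq> range (\<lambda>a::'a. (+) a ` cube r)" "countable F'" "\<Union>F' = \<Union>(range (\<lambda>a::'a. (+) a ` cube r))"
    by (rule Lindelof[of "range (\<lambda>a::'a. (+) a ` cube r)"]) (auto intro: open_translation)
  have "x \<in> \<Union>F'" for x :: 'a
    using zero_in_cube[OF \<xi>(2)] unfolding F'(3) by (auto intro!: exI[of _ x] image_eqI[of _ _ 0])
  then have sub: "points \<xi> \<subseteq> (\<Union>C\<in>F'. points \<xi> \<inter> C)" by blast
  have "countable (points \<xi> \<inter> C)" if C: "C \<in> F'" for C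
  proof -
    obtain a where "C = (+) a ` cube r" using C F'(1) by blast
    then have "\<And>x y. x \<in> points \<xi> \<inter> C \<Longrightarrow> y \<in> points \<xi> \<inter> C \<Longrightarrow> x = y"
      using points_cube_eq[OF \<xi>] by blast
    then have "points \<xi> \<inter> C = {} \<or> (\<exists>x. points \<xi> \<inter> C = {x})" by blast
    then show ?thesis by auto
  qed
  then have "countable (\<Union>C\<in>F'. points \<xi> \<inter> C)" using F'(2) by (intro countable_UN)
  then show ?thesis using sub by (rule countable_subset[rotated])
qed

text \<open>A configuration lives on a countable set of atoms of mass 1, so it is counting measure
  on that set; the image under the identity only changes the \<sigma>-algebra. Integrals thereby
  become sums over points, which can be reindexed by bijections.\<close>

lemma Mp_cube_eq_distr:
  assumes \<xi>: "\<xi> \<in> Mp_cube r" "r > 0"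
  shows "\<xi> = distr (count_space (points \<xi>)) borel (\<lambda>x. x)"
proof (rule measure_eqI)
  have Mp: "\<xi> \<in> Mp" using \<xi> by (simp add: Mp_cubeD)
  show "sets \<xi> = sets (distr (count_space (points \<xi>)) borel (\<lambda>x. x))" by (simp add: Mp_sets[OF Mp])
  fix A assume A: "A \<in> sets \<xi>"
  have pts: "points \<xi> \<in> sets borel" using AE_points[OF Mp] by (simp add: borel_closed)
  have "emeasure \<xi> A = emeasure \<xi> (A \<inter> points \<xi>)"
    using A pts AE_points(2)[OF Mp] by (intro emeasure_eq_AE) (auto simp: Mp_sets[OF Mp])
  also have "\<dots> = (\<integral>\<^sup>+x. emeasure \<xi> {x} \<partial>count_space (A \<inter> points \<xi>))"
    using countable_points[OF \<xi>] by (intro emeasure_countable_singleton) (auto simp: Mp_sets[OF Mp])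
  also have "\<dots> = (\<integral>\<^sup>+x. 1 \<partial>count_space (A \<inter> points \<xi>))"
    by (intro nn_integral_cong) (simp add: emeasure_singleton_points[OF \<xi>])
  also have "\<dots> = emeasure (count_space (points \<xi>)) (A \<inter> points \<xi>)"
    by (cases "finite (A \<inter> points \<xi>)") (auto simp: emeasure_count_space_finite emeasure_count_space_infinite)
  also have "\<dots> = emeasure (distr (count_space (points \<xi>)) borel (\<lambda>x. x)) A"
    using A by (subst emeasure_distr) (auto simp: Mp_sets[OF Mp])
  finally show "emeasure \<xi> A = emeasure (distr (count_space (points \<xi>)) borel (\<lambda>x. x)) A" .
qed

lemma nn_integral_points:
  assumes \<xi>: "\<xi> \<in> Mp_cube r" "r > 0" and f: "f \<in> borel_measurable borel"
  shows "(\<integral>\<^sup>+x. f x \<partial>\<xi>) = (\<integral>\<^sup>+x. f x \<partial>count_space (points \<xi>))"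
  by (subst Mp_cube_eq_distr[OF \<xi>], subst nn_integral_distr) (auto simp: f)

lemma integral_points:
  fixes f :: "'a::euclidean_space \<Rightarrow> 'b::{banach, second_countable_topology}"
  assumes \<xi>: "\<xi> \<in> Mp_cube r" "r > 0" and f: "f \<in> borel_measurable borel"
  shows "(\<integral>x. f x \<partial>\<xi>) = (\<integral>x. f x \<partial>count_space (points \<xi>))"
  by (subst Mp_cube_eq_distr[OF \<xi>], subst integral_distr) (auto simp: f)

lemma sigma_finite_Mp:
  fixes \<xi> :: "'a::euclidean_space measure"
  assumes "\<xi> \<in> Mp"
  shows "sigma_finite_measure \<xi>"
proof
  show "\<exists>A. countable A \<and> A \<subseteq> sets \<xi> \<and> \<Union> A = space \<xi> \<and> (\<forall>a\<in>A. emeasure \<xi> a \<noteq> \<infinity>)"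
  proof (intro exI[of _ "range (\<lambda>n. ball (0::'a) (real n))"] conjI ballI)
    show "\<Union> (range (\<lambda>n. ball (0::'a) (real n))) = space \<xi>"
      using reals_Archimedean2 by (auto simp: Mp_space[OF assms])
    fix a assume "a \<in> range (\<lambda>n. ball (0::'a) (real n))"
    then show "emeasure \<xi> a \<noteq> \<infinity>" using Mp_emeasure_finite[OF assms, of a] by (auto simp: less_top)
  qed (auto simp: Mp_sets[OF assms])
qed

text \<open>Needed because \<open>palm_measure\<close> uses an unordered sum over the whole
  averaging set, which is typically uncountable. Both sides are the supremum of the finite partial
  sums once the terms equal to 0 are discarded.\<close>

lemma infsum_ennreal_eq_nn_integral:
  fixes f :: "'a \<Rightarrow> ennreal"
  assumes "countable {x \<in> A. f x \<noteq> 0}"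
  shows "infsum f A = (\<integral>\<^sup>+x. f x \<partial>count_space A)"
proof -
  define S where "S = {x \<in> A. f x \<noteq> 0}"
  have "infsum f A = infsum f S" by (intro infsum_cong_neutral) (auto simp: S_def)
  moreover have "(\<integral>\<^sup>+x. f x \<partial>count_space A) = (\<integral>\<^sup>+x. f x \<partial>count_space S)"
    by (intro nn_integral_count_space_eq) (auto simp: S_def)
  moreover have "infsum f S = (\<integral>\<^sup>+x. f x \<partial>count_space S)"
  proof (rule antisym)
    have "infsum f S = (SUP F\<in>{F. finite F \<and> F \<subseteq> S}. sum f F)" by (rule nonneg_infsum_complete) simp
    also have "\<dots> \<le> (\<integral>\<^sup>+x. f x \<partial>count_space S)"
    proof (rule SUP_least)
      fix F assume "F \<in> {F. finite F \<and> F \<subseteq> S}"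
      then have F: "finite F" "F \<subseteq> S" by auto
      have "sum f F = (\<integral>\<^sup>+x. f x * indicator F x \<partial>count_space S)"
        using F by (subst nn_integral_count_space'[of F]) (auto simp: indicator_def intro!: sum.cong)
      also have "\<dots> \<le> (\<integral>\<^sup>+x. f x \<partial>count_space S)" by (intro nn_integral_mono) (auto simp: indicator_def)
      finally show "sum f F \<le> (\<integral>\<^sup>+x. f x \<partial>count_space S)" .
    qed
    finally show "infsum f S \<le> (\<integral>\<^sup>+x. f x \<partial>count_space S)" .
  next
    show "(\<integral>\<^sup>+x. f x \<partial>count_space S) \<le> infsum f S"
    proof (cases "S = {}")
      case False
      \<comment> \<open>Images of initial segments of an enumeration. If S is finite the enumeration
        repeats elements, which is harmless since \<open>F n\<close> is a set.\<close>
      define F where "F n = from_nat_into S ` {..<n}" for n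
      have F: "finite (F n)" "F n \<subseteq> S" for n
        using from_nat_into[OF False] by (auto simp: F_def)
      have inc: "incseq F" by (auto simp: F_def incseq_def)
      have "S \<subseteq> (\<Union>n. F n)"
      proof
        fix x assume "x \<in> S"
        then obtain m where "x = from_nat_into S m"
          using assms from_nat_into_surj[of S x] unfolding S_def by metis
        then show "x \<in> (\<Union>n. F n)" by (auto simp: F_def intro!: exI[of _ "Suc m"])
      qed
      have "f x = (SUP n. f x * indicator (F n) x)" if x: "x \<in> S" for x
      proof (rule antisym)
        obtain m where "x \<in> F m" using \<open>S \<subseteq> (\<Union>n. F n)\<close> x by auto
        then show "f x \<le> (SUP n. f x * indicator (F n) x)" by (intro SUP_upper2[of m]) auto
        show "(SUP n. f x * indicator (F n) x) \<le> f x" by (intro SUP_least) (simp add: indicator_def)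
      qed
      then have "(\<integral>\<^sup>+x. f x \<partial>count_space S) = (\<integral>\<^sup>+x. (SUP n. f x * indicator (F n) x) \<partial>count_space S)"
        by (intro nn_integral_cong) simp
      also have "\<dots> = (SUP n. \<integral>\<^sup>+x. f x * indicator (F n) x \<partial>count_space S)"
        using inc by (intro nn_integral_monotone_convergence_SUP)
          (auto simp: incseq_def le_fun_def indicator_def)
      also have "\<dots> \<le> (SUP F\<in>{F. finite F \<and> F \<subseteq> S}. sum f F)"
      proof (rule SUP_least)
        fix n
        have "(\<integral>\<^sup>+x. f x * indicator (F n) x \<partial>count_space S) = sum f (F n)"
          using F[of n] by (subst nn_integral_count_space'[of "F n"]) (auto simp: indicator_def intro!: sum.cong)
        then show "(\<integral>\<^sup>+x. f x * indicator (F n) x \<partial>count_space S) \<le> (SUP F\<in>{F. finite F \<and> F \<subseteq> S}. sum f F)"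
          using F[of n] by (auto intro!: SUP_upper)
      qed
      also have "\<dots> = infsum f S" by (rule nonneg_infsum_complete[symmetric]) simp
      finally show ?thesis .
    qed (simp add: nn_integral_empty)
  qed
  ultimately show ?thesis by simp
qed

section \<open>Measurability for the vague topology\<close>


lemma zero_in_Cc: "(\<lambda>x. 0) \<in> Cc"
  by (simp add: Cc_def)

lemma openin_vague_subset: "openin vague_topology U \<Longrightarrow> U \<subseteq> Mp"
  using openin_subset[of vague_topology U] by (auto simp: vague_topology_def)

lemma topspace_vague [simp]: "topspace vague_topology = (Mp :: 'a::euclidean_space measure set)"
proof
  show "topspace vague_topology \<subseteq> (Mp :: 'a measure set)" by (auto simp: vague_topology_def)
  have "(Mp :: 'a measure set) \<in> {{\<xi> \<in> Mp. (\<integral>x. f x \<partial>\<xi>) \<in> U} |f U. f \<in> Cc \<and> open U}"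
    by (rule CollectI, rule exI[of _ "\<lambda>x. 0"], rule exI[of _ UNIV]) (simp add: zero_in_Cc)
  then show "(Mp :: 'a measure set) \<subseteq> topspace vague_topology"
    unfolding vague_topology_def topology_generated_by_topspace by blast
qed

lemma space_vague_borel [simp]: "space vague_borel = Mp"
  unfolding vague_borel_def by (rule space_measure_of) (auto dest: openin_vague_subset)

lemma sets_vague_borel_open: "openin vague_topology U \<Longrightarrow> U \<in> sets vague_borel"
  unfolding vague_borel_def by (subst sets_measure_of) (auto dest: openin_vague_subset)

lemma sets_vague_borel_closed: "closedin vague_topology X \<Longrightarrow> X \<in> sets vague_borel"
  using sets.compl_sets[OF sets_vague_borel_open[of "Mp - X"]]
  by (auto simp: closedin_def double_diff)

lemma openin_vague_basic: "f \<in> Cc \<Longrightarrow> open U \<Longrightarrow> openin vague_topology {\<xi> \<in> Mp. (\<integral>x. f x \<partial>\<xi>) \<in> U}"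
  unfolding vague_topology_def by (rule topology_generated_by_Basis) blast

lemma measurable_evaluation:
  assumes "f \<in> Cc"
  shows "(\<lambda>\<xi>. \<integral>x. f x \<partial>\<xi>) \<in> borel_measurable vague_borel"
proof (rule borel_measurableI)
  fix S :: "real set" assume "open S"
  then show "(\<lambda>\<xi>. \<integral>x. f x \<partial>\<xi>) -` S \<inter> space vague_borel \<in> sets vague_borel"
    using sets_vague_borel_open[OF openin_vague_basic[OF assms]] by (simp add: vimage_def Collect_conj_eq Int_commute)
qed

section \<open>A countable family of test functions\<close>

lemma Cc_I: "continuous_on UNIV f \<Longrightarrow> bounded {x. f x \<noteq> 0} \<Longrightarrow> f \<in> Cc"
  by (simp add: Cc_def compact_closure)

text \<open>For positive s, a cone with apex over p, height q and support radius 1 / s.\<close>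

definition tent :: "'a::euclidean_space \<Rightarrow> real \<Rightarrow> real \<Rightarrow> 'a \<Rightarrow> real" where
  "tent p q s x = max 0 (q * (1 - s * dist x p))"

lemma tent_in_Cc:
  assumes "q \<ge> 0" "s > 0"
  shows "tent p q s \<in> Cc"
proof (rule Cc_I)
  show "continuous_on UNIV (tent p q s)" unfolding tent_def by (intro continuous_intros)
  have "dist p x \<le> 1 / s" if "tent p q s x \<noteq> 0" for x
  proof (rule ccontr)
    assume "\<not> dist p x \<le> 1 / s"
    then have "1 - s * dist x p \<le> 0" using assms by (simp add: dist_commute field_simps)
    then have "q * (1 - s * dist x p) \<le> 0" using assms by (simp add: mult_nonneg_nonpos)
    then show False using that by (simp add: tent_def)
  qed
  then show "bounded {x. tent p q s x \<noteq> 0}" unfolding bounded_def by blast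
qed

lemma Cc_max: 
  assumes "f \<in> Cc" "g \<in> Cc"
  shows "(\<lambda>x. max (f x) (g x)) \<in> Cc"
proof (rule Cc_I)
  show "continuous_on UNIV (\<lambda>x. max (f x) (g x))" using CcD(1)[OF assms(1)] CcD(1)[OF assms(2)] by (intro continuous_intros)
  show "bounded {x. max (f x) (g x) \<noteq> 0}"
    by (rule bounded_subset[of "{x. f x \<noteq> 0} \<union> {x. g x \<noteq> 0}"]) (use CcD(2)[OF assms(1)] CcD(2)[OF assms(2)] in \<open>auto simp: max_def\<close>)
qed

lemma Cc_add: 
  assumes "f \<in> Cc" "g \<in> Cc"
  shows "(\<lambda>x. f x + g x) \<in> Cc"
proof (rule Cc_I)
  show "continuous_on UNIV (\<lambda>x. f x + g x)" using CcD(1)[OF assms(1)] CcD(1)[OF assms(2)] by (intro continuous_intros)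
  show "bounded {x. f x + g x \<noteq> 0}"
    by (rule bounded_subset[of "{x. f x \<noteq> 0} \<union> {x. g x \<noteq> 0}"]) (use CcD(2)[OF assms(1)] CcD(2)[OF assms(2)] in auto)
qed

lemma Cc_uminus: 
  assumes "f \<in> Cc"
  shows "(\<lambda>x. - f x) \<in> Cc"
  using CcD[OF assms] by (intro Cc_I) (auto intro: continuous_intros)

definition sup_list :: "('a \<Rightarrow> real) list \<Rightarrow> 'a \<Rightarrow> real" where
  "sup_list hs x = foldr (\<lambda>h m. max (h x) m) hs 0"

lemma sup_list_simps [simp]:
  "sup_list [] x = 0" "sup_list (h # hs) x = max (h x) (sup_list hs x)"
  by (simp_all add: sup_list_def)

lemma sup_list_nonneg: "sup_list hs x \<ge> 0"
  by (induction hs) (auto simp: le_max_iff_disj)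

lemma sup_list_le: "(\<And>h. h \<in> set hs \<Longrightarrow> h x \<le> c) \<Longrightarrow> 0 \<le> c \<Longrightarrow> sup_list hs x \<le> c"
  by (induction hs) auto

lemma sup_list_ge: "h \<in> set hs \<Longrightarrow> h x \<le> sup_list hs x"
  by (induction hs) (auto simp: le_max_iff_disj)

lemma sup_list_in_Cc: "(\<And>h. h \<in> set hs \<Longrightarrow> h \<in> Cc) \<Longrightarrow> sup_list hs \<in> Cc"
proof (induction hs)
  case Nil
  then show ?case using zero_in_Cc by (simp add: sup_list_def)
next
  case (Cons h hs)
  have "sup_list (h # hs) = (\<lambda>x. max (h x) (sup_list hs x))" by auto
  then show ?case using Cons by (auto intro!: Cc_max)
qed

text \<open>
  Finite maxima of tents with rational data. The tents below a nonnegative \<open>f \<in> Cc\<close> have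
  supremum \<open>f\<close>, so countably many evaluations already generate the vague topology.
\<close>

lemma countable_approximating_family:
  obtains F :: "('a::euclidean_space \<Rightarrow> real) set" where "countable F" "F \<subseteq> Cc" "F \<noteq> {}"
    "\<forall>f\<in>Cc. (\<forall>x. 0 \<le> f x) \<longrightarrow>
       (\<exists>m::nat \<Rightarrow> 'a \<Rightarrow> real. range m \<subseteq> F \<and> (\<forall>n x. 0 \<le> m n x \<and> m n x \<le> f x) \<and> (\<forall>x. (\<lambda>n. m n x) \<longlonglongrightarrow> f x))"
    "\<forall>f\<in>Cc. \<exists>h\<in>F. \<forall>x. f x \<le> h x"
proof -
  obtain D0 :: "'a set" where D0: "countable D0" "\<And>U. open U \<Longrightarrow> U \<noteq> {} \<Longrightarrow> \<exists>d\<in>D0. d \<in> U"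
    using countable_dense_setE by blast
  \<comment> \<open>The origin is added because the tent of height 0 and the wide tents used for
    domination are centred there.\<close>
  define D where "D = insert 0 D0"
  have D: "countable D" "0 \<in> D" using D0 by (auto simp: D_def)
  have dense: "\<exists>p\<in>D. dist x p < \<epsilon>" if "\<epsilon> > 0" for x :: 'a and \<epsilon>
    using D0(2)[of "ball x \<epsilon>"] that by (auto simp: D_def)
  define T where "T = (\<lambda>(p, q, s). tent p q s) ` (D \<times> (\<rat> \<inter> {0..}) \<times> (\<rat> \<inter> {0<..}))"
  have T: "countable T" unfolding T_def using D by (intro countable_image countable_SIGMA) (auto intro: countable_rat countable_subset)
  have T_Cc: "T \<subseteq> Cc" by (auto simp: T_def tent_in_Cc)
  define F where "F = sup_list ` lists T"
  have "countable F" unfolding F_def using T by (intro countable_image countable_lists)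
  moreover have "F \<subseteq> Cc" using T_Cc by (auto simp: F_def intro!: sup_list_in_Cc)
  moreover have "F \<noteq> {}" by (auto simp: F_def)
  moreover have "\<exists>m::nat \<Rightarrow> 'a \<Rightarrow> real. range m \<subseteq> F \<and> (\<forall>n x. 0 \<le> m n x \<and> m n x \<le> f x) \<and> (\<forall>x. (\<lambda>n. m n x) \<longlonglongrightarrow> f x)"
    if f: "f \<in> Cc" and nonneg: "\<And>x. 0 \<le> f x" for f
  proof -
    \<comment> \<open>Near x, within distance \<delta>, f exceeds a rational q > c. A tent of height
      q centred at p, with p closer to x than \<delta> / 2 and with radius below \<delta> / 2, stays
      below f: inside the \<delta>-ball because f > q there, and elsewhere because the tent
      vanishes. The second condition on p, distance below (1 - c / q) / n, keeps the tent above c at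
      x.\<close>
    have approx: "\<exists>h\<in>T. (\<forall>y. h y \<le> f y) \<and> c < h x" if c: "0 \<le> c" "c < f x" for c x
    proof -
      obtain q where q: "q \<in> \<rat>" "c < q" "q < f x" using Rats_dense_in_real[OF c(2)] by blast
      have "isCont f x" using CcD(1)[OF f] by (simp add: continuous_on_eq_continuous_at)
      then have "eventually (\<lambda>y. q < f y) (at x)" using q(3) by (intro order_tendstoD) (auto simp: isCont_def)
      then obtain \<delta> where \<delta>: "\<delta> > 0" "\<And>y. dist y x < \<delta> \<Longrightarrow> q < f y"
        using q(3) by (auto simp: eventually_at) (metis (full_types))
      obtain n where n: "real n > 2 / \<delta>" using reals_Archimedean2 by blast
      have n0: "real n > 0" using n \<delta> by (smt (verit) divide_nonneg_nonneg)
      have n1: "1 / real n < \<delta> / 2" using n n0 \<delta> by (simp add: field_simps)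
      have "min (\<delta> / 2) ((1 - c / q) / real n) > 0" using \<delta> q c n0 by (simp add: field_simps)
      then obtain p where p: "p \<in> D" "dist x p < \<delta> / 2" "dist x p < (1 - c / q) / real n"
        using dense[of _ x] by (metis min_less_iff_conj)
      have "tent p q (real n) \<in> T" unfolding T_def
        by (rule image_eqI[of _ _ "(p, q, real n)"]) (use p q c n0 in auto)
      moreover have "tent p q (real n) y \<le> f y" for y
      proof (cases "real n * dist y p < 1")
        case True
        have "dist y p < 1 / real n" using True n0 by (simp add: field_simps)
        then have "dist y x < \<delta>" using n1 p(2) dist_triangle[of y x p] by (simp add: dist_commute)
        then have "q < f y" by (rule \<delta>)
        moreover have "q * (1 - real n * dist y p) \<le> q * 1" using q c n0 by (intro mult_left_mono) auto
        ultimately show ?thesis using nonneg[of y] by (simp add: tent_def)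
      next
        case False
        then have "q * (1 - real n * dist y p) \<le> 0" using q c by (intro mult_nonneg_nonpos) auto
        then show ?thesis using nonneg[of y] by (simp add: tent_def)
      qed
      moreover have "c < tent p q (real n) x"
      proof -
        have "real n * dist x p < 1 - c / q" using p(3) n0 by (simp add: field_simps)
        then have "q * (real n * dist x p) < q * (1 - c / q)" using q c by (intro mult_strict_left_mono) auto
        also have "\<dots> = q - c" using q c by (simp add: field_simps)
        finally have "c < q * (1 - real n * dist x p)" by (simp add: right_diff_distrib)
        then show ?thesis by (simp add: tent_def)
      qed
      ultimately show ?thesis by blast
    qed
    define H where "H = {h \<in> T. \<forall>y. h y \<le> f y}"
    have Hc: "countable H" using T by (auto simp: H_def intro: countable_subset)
    have "tent 0 0 1 \<in> H" unfolding H_def T_def using D nonneg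
      by (auto simp: tent_def intro!: image_eqI[of _ _ "(0, 0, 1)"])
    then have Hne: "H \<noteq> {}" by auto
    define m where "m n = sup_list (map (from_nat_into H) [0..<n])" for n
    have inH: "from_nat_into H i \<in> H" for i by (rule from_nat_into[OF Hne])
    have mem: "set (map (from_nat_into H) [0..<n]) \<subseteq> H" for n using inH by auto
    have le: "m n x \<le> f x" for n x
      unfolding m_def using mem[of n] nonneg by (intro sup_list_le) (auto simp: H_def)
    have "range m \<subseteq> F"
    proof
      fix g assume "g \<in> range m"
      then obtain n where "g = sup_list (map (from_nat_into H) [0..<n])" by (auto simp: m_def)
      moreover have "map (from_nat_into H) [0..<n] \<in> lists T"
        using mem[of n] by (intro in_listsI) (auto simp: H_def)
      ultimately show "g \<in> F" unfolding F_def by blast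
    qed
    moreover have "(\<lambda>n. m n x) \<longlonglongrightarrow> f x" for x
    proof (rule order_tendstoI)
      fix a assume a: "a < f x"
      show "eventually (\<lambda>n. a < m n x) sequentially"
      proof (cases "a < 0")
        case True
        then show ?thesis by (intro always_eventually allI) (simp add: m_def less_le_trans[OF True sup_list_nonneg])
      next
        case False
        then obtain h where "h \<in> H" "a < h x" using approx[of a x] a by (auto simp: H_def)
        then obtain i where i: "a < from_nat_into H i x" using from_nat_into_surj[OF Hc] by blast
        have "a < m n x" if n: "n > i" for n
        proof -
          have "from_nat_into H i x \<le> m n x" unfolding m_def using n by (intro sup_list_ge) auto
          with i show ?thesis by simp
        qed
        then show ?thesis by (rule eventually_mono[OF eventually_gt_at_top[of i]])
      qed
    next
      fix a assume "f x < a"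
      then show "eventually (\<lambda>n. m n x < a) sequentially" using le[of _ x] by (intro always_eventually allI) (rule le_less_trans)
    qed
    ultimately show ?thesis using le sup_list_nonneg by (intro exI[of _ m]) (auto simp: m_def)
  qed
  moreover have "\<exists>h\<in>F. \<forall>x. f x \<le> h x" if f: "f \<in> Cc" for f
  proof -
    obtain K where K: "\<And>x. \<bar>f x\<bar> \<le> K" using Cc_bounded[OF f] by auto
    obtain R where R: "R > 0" "\<And>x. f x \<noteq> 0 \<Longrightarrow> norm x \<le> R"
      using CcD(2)[OF f] unfolding bounded_pos by auto
    \<comment> \<open>Where f is nonzero, |x| \<le> R \<le> n / 2, so a tent of height k and radius
      n is still at least k / 2 \<ge> K there.\<close>
    obtain n k where n: "real n \<ge> 2 * R" and k: "real k \<ge> 2 * K"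
      using real_arch_simple[of "2 * R"] real_arch_simple[of "2 * K"] by auto
    have n0: "real n > 0" using n R by auto
    let ?h = "tent 0 (real k) (1 / real n)"
    have hT: "?h \<in> T" unfolding T_def
      by (rule image_eqI[of _ _ "(0, real k, 1 / real n)"]) (use D n0 in auto)
    have "f x \<le> ?h x" for x
    proof (cases "f x = 0")
      case False
      then have "norm x \<le> real n / 2" using R(2)[of x] n by simp
      then have "1 / 2 \<le> 1 - 1 / real n * dist x 0" using n0 by (simp add: field_simps)
      then have "real k * (1 / 2) \<le> real k * (1 - 1 / real n * dist x 0)" by (intro mult_left_mono) auto
      moreover have "f x \<le> real k * (1 / 2)" using K[of x] k by (simp add: abs_le_iff)
      ultimately have "f x \<le> real k * (1 - 1 / real n * dist x 0)" by linarith
      then show ?thesis by (simp add: tent_def)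
    qed (simp add: tent_def)
    moreover have "sup_list [?h] = ?h" by (auto simp: tent_def)
    moreover have "sup_list [?h] \<in> F" unfolding F_def using hT by (intro imageI) auto
    ultimately show ?thesis by metis
  qed
  ultimately show thesis by (intro that[of F] ballI impI) auto
qed


section \<open>Testing measurability on evaluations\<close>

text \<open>The vague topology is the initial topology for countably many evaluations: each open set
  is pulled back from a countable product of lines. In that product the Borel sets are generated by
  the coordinates, which reduces measurability for all vague open sets to measurability of
  evaluations.\<close>

lemma vague_open_coordinates:
  "\<exists>\<phi> :: nat \<Rightarrow> 'a::euclidean_space \<Rightarrow> real. range \<phi> \<subseteq> Cc \<and>
    (\<forall>U. openin vague_topology U \<longrightarrow> (\<exists>V. open V \<and> U = {\<xi> \<in> Mp. (\<lambda>i. \<integral>x. \<phi> i x \<partial>\<xi>) \<in> V}))"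
proof -
  let ?gt = "\<lambda>f c. {\<xi> \<in> Mp :: 'a measure set. c < (\<integral>x. f x \<partial>\<xi>)}" and ?lt = "\<lambda>f c. {\<xi> \<in> Mp :: 'a measure set. (\<integral>x. f x \<partial>\<xi>) < c}"
  obtain F :: "('a \<Rightarrow> real) set" where F: "countable F" "F \<subseteq> Cc" "F \<noteq> {}"
    and sup: "\<forall>f\<in>Cc. (\<forall>x. 0 \<le> f x) \<longrightarrow>
       (\<exists>m::nat \<Rightarrow> 'a \<Rightarrow> real. range m \<subseteq> F \<and> (\<forall>n x. 0 \<le> m n x \<and> m n x \<le> f x) \<and> (\<forall>x. (\<lambda>n. m n x) \<longlonglongrightarrow> f x))"
    and dom: "\<forall>f\<in>Cc. \<exists>h\<in>F. \<forall>x. f x \<le> h x"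
    by (rule countable_approximating_family[where 'a='a], rule that)
  define \<phi> where "\<phi> = from_nat_into F"
  have \<phi>: "range \<phi> = F" unfolding \<phi>_def by (rule range_from_nat_into[OF F(3,1)])
  define e :: "'a measure \<Rightarrow> nat \<Rightarrow> real" where "e \<xi> = (\<lambda>i. \<integral>x. \<phi> i x \<partial>\<xi>)" for \<xi>
  define P where "P U \<longleftrightarrow> (\<exists>V. open V \<and> U = {\<xi> \<in> Mp. e \<xi> \<in> V})" for U
  have P_Int: "P (A \<inter> B)" if AB: "P A" "P B" for A B
  proof -
    obtain V where "open V" "A = {\<xi> \<in> Mp. e \<xi> \<in> V}" using AB(1) unfolding P_def by (elim exE conjE) (rule that)
    moreover obtain W where "open W" "B = {\<xi> \<in> Mp. e \<xi> \<in> W}" using AB(2) unfolding P_def by (elim exE conjE) (rule that)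
    ultimately show ?thesis unfolding P_def by (intro exI[of _ "V \<inter> W"]) auto
  qed
  have P_UN: "P (\<Union>\<K>)" if PK: "\<And>K. K \<in> \<K> \<Longrightarrow> P K" for \<K>
  proof -
    obtain V where V: "\<And>K. K \<in> \<K> \<Longrightarrow> open (V K)" "\<And>K. K \<in> \<K> \<Longrightarrow> K = {\<xi> \<in> Mp. e \<xi> \<in> V K}"
    proof -
      have "\<forall>K\<in>\<K>. \<exists>V. open V \<and> K = {\<xi> \<in> Mp. e \<xi> \<in> V}" using PK by (simp add: P_def)
      from bchoice[OF this] show thesis using that by auto
    qed
    have "\<Union>\<K> = (\<Union>K\<in>\<K>. {\<xi> \<in> Mp. e \<xi> \<in> V K})"
      using V(2) by (simp cong: image_cong)
    also have "\<dots> = {\<xi> \<in> Mp. e \<xi> \<in> (\<Union>K\<in>\<K>. V K)}" by auto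
    finally have "\<Union>\<K> = {\<xi> \<in> Mp. e \<xi> \<in> (\<Union>K\<in>\<K>. V K)}" .
    then show ?thesis unfolding P_def using V(1) by (intro exI[of _ "\<Union>K\<in>\<K>. V K"]) auto
  qed
  have P_coord: "P (?gt h c)" "P (?lt h c)" if h: "h \<in> F" for h c
  proof -
    obtain i where i: "h = \<phi> i" using \<phi> h by auto
    have "open {v::nat \<Rightarrow> real. c < v i}" "open {v::nat \<Rightarrow> real. v i < c}"
      by (auto intro!: open_Collect_less continuous_on_const continuous_on_product_coordinates)
    then show "P (?gt h c)" "P (?lt h c)"
      unfolding P_def e_def i by blast+
  qed
  \<comment> \<open>Here f is a pointwise limit from below of members of F. Dominated convergence,
    with f itself as majorant, makes the set a union of the corresponding sets of the
    approximants.\<close>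
  have P_pos: "P (?gt f c)" if f: "f \<in> Cc" and nn: "\<And>x. 0 \<le> f x" for f c
  proof -
    obtain m where m: "range m \<subseteq> F" "\<And>n x. 0 \<le> m n x" "\<And>n x. m n x \<le> f x" "\<And>x. (\<lambda>n. m n x) \<longlonglongrightarrow> f x"
      using sup f nn by meson
    have mCc: "m n \<in> Cc" for n using m(1) F(2) by auto
    have lim: "(\<lambda>n. \<integral>x. m n x \<partial>\<xi>) \<longlonglongrightarrow> (\<integral>x. f x \<partial>\<xi>)" if \<xi>: "\<xi> \<in> Mp" for \<xi>
    proof (rule integral_dominated_convergence[where w=f])
      show "integrable \<xi> f" by (rule integrable_Cc[OF \<xi> f])
      show "f \<in> borel_measurable \<xi>" "\<And>n. m n \<in> borel_measurable \<xi>"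
        using integrable_Cc[OF \<xi> f] integrable_Cc[OF \<xi> mCc] by auto
    qed (use m in auto)
    have le: "(\<integral>x. m n x \<partial>\<xi>) \<le> (\<integral>x. f x \<partial>\<xi>)" if \<xi>: "\<xi> \<in> Mp" for \<xi> n
      using m by (intro integral_mono integrable_Cc[OF \<xi> f] integrable_Cc[OF \<xi> mCc])
    have "?gt f c = \<Union>(range (\<lambda>n. ?gt (m n) c))"
    proof (intro equalityI subsetI)
      fix \<xi> assume "\<xi> \<in> ?gt f c"
      then have "\<xi> \<in> Mp" "c < (\<integral>x. f x \<partial>\<xi>)" by auto
      then have "eventually (\<lambda>n. c < (\<integral>x. m n x \<partial>\<xi>)) sequentially" using lim by (intro order_tendstoD)
      then show "\<xi> \<in> \<Union>(range (\<lambda>n. ?gt (m n) c))"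
        using \<open>\<xi> \<in> Mp\<close> by (auto simp: eventually_sequentially)
    qed (use le in \<open>auto intro: less_le_trans\<close>)
    then show ?thesis using m(1) by (auto intro!: P_UN P_coord)
  qed
  \<comment> \<open>A member h of F dominating - f makes f + h nonnegative. The integral of f
    exceeds c exactly if some q lies below the integral of f + h while q - c lies above that of h;
    the witness for q is the midpoint of c and the integral of f, raised by the integral of
    h.\<close>
  have P_gt: "P (?gt f c)" if f: "f \<in> Cc" for f c
  proof -
    obtain h where h: "h \<in> F" "\<And>x. - f x \<le> h x" using bspec[OF dom Cc_uminus[OF f]] by blast
    have hCc: "h \<in> Cc" using h F by auto
    have fh: "(\<lambda>x. f x + h x) \<in> Cc" by (rule Cc_add[OF f hCc])
    have nn: "0 \<le> f x + h x" for x using h(2)[of x] by simp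
    have "?gt f c =
        \<Union>(range (\<lambda>q. ?gt (\<lambda>x. f x + h x) q \<inter> ?lt h (q - c)))"
    proof (intro equalityI subsetI)
      fix \<xi> assume "\<xi> \<in> ?gt f c"
      then have \<xi>: "\<xi> \<in> Mp" "c < (\<integral>x. f x \<partial>\<xi>)" by auto
      let ?q = "((\<integral>x. f x \<partial>\<xi>) + c) / 2 + (\<integral>x. h x \<partial>\<xi>)"
      have "?q < (\<integral>x. f x + h x \<partial>\<xi>)" "(\<integral>x. h x \<partial>\<xi>) < ?q - c"
        using \<xi>(2) by (simp_all add: integrable_Cc[OF \<xi>(1)] f hCc field_simps)
      then show "\<xi> \<in> \<Union>(range (\<lambda>q. ?gt (\<lambda>x. f x + h x) q \<inter> ?lt h (q - c)))"
        using \<xi>(1) by blast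
    qed (auto simp: integrable_Cc f hCc)
    moreover have "P \<dots>"
    proof (rule P_UN)
      fix K assume "K \<in> range (\<lambda>q. ?gt (\<lambda>x. f x + h x) q \<inter> ?lt h (q - c))"
      then show "P K" by (auto intro!: P_Int P_pos[OF fh nn] P_coord(2)[OF h(1)])
    qed
    ultimately show ?thesis by simp
  qed
  have P_lt: "P (?lt f c)" if f: "f \<in> Cc" for f c
    using P_gt[OF Cc_uminus[OF f], of "- c"] by simp
  have P_basic: "P {\<xi> \<in> Mp. (\<integral>x. f x \<partial>\<xi>) \<in> U}" if f: "f \<in> Cc" and U: "open U" for f U
  proof -
    let ?I = "{(a, b). {a<..<b} \<subseteq> U}"
    have "{\<xi> \<in> Mp. (\<integral>x. f x \<partial>\<xi>) \<in> U} =
       \<Union>((\<lambda>(a, b). ?gt f a \<inter> ?lt f b) ` ?I)" (is "_ = ?R")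
    proof (intro equalityI subsetI)
      fix \<xi> assume "\<xi> \<in> {\<xi> \<in> Mp. (\<integral>x. f x \<partial>\<xi>) \<in> U}"
      then have \<xi>: "\<xi> \<in> Mp" "(\<integral>x. f x \<partial>\<xi>) \<in> U" by auto
      obtain d where d: "d > 0" "ball (\<integral>x. f x \<partial>\<xi>) d \<subseteq> U" using U \<xi>(2) open_contains_ball by blast
      have "{(\<integral>x. f x \<partial>\<xi>) - d<..<(\<integral>x. f x \<partial>\<xi>) + d} \<subseteq> U"
        using d(2) by (auto simp: subset_eq dist_real_def)
      then show "\<xi> \<in> ?R" using \<xi>(1) d(1)
        by (intro UnionI[OF imageI[of "((\<integral>x. f x \<partial>\<xi>) - d, (\<integral>x. f x \<partial>\<xi>) + d)"]]) auto
    qed auto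
    then show ?thesis using f by (auto intro!: P_UN P_Int P_gt P_lt)
  qed
  have "P U" if "openin vague_topology U" for U
  proof -
    have "generate_topology_on {{\<xi> \<in> Mp. (\<integral>x. f x \<partial>\<xi>) \<in> U} |f U. f \<in> Cc \<and> open U} U"
      using that by (simp add: vague_topology_def openin_topology_generated_by_iff)
    then show ?thesis
    proof induction
      case Empty
      then show ?case unfolding P_def by (intro exI[of _ "{}"]) auto
    qed (auto intro: P_Int P_UN P_basic)
  qed
  then show ?thesis using \<phi> F(2) unfolding P_def e_def by (intro exI[of _ \<phi>]) blast
qed

text \<open>A vague open set is the preimage of an open set of sequences under countably many
  evaluations, and a sequence-valued map is measurable as soon as its coordinates are.\<close>

lemma measurable_vague_borelI:
  fixes \<tau> :: "'s \<Rightarrow> 'a::euclidean_space measure"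
  assumes Mp: "\<And>s. s \<in> space S \<Longrightarrow> \<tau> s \<in> Mp"
    and ev: "\<And>f. f \<in> Cc \<Longrightarrow> (\<lambda>s. \<integral>x. f x \<partial>\<tau> s) \<in> borel_measurable S"
  shows "\<tau> \<in> measurable S vague_borel"
  unfolding vague_borel_def
proof (rule measurable_measure_of)
  show "{U. openin vague_topology U} \<subseteq> Pow Mp" by (auto dest: openin_vague_subset)
  show "\<tau> \<in> space S \<rightarrow> Mp" using Mp by auto
  fix U :: "'a measure set" assume "U \<in> {U. openin vague_topology U}"
  then have U: "openin vague_topology U" by simp
  obtain \<phi> :: "nat \<Rightarrow> 'a \<Rightarrow> real" where \<phi>: "range \<phi> \<subseteq> Cc"
    and co: "\<forall>U. openin vague_topology U \<longrightarrow> (\<exists>V. open V \<and> U = {\<xi> \<in> Mp. (\<lambda>i. \<integral>x. \<phi> i x \<partial>\<xi>) \<in> V})"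
    by (rule exE[OF vague_open_coordinates[where 'a='a]], elim conjE, rule that)
  obtain V where V: "open V" "U = {\<xi> \<in> Mp. (\<lambda>i. \<integral>x. \<phi> i x \<partial>\<xi>) \<in> V}"
    using mp[OF spec[OF co] U] by (elim exE conjE) (rule that)
  have "(\<lambda>s i. \<integral>x. \<phi> i x \<partial>\<tau> s) \<in> borel_measurable S"
    using \<phi> by (intro measurable_coordinatewise_then_product ev) auto
  then have "(\<lambda>s i. \<integral>x. \<phi> i x \<partial>\<tau> s) -` V \<inter> space S \<in> sets S"
    using V(1) by (intro measurable_sets) auto
  also have "(\<lambda>s i. \<integral>x. \<phi> i x \<partial>\<tau> s) -` V \<inter> space S = \<tau> -` U \<inter> space S"
    using V(2) Mp by auto
  finally show "\<tau> -` U \<inter> space S \<in> sets S" .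
qed

text \<open>Integrating f over a translate is integrating the shifted function, which is again a
  test function. So generating sets pull back to generating sets, and the rest follows by induction
  over the generated topology.\<close>

lemma openin_translate_vimage:
  assumes "openin vague_topology U"
  shows "openin vague_topology (translate t -` U \<inter> Mp)"
proof -
  have "generate_topology_on {{\<xi> \<in> Mp. (\<integral>x. f x \<partial>\<xi>) \<in> U} |f U. f \<in> Cc \<and> open U} U"
    using assms by (simp add: vague_topology_def openin_topology_generated_by_iff)
  then show ?thesis
  proof induction
    case Empty
    then show ?case by simp
  next
    case (Int a b)
    have "translate t -` (a \<inter> b) \<inter> Mp = (translate t -` a \<inter> Mp) \<inter> (translate t -` b \<inter> Mp)" by auto
    then show ?case using Int.IH by auto
  next
    case (UN K)
    have "translate t -` \<Union>K \<inter> Mp = \<Union>((\<lambda>k. translate t -` k \<inter> Mp) ` K)" by auto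
    then show ?case by (simp only:) (intro openin_Union, use UN.IH in auto)
  next
    case (Basis s)
    then obtain f U where f: "f \<in> Cc" "open U" "s = {\<xi> \<in> Mp. (\<integral>x. f x \<partial>\<xi>) \<in> U}" by auto
    have "(\<lambda>x. f (t + x)) \<in> Cc"
    proof (rule Cc_I)
      show "continuous_on UNIV (\<lambda>x. f (t + x))"
        using CcD(1)[OF f(1)] by (rule continuous_on_compose2) (auto intro: continuous_intros)
      have "{x. f (t + x) \<noteq> 0} = (+) (- t) ` {x. f x \<noteq> 0}"
        by (auto intro!: image_eqI[of _ _ "t + _"])
      then show "bounded {x. f (t + x) \<noteq> 0}" using CcD(2)[OF f(1)] by (simp only: bounded_translation)
    qed
    moreover have "translate t -` s \<inter> Mp = {\<xi> \<in> Mp. (\<integral>x. f (t + x) \<partial>\<xi>) \<in> U}"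
      using CcD(3)[OF f(1)] by (auto simp: f(3) translate_in_Mp integral_translate)
    ultimately show ?case using openin_vague_basic f(2) by simp
  qed
qed

text \<open>
  Since \<open>gauss a x\<close> is dominated by a multiple of \<open>gauss (2 * a)\<close> on the whole cube
  \<open>x + cube r\<close>, averaging over these cubes compares the sum over the points with an
  integral. The bound does not depend on \<open>a\<close>.
\<close>

lemma nn_integral_gauss_Mp_cube:
  assumes r: "r > 0"
  obtains C where "C > 0" "\<And>(\<xi> :: 'a::euclidean_space measure) a. \<xi> \<in> Mp_cube r \<Longrightarrow> a \<ge> 1 \<Longrightarrow> (\<integral>\<^sup>+x. gauss a x \<partial>\<xi>) \<le> ennreal C"
proof -
  obtain D where D: "\<And>u::'a. u \<in> cube r \<Longrightarrow> norm u \<le> D"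
    using bounded_cube[of r, where 'a='a] unfolding bounded_iff by blast
  define K where "K = sqrt 2 ^ DIM('a) * exp (pi * D\<^sup>2)"
  have K: "K > 0" by (simp add: K_def)
  have cube_sets [measurable]: "(cube r :: 'a set) \<in> sets borel" by (simp add: borel_open)
  define v where "v = measure lborel (cube r :: 'a set)"
  have fin: "emeasure lborel (cube r :: 'a set) < \<infinity>" by (intro emeasure_bounded_finite) simp
  have "emeasure lborel (cube r :: 'a set) \<noteq> 0"
  proof
    assume "emeasure lborel (cube r :: 'a set) = 0"
    then have "(cube r :: 'a set) \<in> null_sets lborel" by (simp add: null_sets_def)
    then have "cube r = ({} :: 'a set)"
      using negligible_iff_null_sets open_not_negligible[of "cube r :: 'a set"] null_sets_completionI open_cube by blast
    then show False using zero_in_cube[OF r, where 'a='a] by simp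
  qed
  then have v: "v > 0" "emeasure lborel (cube r :: 'a set) = ennreal v"
    using fin by (auto simp: v_def emeasure_eq_ennreal_measure zero_less_measure_iff less_top)
  have "(\<integral>\<^sup>+x. gauss a x \<partial>\<xi>) \<le> ennreal (K / v)" if \<xi>: "\<xi> \<in> Mp_cube r" and a: "a \<ge> 1" for \<xi> :: "'a measure" and a
  proof -
    have Mp: "\<xi> \<in> Mp" using \<xi> by (rule Mp_cubeD)
    have [measurable_cong]: "sets \<xi> = sets borel" using Mp by (rule Mp_sets)
    interpret \<xi>: sigma_finite_measure \<xi> using Mp by (rule sigma_finite_Mp)
    interpret pair_sigma_finite \<xi> lborel ..
    have 1: "ennreal (gauss a x) * ennreal v \<le> (\<integral>\<^sup>+z. ennreal (K * gauss (2 * a) z) * indicator (cube r) (z - x) \<partial>lborel)" for x :: 'a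
    proof -
      have "ennreal (gauss a x) * ennreal v = (\<integral>\<^sup>+u. ennreal (gauss a x) * indicator (cube r) u \<partial>(lborel :: 'a measure))"
        by (subst v(2)[symmetric], subst nn_integral_cmult_indicator) auto
      also have "\<dots> \<le> (\<integral>\<^sup>+u. ennreal (K * gauss (2 * a) (x + u)) * indicator (cube r) (x + u - x) \<partial>lborel)"
        by (intro nn_integral_mono) (auto simp: indicator_def K_def intro!: ennreal_leI gauss_le_shifted[OF a] D)
      also have "\<dots> = (\<integral>\<^sup>+z. ennreal (K * gauss (2 * a) z) * indicator (cube r) (z - x) \<partial>lborel)"
        by (rule lborel_nn_integral_shift) measurable
      finally show ?thesis .
    qed
    \<comment> \<open>By the symmetry of the cube this integral is the mass of the cube centred at
      z. Uniform discreteness enters here.\<close>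
    have 2: "(\<integral>\<^sup>+x. indicator (cube r) (z - x) \<partial>\<xi>) \<le> 1" for z
    proof -
      have eq: "indicator (cube r) (z - x) = (indicator ((+) z ` cube r) x :: ennreal)" for x
      proof -
        have "z - x \<in> cube r \<longleftrightarrow> x \<in> (+) z ` cube r"
        proof
          assume "z - x \<in> cube r"
          then have "- (z - x) \<in> cube r" by (simp only: uminus_cube_iff)
          then show "x \<in> (+) z ` cube r" by (intro image_eqI[of _ _ "- (z - x)"]) auto
        next
          assume "x \<in> (+) z ` cube r"
          then obtain y where "y \<in> cube r" "z - x = - y" by auto
          then show "z - x \<in> cube r" by simp
        qed
        then show ?thesis by (simp add: indicator_def)
      qed
      have "(\<integral>\<^sup>+x. indicator (cube r) (z - x) \<partial>\<xi>) = emeasure \<xi> ((+) z ` cube r)"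
        unfolding eq by (rule nn_integral_indicator) (simp add: Mp_sets[OF Mp] borel_open open_translation)
      then show ?thesis using Mp_cube_le_1[OF \<xi>] by simp
    qed
    have "(\<integral>\<^sup>+x. gauss a x \<partial>\<xi>) * ennreal v = (\<integral>\<^sup>+x. ennreal (gauss a x) * ennreal v \<partial>\<xi>)"
      by (rule nn_integral_multc[symmetric]) measurable
    also have "\<dots> \<le> (\<integral>\<^sup>+x. \<integral>\<^sup>+z. ennreal (K * gauss (2 * a) z) * indicator (cube r) (z - x) \<partial>lborel \<partial>\<xi>)"
      by (intro nn_integral_mono 1)
    also have "\<dots> = (\<integral>\<^sup>+z. \<integral>\<^sup>+x. ennreal (K * gauss (2 * a) z) * indicator (cube r) (z - x) \<partial>\<xi> \<partial>lborel)"
      by (rule Fubini'[symmetric]) measurable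
    also have "\<dots> = (\<integral>\<^sup>+z. ennreal (K * gauss (2 * a) z) * (\<integral>\<^sup>+x. indicator (cube r) (z - x) \<partial>\<xi>) \<partial>lborel)"
      by (intro nn_integral_cong nn_integral_cmult) measurable
    also have "\<dots> \<le> (\<integral>\<^sup>+z. ennreal (K * gauss (2 * a) z) * 1 \<partial>(lborel :: 'a measure))"
      by (intro nn_integral_mono mult_left_mono 2) auto
    also have "\<dots> = ennreal K * (\<integral>\<^sup>+z. ennreal (gauss (2 * a) (z::'a)) \<partial>lborel)"
      using K a gauss_pos[of "2 * a"] by (subst nn_integral_cmult[symmetric]) (auto simp: ennreal_mult' intro!: nn_integral_cong)
    also have "\<dots> = ennreal K" using a by (simp add: nn_integral_gauss)
    finally have le: "(\<integral>\<^sup>+x. gauss a x \<partial>\<xi>) * ennreal v \<le> ennreal K" .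
    have "(\<integral>\<^sup>+x. gauss a x \<partial>\<xi>) = (\<integral>\<^sup>+x. gauss a x \<partial>\<xi>) * ennreal v / ennreal v"
      using v(1) by (subst ennreal_mult_divide_eq) auto
    also have "\<dots> \<le> ennreal K / ennreal v" using le by (rule divide_right_mono_ennreal)
    also have "\<dots> = ennreal (K / v)" using v(1) K by (simp add: divide_ennreal)
    finally show ?thesis .
  qed
  then show thesis using K v by (intro that[of "K / v"]) auto
qed

section \<open>Integrals depending measurably on the configuration\<close>

text \<open>The factor \<open>c\<close> approaches the indicator of A through the distance to its
  complement, and \<open>b\<close> makes the support bounded. The domination by |w| allows dominated
  convergence, which carries measurability from evaluations to weighted masses of open sets.\<close>

lemma open_cutoff:
  fixes A :: "'a::euclidean_space set"
  assumes A: "open A" and w: "continuous_on UNIV w"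
  obtains f :: "nat \<Rightarrow> 'a \<Rightarrow> real" where "range f \<subseteq> Cc" "\<And>n x. \<bar>f n x\<bar> \<le> \<bar>w x\<bar>" "\<And>x. (\<lambda>n. f n x) \<longlonglongrightarrow> w x * indicator A x"
proof -
  \<comment> \<open>Without the case distinction c would vanish for A = UNIV, since
    \<open>infdist\<close> from the empty set is 0.\<close>
  define c where "c n x = (if A = UNIV then 1 else min 1 (real n * infdist x (- A)))" for n and x :: 'a
  define b where "b n x = max 0 (1 - norm x / (real n + 1))" for n :: nat and x :: 'a
  have c: "0 \<le> c n x" "c n x \<le> 1" for n x by (auto simp: c_def infdist_nonneg)
  have b: "0 \<le> b n x" "b n x \<le> 1" for n x by (auto simp: b_def)
  have c_lim: "(\<lambda>n. c n x) \<longlonglongrightarrow> indicator A x" for x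
  proof (cases "A = UNIV")
    case False
    show ?thesis
    proof (cases "x \<in> A")
      case True
      have "infdist x (- A) \<noteq> 0"
        using A False True in_closed_iff_infdist_zero[of "- A" x] by auto
      then have pos: "infdist x (- A) > 0" using infdist_nonneg[of x "- A"] by linarith
      obtain N where N: "real N > 1 / infdist x (- A)" using reals_Archimedean2 by blast
      have "c n x = 1" if n: "n \<ge> N" for n
      proof -
        have "1 / infdist x (- A) \<le> real n" using N n by linarith
        then have "1 \<le> real n * infdist x (- A)" using pos by (simp add: field_simps)
        then show ?thesis by (simp add: c_def False)
      qed
      then have "eventually (\<lambda>n. c n x = 1) sequentially" by (auto simp: eventually_sequentially)
      then show ?thesis using True by (simp add: tendsto_eventually)
    qed (simp add: c_def False)
  qed (simp add: c_def)
  have b_lim: "(\<lambda>n. b n x) \<longlonglongrightarrow> 1" for x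
  proof -
    have "(\<lambda>n. 1 / (real n + 1)) \<longlonglongrightarrow> 0"
      using LIMSEQ_inverse_real_of_nat by (simp add: inverse_eq_divide add.commute)
    from tendsto_mult_right[OF this, of "norm x"]
    have "(\<lambda>n. norm x / (real n + 1)) \<longlonglongrightarrow> 0" by simp
    then have "(\<lambda>n. max 0 (1 - norm x / (real n + 1))) \<longlonglongrightarrow> max 0 (1 - 0)" by (intro tendsto_intros)
    then show ?thesis by (simp add: b_def)
  qed
  show thesis
  proof (rule that[of "\<lambda>n x. w x * (c n x * b n x)"])
    have "(\<lambda>x. w x * (c n x * b n x)) \<in> Cc" for n
    proof (rule Cc_I)
      have "continuous_on UNIV (c n)" unfolding c_def by (cases "A = UNIV") (auto intro!: continuous_intros)
      moreover have "continuous_on UNIV (b n)" unfolding b_def by (intro continuous_intros) auto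
      ultimately show "continuous_on UNIV (\<lambda>x. w x * (c n x * b n x))" by (intro continuous_intros w)
      have "norm x \<le> real n + 1" if "w x * (c n x * b n x) \<noteq> 0" for x
      proof (rule ccontr)
        assume "\<not> norm x \<le> real n + 1"
        then have "b n x = 0" by (simp add: b_def field_simps)
        with that show False by simp
      qed
      then show "bounded {x. w x * (c n x * b n x) \<noteq> 0}" unfolding bounded_iff by blast
    qed
    then show "range (\<lambda>n x. w x * (c n x * b n x)) \<subseteq> Cc" by auto
    show "\<bar>w x * (c n x * b n x)\<bar> \<le> \<bar>w x\<bar>" for n x
      using mult_mono[OF c(2)[of n x] b(2)[of n x] _ b(1)] c b
      by (simp add: abs_mult mult_left_le)
    show "(\<lambda>n. w x * (c n x * b n x)) \<longlonglongrightarrow> w x * indicator A x" for x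
    proof -
      have "(\<lambda>n. w x * (c n x * b n x)) \<longlonglongrightarrow> w x * (indicator A x * 1)"
        by (intro tendsto_intros c_lim b_lim)
      then show ?thesis by simp
    qed
  qed
qed

lemma integrable_gauss_Mp_cube:
  assumes "\<xi> \<in> Mp_cube r" "r > 0" "a \<ge> 1"
  shows "integrable \<xi> (gauss a)"
proof -
  have [measurable_cong]: "sets \<xi> = sets borel" using assms by (intro Mp_sets Mp_cubeD)
  obtain C where C: "\<And>(\<xi> :: 'a measure) a. \<xi> \<in> Mp_cube r \<Longrightarrow> a \<ge> 1 \<Longrightarrow> (\<integral>\<^sup>+x. gauss a x \<partial>\<xi>) \<le> ennreal C"
    using nn_integral_gauss_Mp_cube[OF assms(2), where 'a='a] by metis
  show ?thesis
    using assms C[OF assms(1,3)] gauss_pos[of a]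
    by (intro integrableI_nonneg) (auto intro: less_imp_le le_less_trans)
qed

text \<open>
  The measures \<open>\<tau> s\<close> are infinite; a small multiple of \<open>gauss 1\<close> as density turns them into
  subprobability kernels.
\<close>

lemma measurable_kernel_nn_integral:
  fixes \<tau> :: "'s \<Rightarrow> 'a::euclidean_space measure"
  assumes \<tau>: "\<tau> \<in> measurable S vague_borel" and cube: "\<And>s. s \<in> space S \<Longrightarrow> \<tau> s \<in> Mp_cube r" and r: "r > 0"
    and g: "(\<lambda>(s, x). g s x) \<in> borel_measurable (S \<Otimes>\<^sub>M borel)"
  shows "(\<lambda>s. \<integral>\<^sup>+x. g s x \<partial>\<tau> s) \<in> borel_measurable S"
proof -
  obtain C where C: "C > 0" "\<And>(\<xi> :: 'a measure) a. \<xi> \<in> Mp_cube r \<Longrightarrow> a \<ge> 1 \<Longrightarrow> (\<integral>\<^sup>+x. gauss a x \<partial>\<xi>) \<le> ennreal C"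
    using nn_integral_gauss_Mp_cube[OF r, where 'a='a] by metis
  define w :: "'a \<Rightarrow> real" where "w x = gauss 1 x / C" for x
  have w: "w x > 0" for x using C gauss_pos[of 1 x] by (simp add: w_def)
  have w_meas [measurable]: "w \<in> borel_measurable borel" unfolding w_def by measurable
  have w_cont: "continuous_on UNIV w" unfolding w_def gauss_def by (intro continuous_intros) (use C in auto)
  have sets: "sets (\<tau> s) = sets borel" if "s \<in> space S" for s
    using cube[OF that] by (intro Mp_sets Mp_cubeD)
  have w_int: "integrable (\<tau> s) w" if "s \<in> space S" for s
    unfolding w_def using cube[OF that] r by (intro integrable_divide_zero integrable_gauss_Mp_cube) auto
  define K where "K s = density (\<tau> s) w" for s
  \<comment> \<open>Open sets form a generator stable under intersections, so it suffices that their
    masses are measurable in s. These are limits of evaluations at cutoffs of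
    \<open>w\<close>.\<close>
  have K: "K \<in> measurable S (subprob_algebra borel)"
  proof (rule measurable_subprob_algebra_generated[where \<Omega>=UNIV and G="{A. open A}"])
    show "sets borel = sigma_sets UNIV {A :: 'a set. open A}" by (simp add: borel_def)
    show "Int_stable {A :: 'a set. open A}" by (auto simp: Int_stable_def)
    show "{A :: 'a set. open A} \<subseteq> Pow UNIV" by simp
    show "sets (K s) = sets borel" if "s \<in> space S" for s using sets[OF that] by (simp add: K_def)
    show "subprob_space (K s)" if s: "s \<in> space S" for s
    proof (rule subprob_spaceI)
      have [measurable_cong]: "sets (\<tau> s) = sets borel" using s by (rule sets)
      have "emeasure (K s) (space (K s)) = (\<integral>\<^sup>+x. ennreal (1 / C) * ennreal (gauss 1 x) \<partial>\<tau> s)"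
        using C unfolding K_def by (subst emeasure_density) (auto intro!: nn_integral_cong simp: w_def ennreal_mult'[symmetric])
      also have "\<dots> = ennreal (1 / C) * (\<integral>\<^sup>+x. ennreal (gauss 1 x) \<partial>\<tau> s)"
        by (rule nn_integral_cmult) measurable
      also have "\<dots> \<le> ennreal (1 / C) * ennreal C" using C(2)[OF cube[OF s], of 1] by (intro mult_left_mono) auto
      also have "\<dots> = 1" using C(1) by (simp add: ennreal_mult'[symmetric])
      finally show "emeasure (K s) (space (K s)) \<le> 1" .
      show "space (K s) \<noteq> {}" using sets_eq_imp_space_eq[OF sets[OF s]] by (simp add: K_def)
    qed
    have "(\<lambda>s. emeasure (K s) A) \<in> borel_measurable S" if A: "open A" for A
    proof -
      obtain f :: "nat \<Rightarrow> 'a \<Rightarrow> real" where f: "range f \<subseteq> Cc" "\<And>n x. \<bar>f n x\<bar> \<le> \<bar>w x\<bar>" "\<And>x. (\<lambda>n. f n x) \<longlonglongrightarrow> w x * indicator A x"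
        using open_cutoff[OF A w_cont] by blast
      have meas: "(\<lambda>s. \<integral>x. f n x \<partial>\<tau> s) \<in> borel_measurable S" for n
        using measurable_compose[OF \<tau> measurable_evaluation[of "f n"]] f(1) by auto
      have lim: "(\<lambda>n. \<integral>x. f n x \<partial>\<tau> s) \<longlonglongrightarrow> (\<integral>x. w x * indicator A x \<partial>\<tau> s)" if s: "s \<in> space S" for s
      proof (rule integral_dominated_convergence[where w=w])
        have [measurable_cong]: "sets (\<tau> s) = sets borel" using s by (rule sets)
        have [measurable]: "A \<in> sets borel" using A by simp
        show "(\<lambda>x. w x * indicator A x) \<in> borel_measurable (\<tau> s)" by measurable
        have "f n \<in> borel_measurable borel" for n using f(1) by (intro CcD(3)) auto
        then show "f n \<in> borel_measurable (\<tau> s)" for n by simp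
        show "AE x in \<tau> s. norm (f n x) \<le> w x" for n using f(2)[of n] w by (auto simp: abs_of_pos)
      qed (use f w_int[OF s] in auto)
      have "emeasure (K s) A = ennreal (\<integral>x. w x * indicator A x \<partial>\<tau> s)" if s: "s \<in> space S" for s
      proof -
        have [measurable_cong]: "sets (\<tau> s) = sets borel" using s by (rule sets)
        have [measurable]: "A \<in> sets borel" using A by simp
        have "emeasure (K s) A = (\<integral>\<^sup>+x. ennreal (w x * indicator A x) \<partial>\<tau> s)"
          unfolding K_def by (subst emeasure_density) (auto intro!: nn_integral_cong simp: indicator_def)
        also have "\<dots> = ennreal (\<integral>x. w x * indicator A x \<partial>\<tau> s)"
        proof (rule nn_integral_eq_integral)
          have "integrable (\<tau> s) (\<lambda>x. indicator A x *\<^sub>R w x)"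
            using A sets[OF s] by (intro integrable_mult_indicator w_int s) simp
          then show "integrable (\<tau> s) (\<lambda>x. w x * indicator A x)" by (simp add: mult.commute)
        qed (use w in \<open>auto simp: less_imp_le\<close>)
        finally show ?thesis .
      qed
      moreover have "(\<lambda>s. ennreal (\<integral>x. w x * indicator A x \<partial>\<tau> s)) \<in> borel_measurable S"
        by (intro measurable_ennreal[THEN measurable_compose[rotated]] borel_measurable_LIMSEQ_real[OF lim meas])
      ultimately show ?thesis by (simp cong: measurable_cong)
    qed
    then show "(\<lambda>s. emeasure (K s) A) \<in> borel_measurable S" if "A \<in> {A. open A}" for A using that by simp
    then show "(\<lambda>s. emeasure (K s) UNIV) \<in> borel_measurable S" by simp
  qed
  have [measurable]: "(\<lambda>(s, x). g s x) \<in> borel_measurable (S \<Otimes>\<^sub>M borel)" by (rule g)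
  \<comment> \<open>The density \<open>w\<close> is positive everywhere, so multiplying the
    integrand by 1 / w undoes it.\<close>
  have "(\<lambda>s. \<integral>\<^sup>+x. g s x * ennreal (1 / w x) \<partial>K s) \<in> borel_measurable S"
    by (rule nn_integral_measurable_subprob_algebra2[OF _ K]) measurable
  moreover have "(\<integral>\<^sup>+x. g s x * ennreal (1 / w x) \<partial>K s) = (\<integral>\<^sup>+x. g s x \<partial>\<tau> s)" if s: "s \<in> space S" for s
  proof -
    have [measurable_cong]: "sets (\<tau> s) = sets borel" using s by (rule sets)
    have [measurable]: "g s \<in> borel_measurable borel"
      using measurable_compose[OF measurable_Pair1'[OF s] g] by simp
    have "ennreal (w x) * (g s x * ennreal (1 / w x)) = g s x" for x
    proof -
      have "ennreal (w x) * (g s x * ennreal (1 / w x)) = (ennreal (w x) * ennreal (1 / w x)) * g s x"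
        by (simp only: mult_ac)
      also have "ennreal (w x) * ennreal (1 / w x) = 1" using w[of x] by (simp add: ennreal_mult'[symmetric])
      finally show ?thesis by simp
    qed
    then show ?thesis unfolding K_def by (subst nn_integral_density) auto
  qed
  ultimately show ?thesis by (simp cong: measurable_cong)
qed

lemma measurable_kernel_integral_real:
  fixes \<tau> :: "'s \<Rightarrow> 'a::euclidean_space measure" and g :: "'s \<Rightarrow> 'a \<Rightarrow> real"
  assumes \<tau>: "\<tau> \<in> measurable S vague_borel" and cube: "\<And>s. s \<in> space S \<Longrightarrow> \<tau> s \<in> Mp_cube r" and r: "r > 0"
    and g: "(\<lambda>(s, x). g s x) \<in> borel_measurable (S \<Otimes>\<^sub>M borel)"
    and int: "\<And>s. s \<in> space S \<Longrightarrow> integrable (\<tau> s) (g s)"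
  shows "(\<lambda>s. \<integral>x. g s x \<partial>\<tau> s) \<in> borel_measurable S"
proof -
  note [measurable] = g
  have [measurable]: "(\<lambda>s. \<integral>\<^sup>+x. ennreal (g s x) \<partial>\<tau> s) \<in> borel_measurable S"
    "(\<lambda>s. \<integral>\<^sup>+x. ennreal (- g s x) \<partial>\<tau> s) \<in> borel_measurable S"
    by (rule measurable_kernel_nn_integral[OF \<tau> cube r]; measurable)+
  have "(\<lambda>s. enn2real (\<integral>\<^sup>+x. ennreal (g s x) \<partial>\<tau> s) - enn2real (\<integral>\<^sup>+x. ennreal (- g s x) \<partial>\<tau> s)) \<in> borel_measurable S"
    by measurable
  then show ?thesis using real_lebesgue_integral_def[OF int] by (simp cong: measurable_cong)
qed

lemma measurable_kernel_integral_complex: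
  fixes \<tau> :: "'s \<Rightarrow> 'a::euclidean_space measure" and g :: "'s \<Rightarrow> 'a \<Rightarrow> complex"
  assumes \<tau>: "\<tau> \<in> measurable S vague_borel" and cube: "\<And>s. s \<in> space S \<Longrightarrow> \<tau> s \<in> Mp_cube r" and r: "r > 0"
    and g: "(\<lambda>(s, x). g s x) \<in> borel_measurable (S \<Otimes>\<^sub>M borel)"
    and int: "\<And>s. s \<in> space S \<Longrightarrow> integrable (\<tau> s) (g s)"
  shows "(\<lambda>s. \<integral>x. g s x \<partial>\<tau> s) \<in> borel_measurable S"
proof -
  note [measurable] = g
  have "(\<lambda>s. \<integral>x. Re (g s x) \<partial>\<tau> s) \<in> borel_measurable S"
    by (rule measurable_kernel_integral_real[OF \<tau> cube r], assumption, measurable) (intro integrable_Re int)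
  moreover have "(\<lambda>s. \<integral>x. Im (g s x) \<partial>\<tau> s) \<in> borel_measurable S"
    by (rule measurable_kernel_integral_real[OF \<tau> cube r], assumption, measurable) (intro integrable_Im int)
  ultimately have "(\<lambda>s. Complex (\<integral>x. Re (g s x) \<partial>\<tau> s) (\<integral>x. Im (g s x) \<partial>\<tau> s)) \<in> borel_measurable S"
    by (auto simp: borel_measurable_complex_iff)
  moreover have "(\<integral>x. g s x \<partial>\<tau> s) = Complex (\<integral>x. Re (g s x) \<partial>\<tau> s) (\<integral>x. Im (g s x) \<partial>\<tau> s)" if "s \<in> space S" for s
    using int[OF that] by (simp add: complex_eq_iff)
  ultimately show ?thesis by (simp cong: measurable_cong)
qed

lemma Mp_cube_translate:
  assumes "\<xi> \<in> Mp_cube r"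
  shows "translate t \<xi> \<in> Mp_cube r"
proof -
  have Mp: "\<xi> \<in> Mp" using assms by (rule Mp_cubeD)
  have "emeasure (translate t \<xi>) ((+) a ` cube r) \<le> 1" for a
  proof -
    have "(+) t -` ((+) a ` cube r) = (+) (a - t) ` cube r"
    proof (intro equalityI subsetI)
      fix x assume "x \<in> (+) t -` ((+) a ` cube r)"
      then obtain y where "y \<in> cube r" "t + x = a + y" by auto
      then show "x \<in> (+) (a - t) ` cube r" by (intro image_eqI[of _ _ y]) (auto simp: algebra_simps)
    qed auto
    then show ?thesis
      using Mp_cube_le_1[OF assms] by (simp add: emeasure_translate[OF Mp] borel_open open_translation)
  qed
  then show ?thesis using translate_in_Mp[OF Mp] by (simp add: Mp_cube_def)
qed

text \<open>An evaluation of the translate is the integral of f (u s + x) against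
  \<open>\<tau> s\<close>, with an integrand jointly measurable in s and x. The shift may depend on
  s because in the Palm measure each point of the configuration is moved to the origin.\<close>

lemma measurable_translate_kernel:
  fixes \<tau> :: "'s \<Rightarrow> 'a::euclidean_space measure"
  assumes \<tau>: "\<tau> \<in> measurable S vague_borel" and cube: "\<And>s. s \<in> space S \<Longrightarrow> \<tau> s \<in> Mp_cube r" and r: "r > 0"
    and u: "u \<in> borel_measurable S"
  shows "(\<lambda>s. translate (u s) (\<tau> s)) \<in> measurable S vague_borel"
proof (rule measurable_vague_borelI)
  have Mp: "\<tau> s \<in> Mp" if "s \<in> space S" for s using cube[OF that] by (rule Mp_cubeD)
  show "translate (u s) (\<tau> s) \<in> Mp" if "s \<in> space S" for s using Mp[OF that] by (rule translate_in_Mp)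
  fix f :: "'a \<Rightarrow> real" assume f: "f \<in> Cc"
  have [measurable]: "f \<in> borel_measurable borel" using f by (rule CcD)
  note [measurable] = u
  have "(\<lambda>s. \<integral>x. f (u s + x) \<partial>\<tau> s) \<in> borel_measurable S"
  proof (rule measurable_kernel_integral_real[OF \<tau> cube r])
    show "integrable (\<tau> s) (\<lambda>x. f (u s + x))" if s: "s \<in> space S" for s
    proof -
      have [measurable_cong]: "sets (\<tau> s) = sets borel" using Mp[OF s] by (rule Mp_sets)
      have "integrable (translate (u s) (\<tau> s)) f" using f translate_in_Mp[OF Mp[OF s]] by (intro integrable_Cc)
      then show ?thesis unfolding translate_def by (subst (asm) integrable_distr_eq) auto
    qed
  qed measurable
  moreover have "(\<integral>x. f x \<partial>translate (u s) (\<tau> s)) = (\<integral>x. f (u s + x) \<partial>\<tau> s)" if "s \<in> space S" for s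
    using Mp[OF that] by (rule integral_translate) simp
  ultimately show "(\<lambda>s. \<integral>x. f x \<partial>translate (u s) (\<tau> s)) \<in> borel_measurable S"
    by (simp cong: measurable_cong)
qed

section \<open>Mixtures of measures\<close>

text \<open>A set function that is not countably additive would make \<open>measure_of\<close> yield
  the zero measure. Here additivity follows by exchanging the sum with the integral over s. Both
  \<open>palm_measure\<close> and \<open>first_moment\<close> have this shape.\<close>

lemma emeasure_mixture:
  fixes K :: "'s \<Rightarrow> 'b measure"
  assumes sets: "\<And>s. s \<in> space S \<Longrightarrow> sets (K s) = sets R"
    and meas: "\<And>A. A \<in> sets R \<Longrightarrow> (\<lambda>s. emeasure (K s) A) \<in> borel_measurable S"
    and A: "A \<in> sets R"
  shows "emeasure (measure_of (space R) (sets R) (\<lambda>A. \<integral>\<^sup>+s. emeasure (K s) A \<partial>S)) A = (\<integral>\<^sup>+s. emeasure (K s) A \<partial>S)"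
proof (rule emeasure_measure_of_sigma)
  show "sigma_algebra (space R) (sets R)" ..
  show "positive (sets R) (\<lambda>A. \<integral>\<^sup>+s. emeasure (K s) A \<partial>S)" by (simp add: positive_def)
  show "countably_additive (sets R) (\<lambda>A. \<integral>\<^sup>+s. emeasure (K s) A \<partial>S)"
  proof (rule countably_additiveI)
    fix F :: "nat \<Rightarrow> 'b set" assume F: "range F \<subseteq> sets R" "disjoint_family F"
    have "(\<Sum>i. \<integral>\<^sup>+s. emeasure (K s) (F i) \<partial>S) = (\<integral>\<^sup>+s. (\<Sum>i. emeasure (K s) (F i)) \<partial>S)"
      using F by (intro nn_integral_suminf[symmetric] meas) auto
    also have "\<dots> = (\<integral>\<^sup>+s. emeasure (K s) (\<Union>i. F i) \<partial>S)"
      using F sets by (intro nn_integral_cong suminf_emeasure) auto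
    finally show "(\<Sum>i. \<integral>\<^sup>+s. emeasure (K s) (F i) \<partial>S) = (\<integral>\<^sup>+s. emeasure (K s) (\<Union>i. F i) \<partial>S)" .
  qed
qed (rule A)

lemma nn_integral_mixture:
  fixes K :: "'s \<Rightarrow> 'b measure"
  assumes sets: "\<And>s. s \<in> space S \<Longrightarrow> sets (K s) = sets R"
    and meas: "\<And>A. A \<in> sets R \<Longrightarrow> (\<lambda>s. emeasure (K s) A) \<in> borel_measurable S"
    and M: "sets M = sets R" "\<And>A. A \<in> sets R \<Longrightarrow> emeasure M A = (\<integral>\<^sup>+s. emeasure (K s) A \<partial>S)"
    and f: "f \<in> borel_measurable R"
  shows "(\<integral>\<^sup>+x. f x \<partial>M) = (\<integral>\<^sup>+s. \<integral>\<^sup>+x. f x \<partial>K s \<partial>S)" "(\<lambda>s. \<integral>\<^sup>+x. f x \<partial>K s) \<in> borel_measurable S"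
proof -
  have cong: "g \<in> borel_measurable (K s)" if "g \<in> borel_measurable R" "s \<in> space S" for g :: "'b \<Rightarrow> ennreal" and s
    using that sets by (simp cong: measurable_cong_sets)
  have congM: "g \<in> borel_measurable M" if "g \<in> borel_measurable R" for g :: "'b \<Rightarrow> ennreal"
    using that M(1) by (simp cong: measurable_cong_sets)
  have space: "space (K s) = space R" if "s \<in> space S" for s using sets_eq_imp_space_eq[OF sets[OF that]] .
  have spaceM: "space M = space R" using sets_eq_imp_space_eq[OF M(1)] .
  have "(\<integral>\<^sup>+x. f x \<partial>M) = (\<integral>\<^sup>+s. \<integral>\<^sup>+x. f x \<partial>K s \<partial>S) \<and> (\<lambda>s. \<integral>\<^sup>+x. f x \<partial>K s) \<in> borel_measurable S"
    using f
  \<comment> \<open>The identity and the measurability are proved together, since additivity and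
    monotone convergence for the outer integral need the inner integrals to be measurable in
    s.\<close>
  proof (induction rule: borel_measurable_induct)
    case (cong f g)
    have "(\<integral>\<^sup>+x. f x \<partial>M) = (\<integral>\<^sup>+x. g x \<partial>M)" using cong.hyps spaceM by (intro nn_integral_cong) auto
    moreover have "(\<integral>\<^sup>+x. f x \<partial>K s) = (\<integral>\<^sup>+x. g x \<partial>K s)" if "s \<in> space S" for s
      using cong.hyps space[OF that] by (intro nn_integral_cong) auto
    ultimately show ?case using cong.IH by (simp cong: measurable_cong nn_integral_cong)
  next
    case (set A)
    have "(\<integral>\<^sup>+x. indicator A x \<partial>K s) = emeasure (K s) A" if "s \<in> space S" for s
      using set sets[OF that] by simp
    then show ?case using set M meas by (simp cong: measurable_cong nn_integral_cong)
  next
    case (mult u c)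
    have "(\<integral>\<^sup>+x. c * u x \<partial>K s) = c * (\<integral>\<^sup>+x. u x \<partial>K s)" if "s \<in> space S" for s
      using cong[OF mult.hyps(2) that] by (rule nn_integral_cmult)
    moreover have "(\<lambda>s. c * (\<integral>\<^sup>+x. u x \<partial>K s)) \<in> borel_measurable S"
      using mult.IH by (auto intro: borel_measurable_times_ennreal)
    ultimately show ?case using mult congM[OF mult.hyps(2)]
      by (simp cong: measurable_cong nn_integral_cong add: nn_integral_cmult)
  next
    case (add u v)
    have "(\<integral>\<^sup>+x. v x + u x \<partial>K s) = (\<integral>\<^sup>+x. v x \<partial>K s) + (\<integral>\<^sup>+x. u x \<partial>K s)" if "s \<in> space S" for s
      using cong[OF add.hyps(1) that] cong[OF add.hyps(3) that] by (intro nn_integral_add)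
    moreover have "(\<lambda>s. (\<integral>\<^sup>+x. v x \<partial>K s) + (\<integral>\<^sup>+x. u x \<partial>K s)) \<in> borel_measurable S"
      using add.IH by (intro borel_measurable_add) auto
    ultimately show ?case using add congM[OF add.hyps(1)] congM[OF add.hyps(3)]
      by (simp cong: measurable_cong nn_integral_cong add: nn_integral_add)
  next
    case (seq U)
    have eq: "(\<integral>\<^sup>+x. Sup (range U) x \<partial>K s) = (SUP i. \<integral>\<^sup>+x. U i x \<partial>K s)" if "s \<in> space S" for s
      unfolding SUP_apply by (intro nn_integral_monotone_convergence_SUP seq.hyps cong that)
    have "(\<integral>\<^sup>+x. Sup (range U) x \<partial>M) = (SUP i. \<integral>\<^sup>+x. U i x \<partial>M)"
      unfolding SUP_apply by (intro nn_integral_monotone_convergence_SUP seq.hyps congM)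
    also have "\<dots> = (SUP i. \<integral>\<^sup>+s. \<integral>\<^sup>+x. U i x \<partial>K s \<partial>S)" using seq.IH by simp
    also have "\<dots> = (\<integral>\<^sup>+s. (SUP i. \<integral>\<^sup>+x. U i x \<partial>K s) \<partial>S)"
      using seq.IH seq.hyps by (intro nn_integral_monotone_convergence_SUP[symmetric])
        (auto simp: incseq_def le_fun_def intro!: nn_integral_mono)
    also have "\<dots> = (\<integral>\<^sup>+s. \<integral>\<^sup>+x. Sup (range U) x \<partial>K s \<partial>S)" using eq by (simp cong: nn_integral_cong)
    finally have 1: "(\<integral>\<^sup>+x. Sup (range U) x \<partial>M) = (\<integral>\<^sup>+s. \<integral>\<^sup>+x. Sup (range U) x \<partial>K s \<partial>S)" .
    have "(\<lambda>s. SUP i. \<integral>\<^sup>+x. U i x \<partial>K s) \<in> borel_measurable S" using seq.IH by (intro borel_measurable_SUP) auto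
    then have 2: "(\<lambda>s. \<integral>\<^sup>+x. Sup (range U) x \<partial>K s) \<in> borel_measurable S" using eq by (simp cong: measurable_cong)
    show ?case using 1 2 by simp
  qed
  then show "(\<integral>\<^sup>+x. f x \<partial>M) = (\<integral>\<^sup>+s. \<integral>\<^sup>+x. f x \<partial>K s \<partial>S)" "(\<lambda>s. \<integral>\<^sup>+x. f x \<partial>K s) \<in> borel_measurable S" by auto
qed

section \<open>Palm measure and Campbell's formula\<close>

locale discrete_point_process = ergodic_point_process \<mu> X
  for \<mu> :: "'a::euclidean_space measure measure" and X :: "'a measure set" +
  fixes r :: real
  assumes r_pos: "r > 0" and X_cube: "X \<subseteq> Mp_cube r"
begin

text \<open>The process on its support. Every configuration in its space lies in
  \<open>Mp_cube r\<close>, so the uniform Gaussian bounds and the measurability of kernels hold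
  everywhere rather than almost surely.\<close>

definition N :: "'a measure measure" where "N = restrict_space \<mu> X"

lemma space_\<mu>: "space \<mu> = Mp"
  using sets_eq_imp_space_eq[OF sets_eq] by simp

lemma closedin_X: "closedin vague_topology X"
  using support by (simp add: is_vague_support_def)

lemma X_in_cube: "\<xi> \<in> X \<Longrightarrow> \<xi> \<in> Mp_cube r"
  using X_cube by auto

lemma X_in_Mp: "\<xi> \<in> X \<Longrightarrow> \<xi> \<in> Mp"
  using X_in_cube Mp_cubeD by blast

lemma X_sets: "X \<in> sets \<mu>"
  using sets_vague_borel_closed[OF closedin_X] sets_eq by simp

lemma sets_N: "sets N = {D \<in> sets vague_borel. D \<subseteq> X}"
  using X_sets unfolding N_def by (auto simp: sets_restrict_space_iff sets_eq[symmetric] sets.Int_space_eq2 Int_absorb2)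

lemma space_N [simp]: "space N = X"
  using X_in_Mp by (auto simp: N_def space_restrict_space space_\<mu>)

lemma emeasure_X: "emeasure \<mu> X = 1"
proof -
  have "emeasure \<mu> (space \<mu> - X) = 0" using support by (simp add: is_vague_support_def space_\<mu>)
  then have "prob (space \<mu> - X) = 0" by (simp add: measure_def)
  then have "prob X = 1" using prob_compl[OF X_sets] by simp
  then show ?thesis by (simp add: emeasure_eq_measure)
qed

lemma prob_space_N: "prob_space N"
  unfolding N_def by (rule prob_space_restrict_space[OF X_sets emeasure_X])

lemma nn_integral_N: "(\<integral>\<^sup>+\<xi>\<in>X. f \<xi> \<partial>\<mu>) = (\<integral>\<^sup>+\<xi>. f \<xi> \<partial>N)"
  unfolding N_def by (subst nn_integral_restrict_space) (use X_sets in \<open>auto simp: sets.Int_space_eq2\<close>)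

lemma measurable_ident_N [measurable]: "(\<lambda>\<xi>. \<xi>) \<in> measurable N vague_borel"
  using measurable_restrict_space1[OF measurable_ident_sets[OF sets_eq], of X] by (simp add: N_def)

lemma measurable_N_I:
  assumes "\<tau> \<in> measurable S vague_borel" "\<And>s. s \<in> space S \<Longrightarrow> \<tau> s \<in> X"
  shows "\<tau> \<in> measurable S N"
  unfolding N_def
  by (rule measurable_restrict_space2) (use assms in \<open>auto simp: measurable_cong_sets[OF refl sets_eq]\<close>)

text \<open>By stationarity the preimage of X under a translation is a closed set of full measure,
  and the support is contained in every such set.\<close>

lemma translate_in_X:
  assumes "\<xi> \<in> X"
  shows "translate t \<xi> \<in> X"
proof -
  let ?Y = "translate t -` X \<inter> Mp"
  have "Mp - ?Y = translate t -` (Mp - X) \<inter> Mp" using translate_in_Mp by auto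
  moreover have "openin vague_topology (Mp - X)" using closedin_X by (simp add: closedin_def)
  moreover have "Mp - X \<in> sets \<mu>" using sets.compl_sets[OF X_sets] by (simp add: space_\<mu>)
  ultimately have "openin vague_topology (Mp - ?Y)" "emeasure \<mu> (Mp - ?Y) = emeasure \<mu> (Mp - X)"
    using openin_translate_vimage[of "Mp - X" t] stationary[of "Mp - X" t] by auto
  then have "closedin vague_topology ?Y" "emeasure \<mu> (Mp - ?Y) = 0"
    using support by (auto simp: closedin_def is_vague_support_def)
  then have "X \<subseteq> ?Y" using support unfolding is_vague_support_def by blast
  then show ?thesis using assms by auto
qed

lemma translate_in_X_iff: "\<xi> \<in> Mp \<Longrightarrow> translate t \<xi> \<in> X \<longleftrightarrow> \<xi> \<in> X"
  using translate_in_X[of "translate t \<xi>" "- t"] translate_in_X[of \<xi> t]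
  by (auto simp: translate_translate translate_0)

lemma measurable_translate_N:
  assumes "\<tau> \<in> measurable S N" "u \<in> borel_measurable S"
  shows "(\<lambda>s. translate (u s) (\<tau> s)) \<in> measurable S N"
proof (rule measurable_N_I)
  have sp: "\<tau> s \<in> X" if "s \<in> space S" for s using measurable_space[OF assms(1) that] by simp
  show "translate (u s) (\<tau> s) \<in> X" if "s \<in> space S" for s using sp[OF that] by (rule translate_in_X)
  show "(\<lambda>s. translate (u s) (\<tau> s)) \<in> measurable S vague_borel"
    by (rule measurable_translate_kernel[OF measurable_compose[OF assms(1) measurable_ident_N] _ r_pos assms(2)])
      (simp add: sp X_in_cube)
qed

lemma kernel_nn_integral:
  assumes "\<tau> \<in> measurable S N" "(\<lambda>(s, x). g s x) \<in> borel_measurable (S \<Otimes>\<^sub>M borel)"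
  shows "(\<lambda>s. \<integral>\<^sup>+x. g s x \<partial>\<tau> s) \<in> borel_measurable S"
proof (rule measurable_kernel_nn_integral[OF measurable_compose[OF assms(1) measurable_ident_N] _ r_pos assms(2)])
  show "\<tau> s \<in> Mp_cube r" if "s \<in> space S" for s
    using measurable_space[OF assms(1) that] by (simp add: X_in_cube)
qed

lemma distr_translate: "distr N N (translate t) = N"
proof (rule measure_eqI)
  have meas: "translate t \<in> measurable N N"
    using measurable_translate_N[of "\<lambda>\<xi>. \<xi>" N "\<lambda>_. t"] by simp
  fix A assume "A \<in> sets (distr N N (translate t))"
  then have A: "A \<in> sets N" by simp
  then have A\<mu>: "A \<in> sets \<mu>" "A \<subseteq> X" by (auto simp: sets_N sets_eq)
  have "emeasure (distr N N (translate t)) A = emeasure N (translate t -` A \<inter> X)"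
    using meas A by (subst emeasure_distr) auto
  also have "\<dots> = emeasure \<mu> (translate t -` A \<inter> X)"
    unfolding N_def using X_sets by (intro emeasure_restrict_space) (auto simp: sets.Int_space_eq2)
  also have "translate t -` A \<inter> X = translate t -` A \<inter> Mp"
    using A\<mu>(2) translate_in_X_iff X_in_Mp by blast
  also have "emeasure \<mu> \<dots> = emeasure \<mu> A" using A\<mu>(1) by (rule stationary)
  also have "\<dots> = emeasure N A"
    unfolding N_def using X_sets A\<mu>(2) by (intro emeasure_restrict_space[symmetric]) (auto simp: sets.Int_space_eq2)
  finally show "emeasure (distr N N (translate t)) A = emeasure N A" .
qed simp

lemma nn_integral_translate_N:
  assumes "f \<in> borel_measurable N"
  shows "(\<integral>\<^sup>+\<xi>. f (translate t \<xi>) \<partial>N) = (\<integral>\<^sup>+\<xi>. f \<xi> \<partial>N)"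
proof -
  have "translate t \<in> measurable N N"
    using measurable_translate_N[of "\<lambda>\<xi>. \<xi>" N "\<lambda>_. t"] by simp
  then show ?thesis using assms by (subst (2) distr_translate[of t, symmetric], subst nn_integral_distr) auto
qed

text \<open>For a fixed configuration Lebesgue measure is moved past the two inner integrals by
  Fubini's theorem for \<sigma>-finite measures; a third exchange moves it past \<open>N\<close>.
  The inner measures depend on the configuration, so joint measurability comes from the kernel
  lemmas.\<close>

lemma nn_integral_swap_lborel:
  fixes G :: "'a measure \<Rightarrow> 'a \<Rightarrow> 'a \<Rightarrow> 'a \<Rightarrow> ennreal"
  assumes G: "(\<lambda>(((\<xi>, x), y), u). G \<xi> x y u) \<in> borel_measurable (((N \<Otimes>\<^sub>M borel) \<Otimes>\<^sub>M borel) \<Otimes>\<^sub>M borel)"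
  shows "(\<integral>\<^sup>+\<xi>. \<integral>\<^sup>+x. \<integral>\<^sup>+y. \<integral>\<^sup>+u. G \<xi> x y u \<partial>lborel \<partial>\<xi> \<partial>\<xi> \<partial>N)
       = (\<integral>\<^sup>+u. \<integral>\<^sup>+\<xi>. \<integral>\<^sup>+x. \<integral>\<^sup>+y. G \<xi> x y u \<partial>\<xi> \<partial>\<xi> \<partial>N \<partial>lborel)"
proof -
  have G' [measurable]: "(\<lambda>p. G (\<xi> p) (x p) (y p) (u p)) \<in> borel_measurable S"
    if "\<xi> \<in> measurable S N" "x \<in> borel_measurable S" "y \<in> borel_measurable S" "u \<in> borel_measurable S"
    for S :: "'s measure" and \<xi> x y u
  proof -
    have "(\<lambda>p. (((\<xi> p, x p), y p), u p)) \<in> measurable S (((N \<Otimes>\<^sub>M borel) \<Otimes>\<^sub>M borel) \<Otimes>\<^sub>M borel)"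
      using that by measurable
    from measurable_compose[OF this G] show ?thesis by simp
  qed
  have 1: "(\<integral>\<^sup>+x. \<integral>\<^sup>+y. \<integral>\<^sup>+u. G \<xi> x y u \<partial>lborel \<partial>\<xi> \<partial>\<xi>) = (\<integral>\<^sup>+u. \<integral>\<^sup>+x. \<integral>\<^sup>+y. G \<xi> x y u \<partial>\<xi> \<partial>\<xi> \<partial>lborel)"
    if \<xi>: "\<xi> \<in> X" for \<xi>
  proof -
    have Mp: "\<xi> \<in> Mp" using \<xi> by (rule X_in_Mp)
    have [measurable_cong]: "sets \<xi> = sets borel" using Mp by (rule Mp_sets)
    interpret \<xi>: sigma_finite_measure \<xi> using Mp by (rule sigma_finite_Mp)
    interpret pair_sigma_finite \<xi> lborel ..
    have [measurable]: "(\<lambda>p::'s. \<xi>) \<in> measurable S N" for S :: "'s measure" using \<xi> by simp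
    have "(\<integral>\<^sup>+x. \<integral>\<^sup>+y. \<integral>\<^sup>+u. G \<xi> x y u \<partial>lborel \<partial>\<xi> \<partial>\<xi>) = (\<integral>\<^sup>+x. \<integral>\<^sup>+u. \<integral>\<^sup>+y. G \<xi> x y u \<partial>\<xi> \<partial>lborel \<partial>\<xi>)"
      by (intro nn_integral_cong Fubini'[symmetric]) measurable
    also have "\<dots> = (\<integral>\<^sup>+u. \<integral>\<^sup>+x. \<integral>\<^sup>+y. G \<xi> x y u \<partial>\<xi> \<partial>\<xi> \<partial>lborel)"
      by (intro Fubini'[symmetric]) measurable
    finally show ?thesis .
  qed
  interpret N: prob_space N by (rule prob_space_N)
  interpret pair_sigma_finite N lborel ..
  have [measurable]: "(\<lambda>p. \<integral>\<^sup>+y. G (fst (fst p)) (snd p) y (snd (fst p)) \<partial>fst (fst p)) \<in> borel_measurable ((N \<Otimes>\<^sub>M borel) \<Otimes>\<^sub>M borel)"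
    by (rule kernel_nn_integral) measurable
  have meas: "(\<lambda>p. \<integral>\<^sup>+x. \<integral>\<^sup>+y. G (fst p) x y (snd p) \<partial>fst p \<partial>fst p) \<in> borel_measurable (N \<Otimes>\<^sub>M borel)"
    by (rule kernel_nn_integral) (simp_all add: split_beta')
  have "(\<integral>\<^sup>+\<xi>. \<integral>\<^sup>+x. \<integral>\<^sup>+y. \<integral>\<^sup>+u. G \<xi> x y u \<partial>lborel \<partial>\<xi> \<partial>\<xi> \<partial>N) = (\<integral>\<^sup>+\<xi>. \<integral>\<^sup>+u. \<integral>\<^sup>+x. \<integral>\<^sup>+y. G \<xi> x y u \<partial>\<xi> \<partial>\<xi> \<partial>lborel \<partial>N)"
    by (intro nn_integral_cong 1) simp
  also have "\<dots> = (\<integral>\<^sup>+u. \<integral>\<^sup>+\<xi>. \<integral>\<^sup>+x. \<integral>\<^sup>+y. G \<xi> x y u \<partial>\<xi> \<partial>\<xi> \<partial>N \<partial>lborel)"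
    using meas by (intro Fubini'[symmetric]) (simp add: split_beta' measurable_cong_sets[OF sets_pair_measure_cong[OF refl sets_lborel] refl])
  finally show ?thesis .
qed

lemma measurable_pair_integral:
  fixes F :: "'a measure \<Rightarrow> 'a \<Rightarrow> 'a \<Rightarrow> ennreal"
  assumes F: "(\<lambda>((\<xi>, x), y). F \<xi> x y) \<in> borel_measurable ((N \<Otimes>\<^sub>M borel) \<Otimes>\<^sub>M borel)"
  shows "(\<lambda>\<xi>. \<integral>\<^sup>+x. \<integral>\<^sup>+y. F \<xi> x y \<partial>\<xi> \<partial>\<xi>) \<in> borel_measurable N"
proof -
  have "(\<lambda>p. \<integral>\<^sup>+y. F (fst p) (snd p) y \<partial>fst p) \<in> borel_measurable (N \<Otimes>\<^sub>M borel)"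
    by (rule kernel_nn_integral) (use F in \<open>simp_all add: split_beta'\<close>)
  then show ?thesis by (intro kernel_nn_integral) (simp_all add: split_beta')
qed

end

locale palm_setting = discrete_point_process \<mu> X r
  for \<mu> :: "'a::euclidean_space measure measure" and X :: "'a measure set" and r :: real +
  fixes B :: "'a set"
  assumes B: "B \<in> sets borel" "bounded B" "emeasure lborel B > 0"
begin

definition b :: real where "b = measure lborel B"

lemma b: "b > 0" "emeasure lborel B = ennreal b"
proof -
  have "emeasure lborel B < \<infinity>" using B by (intro emeasure_bounded_finite)
  then show "emeasure lborel B = ennreal b" by (simp add: b_def emeasure_eq_ennreal_measure less_top)
  then show "b > 0" using B(3) by simp
qed

text \<open>The contribution of one configuration to the Palm measure: each point x in B carries
  weight 1 / b and yields the configuration seen from x.\<close>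

definition palm_kernel :: "'a measure \<Rightarrow> 'a measure measure" where
  "palm_kernel \<xi> = distr (density \<xi> (\<lambda>x. indicator B x / ennreal b)) N (\<lambda>x. translate (- x) \<xi>)"

lemma nn_integral_palm_kernel:
  assumes \<xi>: "\<xi> \<in> X" and f: "f \<in> borel_measurable N"
  shows "(\<integral>\<^sup>+\<eta>. f \<eta> \<partial>palm_kernel \<xi>) = (\<integral>\<^sup>+x. indicator B x / ennreal b * f (translate (- x) \<xi>) \<partial>\<xi>)"
proof -
  have [measurable_cong]: "sets \<xi> = sets borel" using \<xi> by (intro Mp_sets X_in_Mp)
  have [measurable]: "(\<lambda>x. translate (- x) \<xi>) \<in> measurable borel N"
    by (rule measurable_translate_N) (use \<xi> in auto)
  note [measurable] = B(1) f
  show ?thesis unfolding palm_kernel_def by (simp add: nn_integral_distr nn_integral_density)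
qed

lemma measurable_palm_integrand:
  assumes f: "f \<in> borel_measurable N"
  shows "(\<lambda>\<xi>. \<integral>\<^sup>+x. indicator B x / ennreal b * f (translate (- x) \<xi>) \<partial>\<xi>) \<in> borel_measurable N"
proof (rule kernel_nn_integral)
  have [measurable]: "(\<lambda>p. translate (- snd p) (fst p)) \<in> measurable (N \<Otimes>\<^sub>M borel) N"
    by (rule measurable_translate_N) measurable
  note [measurable] = B(1) f
  show "(\<lambda>(\<xi>, x). indicator B x / ennreal b * f (translate (- x) \<xi>)) \<in> borel_measurable (N \<Otimes>\<^sub>M borel)"
    unfolding split_beta' by measurable
qed simp

lemma emeasure_palm_kernel:
  "\<xi> \<in> X \<Longrightarrow> D \<in> sets N \<Longrightarrow> emeasure (palm_kernel \<xi>) D = (\<integral>\<^sup>+x. indicator B x / ennreal b * indicator D (translate (- x) \<xi>) \<partial>\<xi>)"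
  using nn_integral_palm_kernel[of \<xi> "indicator D"] by (simp add: palm_kernel_def)

lemma measurable_emeasure_palm_kernel:
  "D \<in> sets N \<Longrightarrow> (\<lambda>\<xi>. emeasure (palm_kernel \<xi>) D) \<in> borel_measurable N"
  using measurable_palm_integrand[of "indicator D"]
  by (rule measurable_cong[THEN iffD2, rotated]) (simp_all add: emeasure_palm_kernel)

text \<open>In the unordered sum over B only the terms at points of the configuration can be
  nonzero, so it is an integral against the configuration, and the volume of B moves inside as the
  weight 1 / b. In this form \<open>palm_measure\<close> is a mixture of measures.\<close>

lemma palm_measure_eq:
  "palm_measure \<mu> X B = measure_of (space N) (sets N) (\<lambda>D. \<integral>\<^sup>+\<xi>. emeasure (palm_kernel \<xi>) D \<partial>N)"
  unfolding palm_measure_def space_N sets_N[symmetric]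
proof (rule measure_of_eq)
  show "sets N \<subseteq> Pow X" using sets.space_closed[of N] by simp
  fix D assume "D \<in> sigma_sets X (sets N)"
  then have D: "D \<in> sets N" using sets.sigma_sets_eq[of N] by simp
  have sum_eq: "(\<Sum>\<^sub>\<infinity>x\<in>B. emeasure \<xi> {x} * indicator D (translate (- x) \<xi>))
      = ennreal b * (\<integral>\<^sup>+x. indicator B x / ennreal b * indicator D (translate (- x) \<xi>) \<partial>\<xi>)" if \<xi>: "\<xi> \<in> X" for \<xi>
  proof -
    have [measurable_cong]: "sets \<xi> = sets borel" using \<xi> by (intro Mp_sets X_in_Mp)
    have [measurable]: "(\<lambda>x. translate (- x) \<xi>) \<in> measurable borel N"
      by (rule measurable_translate_N) (use \<xi> in auto)
    note [measurable] = B(1) D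
    let ?h = "\<lambda>x. indicator D (translate (- x) \<xi>) :: ennreal"
    have cnt: "countable (points \<xi>)" by (rule countable_points[OF X_in_cube[OF \<xi>] r_pos])
    have "(\<Sum>\<^sub>\<infinity>x\<in>B. emeasure \<xi> {x} * ?h x) = (\<integral>\<^sup>+x. emeasure \<xi> {x} * ?h x \<partial>count_space B)"
      by (intro infsum_ennreal_eq_nn_integral countable_subset[OF _ cnt]) (auto simp: points_def)
    also have "\<dots> = (\<integral>\<^sup>+x. indicator B x * ?h x \<partial>count_space (points \<xi>))"
      using emeasure_singleton_points[OF X_in_cube[OF \<xi>] r_pos]
      by (auto simp: nn_integral_count_space_indicator indicator_def intro!: nn_integral_cong)
    also have "\<dots> = (\<integral>\<^sup>+x. indicator B x * ?h x \<partial>\<xi>)"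
      by (rule nn_integral_points[symmetric, OF X_in_cube[OF \<xi>] r_pos]) measurable
    also have "\<dots> = (\<integral>\<^sup>+x. ennreal b * (indicator B x / ennreal b * ?h x) \<partial>\<xi>)"
    proof (rule nn_integral_cong)
      fix x
      have "ennreal b * (1 / ennreal b) = 1" using b(1) by (simp add: ennreal_times_divide)
      then show "indicator B x * ?h x = ennreal b * (indicator B x / ennreal b * ?h x)"
        by (simp add: indicator_def)
    qed
    also have "\<dots> = ennreal b * (\<integral>\<^sup>+x. indicator B x / ennreal b * ?h x \<partial>\<xi>)"
      by (rule nn_integral_cmult) measurable
    finally show ?thesis .
  qed
  have "(\<integral>\<^sup>+\<xi>\<in>X. (\<Sum>\<^sub>\<infinity>x\<in>B. emeasure \<xi> {x} * indicator D (translate (- x) \<xi>)) \<partial>\<mu>)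
     = (\<integral>\<^sup>+\<xi>. ennreal b * emeasure (palm_kernel \<xi>) D \<partial>N)"
    unfolding nn_integral_N by (intro nn_integral_cong) (simp add: sum_eq emeasure_palm_kernel D)
  also have "\<dots> = ennreal b * (\<integral>\<^sup>+\<xi>. emeasure (palm_kernel \<xi>) D \<partial>N)"
    using D by (intro nn_integral_cmult measurable_emeasure_palm_kernel)
  finally show "(\<integral>\<^sup>+\<xi>\<in>X. (\<Sum>\<^sub>\<infinity>x\<in>B. emeasure \<xi> {x} * indicator D (translate (- x) \<xi>)) \<partial>\<mu>) / emeasure lborel B
     = (\<integral>\<^sup>+\<xi>. emeasure (palm_kernel \<xi>) D \<partial>N)"
    using b(1) unfolding b(2) by (simp only:) (subst mult.commute, rule ennreal_mult_divide_eq, auto)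
qed

abbreviation P :: "'a measure measure" where "P \<equiv> palm_measure \<mu> X B"

abbreviation \<gamma> :: "'a measure" where "\<gamma> \<equiv> first_moment P"

lemma sets_P: "sets P = sets N"
  unfolding palm_measure_eq by (rule sets.sets_measure_of_eq)

lemma nn_integral_P:
  assumes f: "f \<in> borel_measurable N"
  shows "(\<integral>\<^sup>+\<eta>. f \<eta> \<partial>P) = (\<integral>\<^sup>+\<xi>. \<integral>\<^sup>+x. indicator B x / ennreal b * f (translate (- x) \<xi>) \<partial>\<xi> \<partial>N)"
proof -
  have "(\<integral>\<^sup>+\<eta>. f \<eta> \<partial>P) = (\<integral>\<^sup>+\<xi>. \<integral>\<^sup>+\<eta>. f \<eta> \<partial>palm_kernel \<xi> \<partial>N)"
  proof (rule nn_integral_mixture(1))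
    show "sets P = sets N" by (rule sets_P)
    show s: "sets (palm_kernel \<xi>) = sets N" for \<xi> by (simp add: palm_kernel_def)
    show m: "(\<lambda>\<xi>. emeasure (palm_kernel \<xi>) D) \<in> borel_measurable N" if "D \<in> sets N" for D
      using that by (rule measurable_emeasure_palm_kernel)
    show "emeasure P D = (\<integral>\<^sup>+\<xi>. emeasure (palm_kernel \<xi>) D \<partial>N)" if "D \<in> sets N" for D
      unfolding palm_measure_eq by (rule emeasure_mixture[OF s m that])
  qed (rule f)
  then show ?thesis by (simp add: nn_integral_palm_kernel[OF _ f] cong: nn_integral_cong_simp)
qed

lemma sets_\<gamma> [simp, measurable_cong]: "sets \<gamma> = sets borel"
  using sets.sigma_sets_eq[of "borel :: 'a measure"] by (simp add: first_moment_def)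

text \<open>Two mixtures are unfolded, the first moment over the Palm measure and the Palm measure
  over \<open>N\<close>. Seen from a point x, a point y of the configuration sits at y - x.\<close>

lemma nn_integral_\<gamma>:
  assumes h [measurable]: "h \<in> borel_measurable borel"
  shows "(\<integral>\<^sup>+s. h s \<partial>\<gamma>) = (\<integral>\<^sup>+\<xi>. \<integral>\<^sup>+x. \<integral>\<^sup>+y. indicator B x / ennreal b * h (y - x) \<partial>\<xi> \<partial>\<xi> \<partial>N)"
proof -
  have spP: "space P = X" using sets_eq_imp_space_eq[OF sets_P] by simp
  have [measurable_cong]: "sets P = sets N" by (rule sets_P)
  have "(\<integral>\<^sup>+s. h s \<partial>\<gamma>) = (\<integral>\<^sup>+\<eta>. \<integral>\<^sup>+s. h s \<partial>\<eta> \<partial>P)"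
  proof (rule nn_integral_mixture(1)[where R=borel])
    show s: "sets \<eta> = sets borel" if "\<eta> \<in> space P" for \<eta> using that spP by (simp add: Mp_sets X_in_Mp)
    show m: "(\<lambda>\<eta>. emeasure \<eta> A) \<in> borel_measurable P" if A: "A \<in> sets borel" for A :: "'a set"
    proof -
      have "(\<lambda>\<eta>. \<integral>\<^sup>+x. indicator A x \<partial>\<eta>) \<in> borel_measurable N"
        using A by (intro kernel_nn_integral) auto
      then have "(\<lambda>\<eta>. emeasure \<eta> A) \<in> borel_measurable N"
        by (rule measurable_cong[THEN iffD2, rotated]) (use A s spP in simp)
      then show ?thesis by simp
    qed
    show "emeasure \<gamma> A = (\<integral>\<^sup>+\<eta>. emeasure \<eta> A \<partial>P)" if "A \<in> sets borel" for A
      using emeasure_mixture[of P "\<lambda>\<eta>. \<eta>" borel, OF s m that] by (simp add: first_moment_def)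
  qed simp_all
  also have "\<dots> = (\<integral>\<^sup>+\<xi>. \<integral>\<^sup>+x. indicator B x / ennreal b * (\<integral>\<^sup>+s. h s \<partial>translate (- x) \<xi>) \<partial>\<xi> \<partial>N)"
    by (intro nn_integral_P kernel_nn_integral) measurable
  also have "\<dots> = (\<integral>\<^sup>+\<xi>. \<integral>\<^sup>+x. \<integral>\<^sup>+y. indicator B x / ennreal b * h (y - x) \<partial>\<xi> \<partial>\<xi> \<partial>N)"
  proof (intro nn_integral_cong)
    fix \<xi> x assume "\<xi> \<in> space N"
    then have Mp: "\<xi> \<in> Mp" by (simp add: X_in_Mp)
    then have [measurable_cong]: "sets \<xi> = sets borel" by (rule Mp_sets)
    have "(\<integral>\<^sup>+s. h s \<partial>translate (- x) \<xi>) = (\<integral>\<^sup>+y. h (y - x) \<partial>\<xi>)"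
      by (subst nn_integral_translate[OF Mp]) simp_all
    then show "indicator B x / ennreal b * (\<integral>\<^sup>+s. h s \<partial>translate (- x) \<xi>) = (\<integral>\<^sup>+y. indicator B x / ennreal b * h (y - x) \<partial>\<xi>)"
      by (simp add: nn_integral_cmult)
  qed
  finally show ?thesis .
qed

text \<open>
  After substituting \<open>z = x + u\<close> and translating the process by \<open>- u\<close>, the averaging set
  \<open>B\<close> only enters through the integral of \<open>indicator B (x - u) / b\<close> over \<open>u\<close>, which is \<open>1\<close>.
\<close>

theorem campbell:
  fixes F :: "'a \<Rightarrow> 'a \<Rightarrow> ennreal"
  assumes F: "(\<lambda>(z, s). F z s) \<in> borel_measurable (borel \<Otimes>\<^sub>M borel)"
  shows "(\<integral>\<^sup>+\<xi>. \<integral>\<^sup>+x. \<integral>\<^sup>+y. F x (y - x) \<partial>\<xi> \<partial>\<xi> \<partial>N) = (\<integral>\<^sup>+s. \<integral>\<^sup>+z. F z s \<partial>lborel \<partial>\<gamma>)"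
proof -
  have F' [measurable]: "(\<lambda>p. F (z p) (s p)) \<in> borel_measurable S"
    if "z \<in> borel_measurable S" "s \<in> borel_measurable S" for S :: "'s measure" and z s
    using measurable_compose[OF measurable_Pair[OF that] F] by simp
  note [measurable] = B(1)
  have c1: "(\<integral>\<^sup>+u. indicator B (x - u) / ennreal b \<partial>lborel) = 1" for x
  proof -
    have "(\<integral>\<^sup>+u. indicator B (x - u) / ennreal b \<partial>lborel) = (\<integral>\<^sup>+u. indicator B (x + - u) / ennreal b \<partial>lborel)" by simp
    also have "\<dots> = (\<integral>\<^sup>+u. indicator B (x + u) / ennreal b \<partial>lborel)"
      by (rule lborel_nn_integral_reflect) measurable
    also have "\<dots> = (\<integral>\<^sup>+u. indicator B u / ennreal b \<partial>lborel)"
      by (rule lborel_nn_integral_shift) measurable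
    also have "\<dots> = emeasure lborel B / ennreal b"
      by (subst nn_integral_divide) auto
    also have "\<dots> = 1" using b by (simp add: ennreal_divide_self)
    finally show ?thesis .
  qed
  have Fz: "(\<lambda>s. \<integral>\<^sup>+z. F z s \<partial>lborel) \<in> borel_measurable borel" by measurable
  have "(\<integral>\<^sup>+s. \<integral>\<^sup>+z. F z s \<partial>lborel \<partial>\<gamma>)
      = (\<integral>\<^sup>+\<xi>. \<integral>\<^sup>+x. \<integral>\<^sup>+y. indicator B x / ennreal b * (\<integral>\<^sup>+z. F z (y - x) \<partial>lborel) \<partial>\<xi> \<partial>\<xi> \<partial>N)"
    by (rule nn_integral_\<gamma>[OF Fz])
  also have "\<dots> = (\<integral>\<^sup>+\<xi>. \<integral>\<^sup>+x. \<integral>\<^sup>+y. \<integral>\<^sup>+u. indicator B x / ennreal b * F (x + u) (y - x) \<partial>lborel \<partial>\<xi> \<partial>\<xi> \<partial>N)"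
  proof (intro nn_integral_cong)
    fix x y :: 'a
    have "(\<integral>\<^sup>+z. F z (y - x) \<partial>lborel) = (\<integral>\<^sup>+u. F (x + u) (y - x) \<partial>lborel)"
      by (rule lborel_nn_integral_shift[symmetric]) measurable
    then show "indicator B x / ennreal b * (\<integral>\<^sup>+z. F z (y - x) \<partial>lborel) = (\<integral>\<^sup>+u. indicator B x / ennreal b * F (x + u) (y - x) \<partial>lborel)"
      by (simp add: nn_integral_cmult)
  qed
  also have "\<dots> = (\<integral>\<^sup>+u. \<integral>\<^sup>+\<xi>. \<integral>\<^sup>+x. \<integral>\<^sup>+y. indicator B x / ennreal b * F (x + u) (y - x) \<partial>\<xi> \<partial>\<xi> \<partial>N \<partial>lborel)"
    by (rule nn_integral_swap_lborel) (unfold split_beta', measurable)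
  also have "\<dots> = (\<integral>\<^sup>+u. \<integral>\<^sup>+\<xi>. \<integral>\<^sup>+x. \<integral>\<^sup>+y. indicator B (x - u) / ennreal b * F x (y - x) \<partial>\<xi> \<partial>\<xi> \<partial>N \<partial>lborel)"
  proof (rule nn_integral_cong)
    fix u :: 'a
    let ?Q = "\<lambda>\<xi>. \<integral>\<^sup>+x. \<integral>\<^sup>+y. indicator B x / ennreal b * F (x + u) (y - x) \<partial>\<xi> \<partial>\<xi>"
    have "?Q \<in> borel_measurable N"
      by (rule measurable_pair_integral) (unfold split_beta', measurable)
    then have "(\<integral>\<^sup>+\<xi>. ?Q \<xi> \<partial>N) = (\<integral>\<^sup>+\<xi>. ?Q (translate (- u) \<xi>) \<partial>N)"
      by (rule nn_integral_translate_N[symmetric])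
    also have "\<dots> = (\<integral>\<^sup>+\<xi>. \<integral>\<^sup>+x. \<integral>\<^sup>+y. indicator B (x - u) / ennreal b * F x (y - x) \<partial>\<xi> \<partial>\<xi> \<partial>N)"
    proof (rule nn_integral_cong)
      fix \<xi> assume "\<xi> \<in> space N"
      then have Mp: "\<xi> \<in> Mp" by (simp add: X_in_Mp)
      have sT: "sigma_finite_measure (translate (- u) \<xi>)" by (rule sigma_finite_Mp[OF translate_in_Mp[OF Mp]])
      interpret T: sigma_finite_measure "translate (- u) \<xi>" by (rule sT)
      have "?Q (translate (- u) \<xi>) = (\<integral>\<^sup>+x. \<integral>\<^sup>+y. indicator B (- u + x) / ennreal b * F (- u + x + u) (y - (- u + x)) \<partial>translate (- u) \<xi> \<partial>\<xi>)"
        by (rule nn_integral_translate[OF Mp]) measurable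
      also have "\<dots> = (\<integral>\<^sup>+x. \<integral>\<^sup>+y. indicator B (- u + x) / ennreal b * F (- u + x + u) (- u + y - (- u + x)) \<partial>\<xi> \<partial>\<xi>)"
        by (intro nn_integral_cong nn_integral_translate[OF Mp]) measurable
      finally show "?Q (translate (- u) \<xi>) = (\<integral>\<^sup>+x. \<integral>\<^sup>+y. indicator B (x - u) / ennreal b * F x (y - x) \<partial>\<xi> \<partial>\<xi>)"
        by simp
    qed
    finally show "(\<integral>\<^sup>+\<xi>. ?Q \<xi> \<partial>N) = (\<integral>\<^sup>+\<xi>. \<integral>\<^sup>+x. \<integral>\<^sup>+y. indicator B (x - u) / ennreal b * F x (y - x) \<partial>\<xi> \<partial>\<xi> \<partial>N)" .
  qed
  also have "\<dots> = (\<integral>\<^sup>+\<xi>. \<integral>\<^sup>+x. \<integral>\<^sup>+y. \<integral>\<^sup>+u. indicator B (x - u) / ennreal b * F x (y - x) \<partial>lborel \<partial>\<xi> \<partial>\<xi> \<partial>N)"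
    by (rule nn_integral_swap_lborel[symmetric]) (unfold split_beta', measurable)
  also have "\<dots> = (\<integral>\<^sup>+\<xi>. \<integral>\<^sup>+x. \<integral>\<^sup>+y. F x (y - x) \<partial>\<xi> \<partial>\<xi> \<partial>N)"
    by (intro nn_integral_cong, subst nn_integral_multc) (auto simp: c1)
  finally show ?thesis ..
qed

end

section \<open>Smoothed Fourier sums of a point set\<close>

definition wave :: "'a::euclidean_space \<Rightarrow> 'a \<Rightarrow> complex" where
  "wave k x = cis (2 * pi * (k \<bullet> x))"

lemma norm_wave [simp]: "norm (wave k x) = 1"
  by (simp add: wave_def)

lemma wave_add: "wave k (x + y) = wave k x * wave k y"
  by (simp add: wave_def inner_add_right distrib_left cis_mult)

lemma wave_measurable [measurable]: "wave k \<in> borel_measurable borel"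
proof -
  have "continuous_on UNIV (wave k)" unfolding wave_def cis_conv_exp by (intro continuous_intros)
  then show ?thesis by (rule borel_measurable_continuous_onI)
qed

definition gauss_wave_sum :: "'a::euclidean_space \<Rightarrow> real \<Rightarrow> 'a measure \<Rightarrow> complex" where
  "gauss_wave_sum k a \<xi> = (\<integral>x. wave k x * of_real (gauss a x) \<partial>\<xi>)"

lemma integrable_wave_gauss:
  assumes "\<xi> \<in> Mp_cube r" "r > 0" "a \<ge> 1"
  shows "integrable \<xi> (\<lambda>x. wave k x * of_real (gauss a x))"
proof -
  have [measurable_cong]: "sets \<xi> = sets borel" using assms by (intro Mp_sets Mp_cubeD)
  show ?thesis
    by (rule Bochner_Integration.integrable_bound[OF integrable_gauss_Mp_cube[OF assms]]) (auto simp: norm_mult)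
qed

lemma integrable_shift_Mp:
  fixes f :: "'a::euclidean_space \<Rightarrow> 'b::{banach, second_countable_topology}"
  assumes "\<xi> \<in> Mp" "integrable (translate t \<xi>) f" and [measurable]: "f \<in> borel_measurable borel"
  shows "integrable \<xi> (\<lambda>x. f (t + x))"
proof -
  have [measurable_cong]: "sets \<xi> = sets borel" using assms(1) by (rule Mp_sets)
  show ?thesis using assms(2) unfolding translate_def by (subst (asm) integrable_distr_eq) auto
qed

text \<open>Translation multiplies every wave exactly by \<open>wave k t\<close>; only the Gaussian
  weights change, and \<open>gauss_shift_error\<close> bounds that change by weights with parameter
  2 * a. Their sums over the configuration and over its translate are each at most C, so the error
  is of order 1 / sqrt a uniformly in the configuration.\<close>

lemma gauss_wave_sum_translate_error:
  fixes \<xi> :: "'a::euclidean_space measure"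
  assumes \<xi>: "\<xi> \<in> Mp_cube r" and r: "r > 0" and a: "a \<ge> 1"
    and C: "\<And>(\<xi> :: 'a measure) a. \<xi> \<in> Mp_cube r \<Longrightarrow> a \<ge> 1 \<Longrightarrow> (\<integral>x. gauss a x \<partial>\<xi>) \<le> C"
  shows "cmod (gauss_wave_sum k a (translate t \<xi>) - wave k t * gauss_wave_sum k a \<xi>)
     \<le> sqrt (pi / (2 * a)) * (norm t * sqrt 2 ^ DIM('a) * (2 * C))"
proof -
  have Mp: "\<xi> \<in> Mp" using \<xi> by (rule Mp_cubeD)
  have [measurable_cong]: "sets \<xi> = sets borel" using Mp by (rule Mp_sets)
  have T: "translate t \<xi> \<in> Mp_cube r" using \<xi> by (rule Mp_cube_translate)
  let ?c = "sqrt (pi / (2 * a)) * norm t * sqrt 2 ^ DIM('a)"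
  let ?h = "\<lambda>x. wave k x * complex_of_real (gauss a x)" and ?g = "gauss (2 * a)"
  have i1: "integrable \<xi> (\<lambda>x. ?h (t + x))"
    by (rule integrable_shift_Mp[OF Mp integrable_wave_gauss[OF T r a]]) measurable
  have i2: "integrable \<xi> (\<lambda>x. wave k t * ?h x)"
    by (intro integrable_mult_right integrable_wave_gauss[OF \<xi> r a])
  have i3: "integrable \<xi> (\<lambda>x. ?g (t + x))"
    by (rule integrable_shift_Mp[OF Mp integrable_gauss_Mp_cube[OF T r]]) (use a in auto)
  have i4: "integrable \<xi> (\<lambda>x. ?g x)"
    by (rule integrable_gauss_Mp_cube[OF \<xi> r]) (use a in auto)
  have "gauss_wave_sum k a (translate t \<xi>) = (\<integral>x. ?h (t + x) \<partial>\<xi>)"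
    unfolding gauss_wave_sum_def by (rule integral_translate[OF Mp]) measurable
  moreover have "wave k t * gauss_wave_sum k a \<xi> = (\<integral>x. wave k t * ?h x \<partial>\<xi>)"
    by (simp add: gauss_wave_sum_def)
  ultimately have "gauss_wave_sum k a (translate t \<xi>) - wave k t * gauss_wave_sum k a \<xi>
      = (\<integral>x. ?h (t + x) - wave k t * ?h x \<partial>\<xi>)"
    using i1 i2 by simp
  also have "cmod \<dots> \<le> (\<integral>x. cmod (?h (t + x) - wave k t * ?h x) \<partial>\<xi>)"
    by (rule integral_norm_bound)
  also have "\<dots> \<le> (\<integral>x. ?c * (?g (t + x) + ?g x) \<partial>\<xi>)"
  proof (rule integral_mono)
    fix x
    have "?h (t + x) - wave k t * ?h x
        = wave k t * wave k x * of_real (gauss a (t + x) - gauss a x)"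
      by (simp add: wave_add algebra_simps)
    then have "cmod (?h (t + x) - wave k t * ?h x) = \<bar>gauss a (t + x) - gauss a x\<bar>"
      by (simp add: norm_mult del: of_real_diff)
    also have "\<dots> \<le> ?c * (?g (t + x) + ?g x)"
      using a by (intro gauss_shift_error) simp
    finally show "cmod (?h (t + x) - wave k t * ?h x)
        \<le> ?c * (?g (t + x) + ?g x)" .
  qed (use i1 i2 i3 i4 in auto)
  also have "\<dots> = ?c * ((\<integral>x. ?g (t + x) \<partial>\<xi>) + (\<integral>x. ?g x \<partial>\<xi>))"
    using i3 i4 by simp
  also have "(\<integral>x. ?g (t + x) \<partial>\<xi>) = (\<integral>x. ?g x \<partial>translate t \<xi>)"
    by (rule integral_translate[OF Mp, symmetric]) measurable
  also have "?c * ((\<integral>x. ?g x \<partial>translate t \<xi>) + (\<integral>x. ?g x \<partial>\<xi>)) \<le> ?c * (C + C)"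
    using a by (intro mult_left_mono add_mono C T \<xi>) auto
  finally show ?thesis by (simp add: algebra_simps)
qed

text \<open>Expressing membership of s + x as an integral over y gives the overlap of a
  configuration with its translate the form of a double sum over pairs of points, to which
  \<open>campbell\<close> applies.\<close>

lemma emeasure_points_vimage:
  assumes \<xi>: "\<xi> \<in> Mp_cube r" "r > 0"
  shows "(\<integral>\<^sup>+y. indicator {s} (y - x) \<partial>\<xi>) = (indicator (points \<xi>) (s + x) :: ennreal)"
proof -
  have Mp: "\<xi> \<in> Mp" using \<xi> by (intro Mp_cubeD)
  have "(\<integral>\<^sup>+y. indicator {s} (y - x) \<partial>\<xi>) = (\<integral>\<^sup>+y. indicator {s + x} y \<partial>\<xi>)"
    by (intro nn_integral_cong) (auto simp: indicator_def algebra_simps)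
  also have "\<dots> = emeasure \<xi> {s + x}" by (rule nn_integral_indicator) (simp add: Mp_sets[OF Mp])
  finally show ?thesis by (simp add: emeasure_singleton_points[OF \<xi>])
qed

lemma bij_betw_shift_points:
  "bij_betw ((+) t) {x \<in> \<Lambda>. t + x \<in> \<Lambda>} {x \<in> \<Lambda>. x - t \<in> \<Lambda>}" for t :: "'a::ab_group_add"
  by (rule bij_betwI[where g="\<lambda>x. x - t"]) auto

text \<open>Both sides sum over pairs of points that differ by t, indexed on the left by the end
  point and on the right by the starting point.\<close>

lemma nn_integral_reindex_points:
  assumes \<xi>: "\<xi> \<in> Mp_cube r" "r > 0" and f [measurable]: "f \<in> borel_measurable borel"
  shows "(\<integral>\<^sup>+x. f x * indicator (points \<xi>) (x - t) \<partial>\<xi>) = (\<integral>\<^sup>+x. f (t + x) * indicator (points \<xi>) (t + x) \<partial>\<xi>)"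
proof -
  have [measurable]: "points \<xi> \<in> sets borel" using AE_points(1)[OF Mp_cubeD[OF \<xi>(1)]] by (rule borel_closed)
  let ?P = "points \<xi>"
  have "(\<integral>\<^sup>+x. f x * indicator ?P (x - t) \<partial>\<xi>) = (\<integral>\<^sup>+x. f x \<partial>count_space {x \<in> ?P. x - t \<in> ?P})"
    by (subst nn_integral_points[OF \<xi>])
      (auto simp: nn_integral_count_space_indicator indicator_def intro!: nn_integral_cong)
  also have "\<dots> = (\<integral>\<^sup>+x. f (t + x) \<partial>count_space {x \<in> ?P. t + x \<in> ?P})"
    by (rule nn_integral_bij_count_space[OF bij_betw_shift_points, symmetric])
  also have "\<dots> = (\<integral>\<^sup>+x. f (t + x) * indicator ?P (t + x) \<partial>\<xi>)"
    by (subst nn_integral_points[OF \<xi>])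
      (auto simp: nn_integral_count_space_indicator indicator_def intro!: nn_integral_cong)
  finally show ?thesis .
qed

lemma integral_reindex_points:
  fixes f :: "'a::euclidean_space \<Rightarrow> complex"
  assumes \<xi>: "\<xi> \<in> Mp_cube r" "r > 0" and f [measurable]: "f \<in> borel_measurable borel"
  shows "(\<integral>x. indicator (points \<xi>) (x - t) *\<^sub>R f x \<partial>\<xi>) = (\<integral>x. indicator (points \<xi>) (t + x) *\<^sub>R f (t + x) \<partial>\<xi>)"
proof -
  have [measurable]: "points \<xi> \<in> sets borel" using AE_points(1)[OF Mp_cubeD[OF \<xi>(1)]] by (rule borel_closed)
  let ?P = "points \<xi>"
  have ind: "(\<integral>x. g x \<partial>count_space A) = (\<integral>x. indicator A x *\<^sub>R g x \<partial>count_space UNIV)" for A and g :: "'a \<Rightarrow> complex"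
    using integral_restrict_space[of A "count_space UNIV" g] by (simp add: restrict_count_space)
  have "(\<integral>x. indicator ?P (x - t) *\<^sub>R f x \<partial>\<xi>) = (\<integral>x. f x \<partial>count_space {x \<in> ?P. x - t \<in> ?P})"
    by (subst integral_points[OF \<xi>])
      (auto simp: ind[of ?P] ind[of "{x \<in> ?P. x - t \<in> ?P}"] indicator_def intro!: Bochner_Integration.integral_cong)
  also have "\<dots> = (\<integral>x. f (t + x) \<partial>count_space {x \<in> ?P. t + x \<in> ?P})"
    by (rule integral_bij_count_space[OF bij_betw_shift_points, symmetric])
  also have "\<dots> = (\<integral>x. indicator ?P (t + x) *\<^sub>R f (t + x) \<partial>\<xi>)"
    by (subst integral_points[OF \<xi>])
      (auto simp: ind[of ?P] ind[of "{x \<in> ?P. t + x \<in> ?P}"] indicator_def intro!: Bochner_Integration.integral_cong)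
  finally show ?thesis .
qed

text \<open>
  The common points of \<open>\<xi>\<close> and of its translate cancel in the difference of the two sums;
  each of them is counted twice on the right.
\<close>

lemma gauss_wave_sum_translate_diff:
  assumes \<xi>: "\<xi> \<in> Mp_cube r" "r > 0" and a: "a \<ge> 1"
  shows "ennreal (cmod (gauss_wave_sum k a (translate t \<xi>) - gauss_wave_sum k a \<xi>))
       + 2 * (\<integral>\<^sup>+x. \<integral>\<^sup>+y. ennreal (gauss a (t + x)) * indicator {t} (y - x) \<partial>\<xi> \<partial>\<xi>)
     \<le> (\<integral>\<^sup>+x. \<integral>\<^sup>+y. ennreal (gauss a (t + x)) * indicator {0} (y - x) \<partial>\<xi> \<partial>\<xi>)
       + (\<integral>\<^sup>+x. \<integral>\<^sup>+y. ennreal (gauss a x) * indicator {0} (y - x) \<partial>\<xi> \<partial>\<xi>)"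
proof -
  have Mp: "\<xi> \<in> Mp" using \<xi> by (intro Mp_cubeD)
  have [measurable_cong]: "sets \<xi> = sets borel" using Mp by (rule Mp_sets)
  have T: "translate t \<xi> \<in> Mp_cube r" using \<xi>(1) by (rule Mp_cube_translate)
  let ?P = "points \<xi>"
  have P_sets [measurable]: "?P \<in> sets borel" using AE_points(1)[OF Mp] by (rule borel_closed)
  let ?h = "\<lambda>x. wave k x * complex_of_real (gauss a x)"
  \<comment> \<open>\<open>?A\<close> collects the points of the translate that are also points of
    \<xi>, \<open>?A'\<close> the others; \<open>?B\<close> and \<open>?B'\<close> split the points
    of \<xi> by membership in the translate. \<open>?A\<close> and \<open>?B\<close> run over the
    same common points, once as t + x and once as x, so their integrals agree and cancel.\<close>
  let ?A = "\<lambda>x. indicator ?P (t + x) *\<^sub>R ?h (t + x)" and ?A' = "\<lambda>x. (1 - indicator ?P (t + x)) *\<^sub>R ?h (t + x)"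
  let ?B = "\<lambda>x. indicator ?P (x - t) *\<^sub>R ?h x" and ?B' = "\<lambda>x. (1 - indicator ?P (x - t)) *\<^sub>R ?h x"
  let ?S = "gauss_wave_sum k a \<xi>" and ?T = "gauss_wave_sum k a (translate t \<xi>)"
  have ih: "integrable \<xi> ?h" by (rule integrable_wave_gauss[OF \<xi> a])
  have ihT: "integrable \<xi> (\<lambda>x. ?h (t + x))"
    by (rule integrable_shift_Mp[OF Mp integrable_wave_gauss[OF T \<xi>(2) a]]) measurable
  have iA: "integrable \<xi> (\<lambda>x. ?A x)"
    by (rule Bochner_Integration.integrable_bound[OF ihT]) (auto simp: indicator_def)
  have iA': "integrable \<xi> (\<lambda>x. ?A' x)"
    by (rule Bochner_Integration.integrable_bound[OF ihT]) (auto simp: indicator_def)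
  have iB: "integrable \<xi> (\<lambda>x. ?B x)"
    by (rule Bochner_Integration.integrable_bound[OF ih]) (auto simp: indicator_def)
  have iB': "integrable \<xi> (\<lambda>x. ?B' x)"
    by (rule Bochner_Integration.integrable_bound[OF ih]) (auto simp: indicator_def)
  have "?T = (\<integral>x. ?h (t + x) \<partial>\<xi>)"
    unfolding gauss_wave_sum_def by (rule integral_translate[OF Mp]) measurable
  also have "\<dots> = (\<integral>x. ?A x + ?A' x \<partial>\<xi>)"
    by (simp add: scaleR_left_distrib[symmetric])
  also have "\<dots> = (\<integral>x. ?A x \<partial>\<xi>) + (\<integral>x. ?A' x \<partial>\<xi>)"
    by (rule Bochner_Integration.integral_add[OF iA iA'])
  finally have 1: "?T = \<dots>" .
  have "?S = (\<integral>x. ?B x + ?B' x \<partial>\<xi>)"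
    by (simp add: scaleR_left_distrib[symmetric] gauss_wave_sum_def)
  also have "\<dots> = (\<integral>x. ?B x \<partial>\<xi>) + (\<integral>x. ?B' x \<partial>\<xi>)"
    by (rule Bochner_Integration.integral_add[OF iB iB'])
  also have "(\<integral>x. ?B x \<partial>\<xi>) = (\<integral>x. ?A x \<partial>\<xi>)"
    by (rule integral_reindex_points[OF \<xi>]) measurable
  finally have 2: "?S = \<dots> + (\<integral>x. ?B' x \<partial>\<xi>)" .
  have "cmod (?T - ?S)
     = cmod ((\<integral>x. ?A' x \<partial>\<xi>) - (\<integral>x. ?B' x \<partial>\<xi>))"
    unfolding 1 2 by simp
  also have "\<dots> \<le> cmod (\<integral>x. ?A' x \<partial>\<xi>) + cmod (\<integral>x. ?B' x \<partial>\<xi>)"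
    by (rule norm_triangle_ineq4)
  finally have "ennreal (cmod (?T - ?S))
     \<le> ennreal (cmod (\<integral>x. ?A' x \<partial>\<xi>)) + ennreal (cmod (\<integral>x. ?B' x \<partial>\<xi>))"
    by (simp flip: ennreal_plus)
  also have "\<dots> \<le> (\<integral>\<^sup>+x. ennreal (cmod (?A' x)) \<partial>\<xi>) + (\<integral>\<^sup>+x. ennreal (cmod (?B' x)) \<partial>\<xi>)"
    by (intro add_mono integral_norm_bound_ennreal iA' iB')
  finally have 3: "ennreal (cmod (?T - ?S))
      \<le> (\<integral>\<^sup>+x. ennreal (cmod (?A' x)) \<partial>\<xi>) + (\<integral>\<^sup>+x. ennreal (cmod (?B' x)) \<partial>\<xi>)" .
  let ?V = "\<integral>\<^sup>+x. ennreal (gauss a (t + x)) * indicator ?P (t + x) \<partial>\<xi>"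
  have gp: "\<bar>gauss a x\<bar> = gauss a x" for x :: 'a using a gauss_pos[of a x] by simp
  \<comment> \<open>The common weight \<open>?V\<close> is carried as a summand, so that nothing has
    to be subtracted in \<open>ennreal\<close>.\<close>
  have 4: "(\<integral>\<^sup>+x. ennreal (cmod (?A' x)) \<partial>\<xi>) + ?V = (\<integral>\<^sup>+x. ennreal (gauss a (t + x)) \<partial>\<xi>)"
    by (subst nn_integral_add[symmetric]) (auto intro!: nn_integral_cong simp: indicator_def norm_mult gp)
  have "(\<integral>\<^sup>+x. ennreal (cmod (?B' x)) \<partial>\<xi>) + (\<integral>\<^sup>+x. ennreal (gauss a x) * indicator ?P (x - t) \<partial>\<xi>) = (\<integral>\<^sup>+x. ennreal (gauss a x) \<partial>\<xi>)"
    by (subst nn_integral_add[symmetric]) (auto intro!: nn_integral_cong simp: indicator_def norm_mult gp)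
  also have "(\<integral>\<^sup>+x. ennreal (gauss a x) * indicator ?P (x - t) \<partial>\<xi>) = ?V"
    by (rule nn_integral_reindex_points[OF \<xi>]) measurable
  finally have 5: "(\<integral>\<^sup>+x. ennreal (cmod (?B' x)) \<partial>\<xi>) + ?V = (\<integral>\<^sup>+x. ennreal (gauss a x) \<partial>\<xi>)" .
  have inner: "(\<integral>\<^sup>+y. c * indicator {s} (y - x) \<partial>\<xi>) = c * indicator ?P (s + x)" for c :: ennreal and s x
    by (subst nn_integral_cmult) (auto simp: emeasure_points_vimage[OF \<xi>])
  \<comment> \<open>For s = 0 the membership condition holds at almost every x, because x is itself
    a point.\<close>
  have zero: "(\<integral>\<^sup>+x. f x * indicator ?P (0 + x) \<partial>\<xi>) = (\<integral>\<^sup>+x. f x \<partial>\<xi>)" for f :: "'a \<Rightarrow> ennreal"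
    using AE_points(2)[OF Mp] by (intro nn_integral_cong_AE) auto
  have "ennreal (cmod (?T - ?S)) + 2 * ?V
     \<le> ((\<integral>\<^sup>+x. ennreal (cmod (?A' x)) \<partial>\<xi>) + (\<integral>\<^sup>+x. ennreal (cmod (?B' x)) \<partial>\<xi>)) + 2 * ?V"
    by (rule add_right_mono[OF 3])
  also have "\<dots> = (\<integral>\<^sup>+x. ennreal (gauss a (t + x)) \<partial>\<xi>) + (\<integral>\<^sup>+x. ennreal (gauss a x) \<partial>\<xi>)"
    unfolding 4[symmetric] 5[symmetric] mult_2 by (simp only: add_ac)
  finally show ?thesis unfolding inner zero .
qed

locale palm_fourier = palm_setting \<mu> X r B
  for \<mu> :: "'a::euclidean_space measure measure" and X :: "'a measure set" and r :: real and B :: "'a set" +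
  fixes \<nu> :: "'a measure" and k :: 'a
  assumes ft: "has_fourier_transform \<gamma> \<nu>"
begin

abbreviation S :: "real \<Rightarrow> 'a measure \<Rightarrow> complex" where
  "S \<equiv> gauss_wave_sum k"

definition J :: "real \<Rightarrow> real" where
  "J q = (\<integral>y. cos (2 * pi * (k \<bullet> y)) * gauss q y \<partial>\<gamma>)"

sublocale N: prob_space N
  by (rule prob_space_N)

lemma integral_gauss_bound:
  obtains C where "C > 0" "\<forall>\<xi>::'a measure. \<forall>a. \<xi> \<in> Mp_cube r \<longrightarrow> a \<ge> 1 \<longrightarrow> (\<integral>x. gauss a x \<partial>\<xi>) \<le> C"
proof -
  obtain C where C: "C > 0" "\<And>(\<xi> :: 'a measure) a. \<xi> \<in> Mp_cube r \<Longrightarrow> a \<ge> 1 \<Longrightarrow> (\<integral>\<^sup>+x. gauss a x \<partial>\<xi>) \<le> ennreal C"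
    using nn_integral_gauss_Mp_cube[OF r_pos, where 'a='a] by metis
  have "(\<integral>x. gauss a x \<partial>\<xi>) \<le> C" if "\<xi> \<in> Mp_cube r" "a \<ge> 1" for \<xi> :: "'a measure" and a
  proof -
    have "ennreal (\<integral>x. gauss a x \<partial>\<xi>) = (\<integral>\<^sup>+x. gauss a x \<partial>\<xi>)"
      using that by (intro nn_integral_eq_integral[symmetric] integrable_gauss_Mp_cube[OF _ r_pos]) (auto simp: gauss_nonneg)
    then have "ennreal (\<integral>x. gauss a x \<partial>\<xi>) \<le> ennreal C" using C(2)[OF that] by simp
    then show ?thesis using C(1) by (simp add: ennreal_le_iff)
  qed
  then show thesis using C(1) that by blast
qed

lemma norm_S_le:
  assumes "\<xi> \<in> X" "a \<ge> 1"
  shows "cmod (S a \<xi>) \<le> (\<integral>x. gauss a x \<partial>\<xi>)"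
proof -
  have "cmod (S a \<xi>) \<le> (\<integral>x. cmod (wave k x * of_real (gauss a x)) \<partial>\<xi>)"
    unfolding gauss_wave_sum_def by (rule integral_norm_bound)
  also have "\<dots> = (\<integral>x. gauss a x \<partial>\<xi>)"
    using assms by (simp add: norm_mult gauss_nonneg abs_of_nonneg)
  finally show ?thesis .
qed

lemma measurable_S [measurable]:
  assumes "a \<ge> 1"
  shows "S a \<in> borel_measurable N"
  unfolding gauss_wave_sum_def
  by (rule measurable_kernel_integral_complex[OF measurable_ident_N _ r_pos])
    (use assms in \<open>auto simp: X_in_cube intro: integrable_wave_gauss[OF _ r_pos]\<close>)

lemma integrable_bounded_N:
  fixes f :: "'a measure \<Rightarrow> 'b::{banach, second_countable_topology}"
  assumes "f \<in> borel_measurable N" "\<And>\<xi>. \<xi> \<in> X \<Longrightarrow> norm (f \<xi>) \<le> C"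
  shows "integrable N f"
  using assms by (intro N.integrable_const_bound[where B=C]) auto

definition cross :: "real \<Rightarrow> real \<Rightarrow> 'a measure \<Rightarrow> real" where
  "cross a c \<xi> = Re (S a \<xi> * cnj (S c \<xi>))"

text \<open>
  The factor \<open>1 + cos\<close> instead of \<open>cos\<close> keeps the integrands nonnegative, as \<open>campbell\<close>
  requires; the extra term is subtracted afterwards.
\<close>

lemma cross_double_integral:
  assumes \<xi>: "\<xi> \<in> X" and a: "a \<ge> 1" and c: "c \<ge> 1"
  shows "(\<integral>\<^sup>+x. \<integral>\<^sup>+y. ennreal ((1 + cos (2 * pi * (k \<bullet> (y - x)))) * (gauss a x * gauss c y)) \<partial>\<xi> \<partial>\<xi>)
       = ennreal ((\<integral>x. gauss a x \<partial>\<xi>) * (\<integral>x. gauss c x \<partial>\<xi>) + cross a c \<xi>)"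
    and "(\<integral>\<^sup>+x. \<integral>\<^sup>+y. ennreal (gauss a x * gauss c y) \<partial>\<xi> \<partial>\<xi>)
       = ennreal ((\<integral>x. gauss a x \<partial>\<xi>) * (\<integral>x. gauss c x \<partial>\<xi>))"
proof -
  have [measurable_cong]: "sets \<xi> = sets borel" using \<xi> by (intro Mp_sets X_in_Mp)
  note cube = X_in_cube[OF \<xi>]
  let ?\<theta> = "\<lambda>x. 2 * pi * (k \<bullet> x)"
  let ?w = "\<lambda>x y. (1 + cos (2 * pi * (k \<bullet> (y - x)))) * (gauss a x * gauss c y)"
  let ?R = "\<lambda>x. gauss a x * (\<integral>y. gauss c y \<partial>\<xi>) + (cos (?\<theta> x) * gauss a x) * Re (S c \<xi>) + (sin (?\<theta> x) * gauss a x) * Im (S c \<xi>)"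
  have g0: "gauss a x \<ge> 0" "gauss c x \<ge> 0" for x :: 'a using a c gauss_pos[of a x] gauss_pos[of c x] by auto
  have ig: "integrable \<xi> (gauss a)" "integrable \<xi> (gauss c)"
    using a c by (auto intro!: integrable_gauss_Mp_cube[OF cube r_pos])
  have icos: "integrable \<xi> (\<lambda>x. cos (?\<theta> x) * gauss b x)" and isin: "integrable \<xi> (\<lambda>x. sin (?\<theta> x) * gauss b x)"
    and ReS: "Re (S b \<xi>) = (\<integral>x. cos (?\<theta> x) * gauss b x \<partial>\<xi>)" and ImS: "Im (S b \<xi>) = (\<integral>x. sin (?\<theta> x) * gauss b x \<partial>\<xi>)"
    if "b \<ge> 1" for b
  proof -
    have i: "integrable \<xi> (\<lambda>x. wave k x * of_real (gauss b x))" by (rule integrable_wave_gauss[OF cube r_pos that])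
    show "integrable \<xi> (\<lambda>x. cos (?\<theta> x) * gauss b x)" using integrable_Re[OF i] by (simp add: wave_def)
    show "integrable \<xi> (\<lambda>x. sin (?\<theta> x) * gauss b x)" using integrable_Im[OF i] by (simp add: wave_def)
    show "Re (S b \<xi>) = (\<integral>x. cos (?\<theta> x) * gauss b x \<partial>\<xi>)"
      unfolding gauss_wave_sum_def integral_Re[OF i, symmetric] by (simp add: wave_def)
    show "Im (S b \<xi>) = (\<integral>x. sin (?\<theta> x) * gauss b x \<partial>\<xi>)"
      unfolding gauss_wave_sum_def integral_Im[OF i, symmetric] by (simp add: wave_def)
  qed
  have inner: "(\<integral>\<^sup>+y. ennreal (?w x y) \<partial>\<xi>)
     = ennreal (?R x)" for x
  proof -
    \<comment> \<open>The addition theorem splits the cosine of a difference into products of a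
      function of x and a function of y. Integrating then produces products of real and imaginary
      parts of the two sums.\<close>
    have eq: "?w x y
        = gauss a x * gauss c y + (cos (?\<theta> x) * gauss a x) * (cos (?\<theta> y) * gauss c y) + (sin (?\<theta> x) * gauss a x) * (sin (?\<theta> y) * gauss c y)" for y
      by (simp add: inner_diff_right right_diff_distrib cos_diff algebra_simps)
    have nn: "0 \<le> ?w x y" for y
      using cos_ge_minus_one[of "2 * pi * (k \<bullet> (y - x))"] g0 by (intro mult_nonneg_nonneg) (linarith | simp)+
    have "(\<integral>\<^sup>+y. ennreal (?w x y) \<partial>\<xi>)
       = ennreal (\<integral>y. ?w x y \<partial>\<xi>)"
      by (rule nn_integral_eq_integral) (use nn ig icos[OF c] isin[OF c] in \<open>auto simp: eq\<close>)
    also have "(\<integral>y. ?w x y \<partial>\<xi>)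
        = ?R x"
      unfolding eq ReS[OF c] ImS[OF c] using ig icos[OF c] isin[OF c] by simp
    finally show ?thesis .
  qed
  have nn: "0 \<le> ?R x" for x
  proof -
    have "\<bar>Re (wave k x * cnj (S c \<xi>))\<bar> \<le> cmod (S c \<xi>)"
      using abs_Re_le_cmod[of "wave k x * cnj (S c \<xi>)"] by (simp add: norm_mult)
    also have "\<dots> \<le> (\<integral>y. gauss c y \<partial>\<xi>)" by (rule norm_S_le[OF \<xi> c])
    finally have "0 \<le> (\<integral>y. gauss c y \<partial>\<xi>) + (cos (?\<theta> x) * Re (S c \<xi>) + sin (?\<theta> x) * Im (S c \<xi>))"
      by (simp add: wave_def abs_le_iff)
    then have "0 \<le> gauss a x * ((\<integral>y. gauss c y \<partial>\<xi>) + (cos (?\<theta> x) * Re (S c \<xi>) + sin (?\<theta> x) * Im (S c \<xi>)))"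
      using g0 by (intro mult_nonneg_nonneg)
    then show ?thesis by (simp add: algebra_simps)
  qed
  have "(\<integral>\<^sup>+x. \<integral>\<^sup>+y. ennreal (?w x y) \<partial>\<xi> \<partial>\<xi>)
     = ennreal (\<integral>x. ?R x \<partial>\<xi>)"
    unfolding inner by (rule nn_integral_eq_integral) (use nn ig icos[OF a] isin[OF a] in auto)
  also have "(\<integral>x. ?R x \<partial>\<xi>)
     = (\<integral>x. gauss a x \<partial>\<xi>) * (\<integral>y. gauss c y \<partial>\<xi>) + Re (S a \<xi>) * Re (S c \<xi>) + Im (S a \<xi>) * Im (S c \<xi>)"
    unfolding ReS[OF a] ImS[OF a] using ig icos[OF a] isin[OF a] by simp
  finally show "(\<integral>\<^sup>+x. \<integral>\<^sup>+y. ennreal (?w x y) \<partial>\<xi> \<partial>\<xi>)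
       = ennreal ((\<integral>x. gauss a x \<partial>\<xi>) * (\<integral>x. gauss c x \<partial>\<xi>) + cross a c \<xi>)"
    by (simp add: cross_def add.assoc)
  have "(\<integral>\<^sup>+y. ennreal (gauss a x * gauss c y) \<partial>\<xi>) = ennreal (gauss a x * (\<integral>y. gauss c y \<partial>\<xi>))" for x :: 'a
    by (subst nn_integral_eq_integral) (use g0 ig in \<open>auto intro!: AE_I2 mult_nonneg_nonneg\<close>)
  then have "(\<integral>\<^sup>+x. \<integral>\<^sup>+y. ennreal (gauss a x * gauss c y) \<partial>\<xi> \<partial>\<xi>) = (\<integral>\<^sup>+x. ennreal (gauss a x * (\<integral>y. gauss c y \<partial>\<xi>)) \<partial>\<xi>)"
    by simp
  also have "\<dots> = ennreal ((\<integral>x. gauss a x \<partial>\<xi>) * (\<integral>x. gauss c x \<partial>\<xi>))"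
    by (subst nn_integral_eq_integral) (use g0 ig in \<open>auto intro!: mult_nonneg_nonneg integral_nonneg_AE AE_I2\<close>)
  finally show "(\<integral>\<^sup>+x. \<integral>\<^sup>+y. ennreal (gauss a x * gauss c y) \<partial>\<xi> \<partial>\<xi>)
       = ennreal ((\<integral>x. gauss a x \<partial>\<xi>) * (\<integral>x. gauss c x \<partial>\<xi>))" .
qed

text \<open>In Campbell's formula gauss a z * gauss c (z + s) integrates over z to gauss (a + c) s,
  which is why only a + c survives. The formula is used with weight 1 + cos and with weight 1; the
  results may be subtracted because the uniform Gaussian bound makes the expectations finite and
  \<open>has_fourier_transform\<close> makes the integrals over \<open>\<gamma>\<close>
  finite.\<close>

lemma expectation_cross:
  assumes a: "a \<ge> 1" and c: "c \<ge> 1"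
  shows "integrable N (cross a c)" "(\<integral>\<xi>. cross a c \<xi> \<partial>N) = J (a + c)"
proof -
  obtain C where C0: "C > 0" and C1: "\<forall>\<xi>::'a measure. \<forall>a. \<xi> \<in> Mp_cube r \<longrightarrow> a \<ge> 1 \<longrightarrow> (\<integral>x. gauss a x \<partial>\<xi>) \<le> C"
    by (rule integral_gauss_bound)
  note C = C0 C1[rule_format]
  define m where "m a \<xi> = (\<integral>x. gauss a x \<partial>\<xi>)" for a and \<xi> :: "'a measure"
  have m: "0 \<le> m q \<xi>" "m q \<xi> \<le> C" "cmod (S q \<xi>) \<le> m q \<xi>" if "\<xi> \<in> X" "q \<ge> 1" for q \<xi>
    using C(2)[OF X_in_cube[OF that(1)] that(2)] norm_S_le[OF that] that
    unfolding m_def by (auto intro!: integral_nonneg_AE simp: gauss_nonneg)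
  have m_meas: "m q \<in> borel_measurable N" if "q \<ge> 1" for q
    unfolding m_def
    by (rule measurable_kernel_integral_real[OF measurable_ident_N _ r_pos])
      (use that in \<open>auto simp: X_in_cube intro: integrable_gauss_Mp_cube[OF _ r_pos]\<close>)
  have cross_le: "\<bar>cross a c \<xi>\<bar> \<le> m a \<xi> * m c \<xi>" if "\<xi> \<in> X" for \<xi>
  proof -
    have "\<bar>cross a c \<xi>\<bar> \<le> cmod (S a \<xi>) * cmod (S c \<xi>)"
      unfolding cross_def using abs_Re_le_cmod[of "S a \<xi> * cnj (S c \<xi>)"] by (simp add: norm_mult)
    also have "\<dots> \<le> m a \<xi> * m c \<xi>" using m(1,3)[OF that] a c by (intro mult_mono) auto
    finally show ?thesis .
  qed
  have nnc: "0 \<le> m a \<xi> * m c \<xi> + cross a c \<xi>" if "\<xi> \<in> X" for \<xi>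
    using cross_le[OF that] by linarith
  have mm: "m a \<xi> * m c \<xi> \<le> C * C" if "\<xi> \<in> X" for \<xi>
    using m(1,2)[OF that] a c C(1) by (intro mult_mono) auto
  have im: "integrable N (\<lambda>\<xi>. m a \<xi> * m c \<xi>)"
    using m_meas a c mm m(1) by (intro integrable_bounded_N[where C="C * C"]) auto
  have cross_meas: "cross a c \<in> borel_measurable N"
  proof -
    note [measurable] = measurable_S[OF a] measurable_S[OF c]
    have "cross a c = (\<lambda>\<xi>. Re (S a \<xi>) * Re (S c \<xi>) + Im (S a \<xi>) * Im (S c \<xi>))"
      by (auto simp: cross_def)
    then show ?thesis by simp
  qed
  show ic: "integrable N (cross a c)"
  proof (rule integrable_bounded_N[OF cross_meas])
    show "norm (cross a c \<xi>) \<le> C * C" if "\<xi> \<in> X" for \<xi>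
      using order_trans[OF cross_le[OF that] mm[OF that]] by simp
  qed
  define \<Phi> where "\<Phi> s = (1 + cos (2 * pi * (k \<bullet> s)))" for s
  have \<Phi>: "0 \<le> \<Phi> s" "\<Phi> s \<le> 2" for s
    using cos_ge_minus_one[of "2 * pi * (k \<bullet> s)"] cos_le_one[of "2 * pi * (k \<bullet> s)"] unfolding \<Phi>_def by linarith+
  have \<Phi>_meas [measurable]: "\<Phi> \<in> borel_measurable borel" unfolding \<Phi>_def by measurable
  have ac: "a > 0" "c > 0" "a + c > 0" using a c by auto
  have ig: "integrable \<gamma> (gauss (a + c))"
    by (rule has_fourier_transform_gauss(1)[OF ft sets_\<gamma> ac(3)])
  have g0: "gauss (a + c) s > 0" for s :: 'a by (rule gauss_pos[OF ac(3)])
  have conv: "(\<integral>\<^sup>+z. ennreal (w * (gauss a z * gauss c (z + s))) \<partial>lborel) = ennreal (w * gauss (a + c) s)" if "w \<ge> 0" for w and s :: 'a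
  proof -
    have "(\<integral>\<^sup>+z. ennreal (w * (gauss a z * gauss c (z + s))) \<partial>lborel) = (\<integral>\<^sup>+z. ennreal w * ennreal (gauss a z * gauss c (z + s)) \<partial>lborel)"
      using that by (simp add: ennreal_mult')
    also have "\<dots> = ennreal w * ennreal (gauss (a + c) s)"
      by (subst nn_integral_cmult) (auto simp: nn_integral_gauss_mult_gauss[OF ac(1,2)])
    finally show ?thesis using that by (simp add: ennreal_mult')
  qed
  have "ennreal (\<integral>\<xi>. m a \<xi> * m c \<xi> + cross a c \<xi> \<partial>N) = (\<integral>\<^sup>+\<xi>. ennreal (m a \<xi> * m c \<xi> + cross a c \<xi>) \<partial>N)"
    using im ic nnc by (intro nn_integral_eq_integral[symmetric]) (auto intro!: AE_I2)
  \<comment> \<open>Writing y as x + (y - x) brings the integrand into the form F x (y - x) required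
    by \<open>campbell\<close>.\<close>
  also have "\<dots> = (\<integral>\<^sup>+\<xi>. \<integral>\<^sup>+x. \<integral>\<^sup>+y. ennreal (\<Phi> (y - x) * (gauss a x * gauss c (x + (y - x)))) \<partial>\<xi> \<partial>\<xi> \<partial>N)"
    by (intro nn_integral_cong) (simp add: cross_double_integral(1)[OF _ a c] m_def \<Phi>_def)
  also have "\<dots> = (\<integral>\<^sup>+s. \<integral>\<^sup>+z. ennreal (\<Phi> s * (gauss a z * gauss c (z + s))) \<partial>lborel \<partial>\<gamma>)"
    by (rule campbell) measurable
  also have "\<dots> = (\<integral>\<^sup>+s. ennreal (\<Phi> s * gauss (a + c) s) \<partial>\<gamma>)"
    by (simp only: conv[OF \<Phi>(1)])
  also have "\<dots> = ennreal (\<integral>s. \<Phi> s * gauss (a + c) s \<partial>\<gamma>)"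
  proof (rule nn_integral_eq_integral)
    show "integrable \<gamma> (\<lambda>s. \<Phi> s * gauss (a + c) s)"
      by (rule Bochner_Integration.integrable_bound[OF integrable_mult_right[OF ig, of 2]])
        (use \<Phi> g0 in \<open>auto simp: abs_mult intro!: mult_right_mono\<close>)
  qed (use \<Phi> in \<open>auto intro!: AE_I2 mult_nonneg_nonneg less_imp_le[OF g0]\<close>)
  finally have e1: "(\<integral>\<xi>. m a \<xi> * m c \<xi> + cross a c \<xi> \<partial>N) = (\<integral>s. \<Phi> s * gauss (a + c) s \<partial>\<gamma>)"
    using nnc \<Phi> by (subst (asm) ennreal_inj)
      (auto intro!: integral_nonneg_AE AE_I2 mult_nonneg_nonneg less_imp_le[OF g0])
  have "ennreal (\<integral>\<xi>. m a \<xi> * m c \<xi> \<partial>N) = (\<integral>\<^sup>+\<xi>. ennreal (m a \<xi> * m c \<xi>) \<partial>N)"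
    using im m(1) a c by (intro nn_integral_eq_integral[symmetric]) (auto intro!: AE_I2 mult_nonneg_nonneg)
  also have "\<dots> = (\<integral>\<^sup>+\<xi>. \<integral>\<^sup>+x. \<integral>\<^sup>+y. ennreal (1 * (gauss a x * gauss c (x + (y - x)))) \<partial>\<xi> \<partial>\<xi> \<partial>N)"
    by (intro nn_integral_cong) (simp add: cross_double_integral(2)[OF _ a c] m_def)
  also have "\<dots> = (\<integral>\<^sup>+s. \<integral>\<^sup>+z. ennreal (1 * (gauss a z * gauss c (z + s))) \<partial>lborel \<partial>\<gamma>)"
    by (rule campbell) measurable
  also have "\<dots> = (\<integral>\<^sup>+s. ennreal (1 * gauss (a + c) s) \<partial>\<gamma>)"
    by (simp only: conv[OF zero_le_one])
  also have "\<dots> = ennreal (\<integral>s. gauss (a + c) s \<partial>\<gamma>)"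
    using nn_integral_eq_integral[OF ig] g0 by (simp add: less_imp_le)
  finally have e2: "(\<integral>\<xi>. m a \<xi> * m c \<xi> \<partial>N) = (\<integral>s. gauss (a + c) s \<partial>\<gamma>)"
    using m(1) a c g0 by (subst (asm) ennreal_inj)
      (auto intro!: integral_nonneg_AE AE_I2 mult_nonneg_nonneg less_imp_le[OF g0])
  have icos: "integrable \<gamma> (\<lambda>s. cos (2 * pi * (k \<bullet> s)) * gauss (a + c) s)"
    by (rule Bochner_Integration.integrable_bound[OF ig])
      (use g0 in \<open>auto simp: abs_mult less_imp_le intro!: mult_left_le_one_le\<close>)
  have "(\<integral>s. \<Phi> s * gauss (a + c) s \<partial>\<gamma>) = (\<integral>s. gauss (a + c) s \<partial>\<gamma>) + J (a + c)"
    unfolding J_def \<Phi>_def distrib_right using ig icos by simp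
  then show "(\<integral>\<xi>. cross a c \<xi> \<partial>N) = J (a + c)"
    using e1 e2 im ic by simp
qed

lemma J_tendsto: "(J \<longlongrightarrow> measure \<nu> {k}) at_top"
proof -
  have lim: "((\<lambda>q. \<integral>x. exp (- pi * q * (norm (x - k))\<^sup>2) \<partial>\<nu>) \<longlongrightarrow> measure \<nu> {k}) at_top"
    using ft by (intro tendsto_integral_gaussian has_fourier_transform_gauss(3)[OF ft sets_\<gamma>])
      (auto simp: has_fourier_transform_def)
  have eq: "eventually (\<lambda>q. J q = (\<integral>x. exp (- pi * q * (norm (x - k))\<^sup>2) \<partial>\<nu>)) at_top"
    using eventually_gt_at_top[of 0]
  proof eventually_elim
    case (elim q)
    then show ?case unfolding J_def by (intro has_fourier_transform_gauss(2)[OF ft sets_\<gamma>])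
  qed
  show ?thesis unfolding tendsto_cong[OF eq] by (rule lim)
qed

text \<open>The pointwise cancellation estimate is integrated over the process. In each double sum
  the Gaussian weight has Lebesgue integral 1, so Campbell's formula leaves just the mass of
  \<open>\<gamma>\<close> at the prescribed difference, and the bound is independent of a.\<close>

lemma expectation_translate_diff:
  assumes a: "a \<ge> 1"
  shows "(\<integral>\<xi>. cmod (S a (translate t \<xi>) - S a \<xi>) \<partial>N) \<le> 2 * (measure \<gamma> {0} - measure \<gamma> {t})"
proof -
  let ?D = "\<lambda>\<xi>. cmod (S a (translate t \<xi>) - S a \<xi>)"
  let ?G = "\<lambda>u s \<xi>. \<integral>\<^sup>+x. \<integral>\<^sup>+y. ennreal (gauss a (u + x)) * indicator {s} (y - x) \<partial>\<xi> \<partial>\<xi>"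
  have a0: "a > 0" using a by simp
  have lin: "(\<integral>\<^sup>+\<xi>. ?G u s \<xi> \<partial>N) = emeasure \<gamma> {s}" for u s :: 'a
  proof -
    have "(\<integral>\<^sup>+\<xi>. ?G u s \<xi> \<partial>N)
        = (\<integral>\<^sup>+s'. \<integral>\<^sup>+z. ennreal (gauss a (u + z)) * indicator {s} s' \<partial>lborel \<partial>\<gamma>)"
      by (rule campbell) measurable
    also have "\<dots> = (\<integral>\<^sup>+s'. indicator {s} s' \<partial>\<gamma>)"
    proof (intro nn_integral_cong)
      fix s'
      have "(\<integral>\<^sup>+z. ennreal (gauss a (u + z)) \<partial>lborel) = (\<integral>\<^sup>+z. ennreal (gauss a z) \<partial>(lborel :: 'a measure))"
        by (rule lborel_nn_integral_shift) measurable
      then show "(\<integral>\<^sup>+z. ennreal (gauss a (u + z)) * indicator {s} s' \<partial>lborel) = indicator {s} s'"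
        by (subst nn_integral_multc) (auto simp: nn_integral_gauss[OF a0])
    qed
    also have "\<dots> = emeasure \<gamma> {s}" by (rule nn_integral_indicator) simp
    finally show ?thesis .
  qed
  have meas: "(\<lambda>\<xi>. ?G u s \<xi>) \<in> borel_measurable N" for u s :: 'a
    by (rule measurable_pair_integral) (unfold split_beta', measurable)
  obtain C where C0: "C > 0" and C1: "\<forall>\<xi>::'a measure. \<forall>a. \<xi> \<in> Mp_cube r \<longrightarrow> a \<ge> 1 \<longrightarrow> (\<integral>x. gauss a x \<partial>\<xi>) \<le> C"
    by (rule integral_gauss_bound)
  note C = C0 C1[rule_format]
  \<comment> \<open>Finiteness is required to pass from \<open>emeasure\<close> to
    \<open>measure\<close>, which is 0 on sets of infinite mass. For each point x at most one point
    lies at s + x, so the double sum is dominated by a single Gaussian sum.\<close>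
  have fin: "emeasure \<gamma> {s} < \<infinity>" for s
  proof -
    have "emeasure \<gamma> {s} = (\<integral>\<^sup>+\<xi>. ?G 0 s \<xi> \<partial>N)"
      by (rule lin[symmetric])
    also have "\<dots> \<le> (\<integral>\<^sup>+\<xi>. ennreal C \<partial>N)"
    proof (rule nn_integral_mono)
      fix \<xi> assume "\<xi> \<in> space N"
      then have \<xi>: "\<xi> \<in> Mp_cube r" by (simp add: X_in_cube)
      have [measurable_cong]: "sets \<xi> = sets borel" using \<xi> by (intro Mp_sets Mp_cubeD)
      have "?G 0 s \<xi> \<le> (\<integral>\<^sup>+x. ennreal (gauss a x) \<partial>\<xi>)"
      proof (rule nn_integral_mono)
        fix x
        have "(\<integral>\<^sup>+y. ennreal (gauss a (0 + x)) * indicator {s} (y - x) \<partial>\<xi>) = ennreal (gauss a x) * (\<integral>\<^sup>+y. indicator {s} (y - x) \<partial>\<xi>)"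
          unfolding add_0 by (rule nn_integral_cmult) measurable
        also have "\<dots> = ennreal (gauss a x) * indicator (points \<xi>) (s + x)"
          by (simp only: emeasure_points_vimage[OF \<xi> r_pos])
        also have "\<dots> \<le> ennreal (gauss a x)" by (simp add: indicator_def)
        finally show "(\<integral>\<^sup>+y. ennreal (gauss a (0 + x)) * indicator {s} (y - x) \<partial>\<xi>) \<le> ennreal (gauss a x)" .
      qed
      also have "\<dots> = ennreal (\<integral>x. gauss a x \<partial>\<xi>)"
        using a0 by (intro nn_integral_eq_integral integrable_gauss_Mp_cube[OF \<xi> r_pos a]) (simp add: gauss_nonneg)
      also have "\<dots> \<le> ennreal C" by (intro ennreal_leI C(2) \<xi> a)
      finally show "?G 0 s \<xi> \<le> ennreal C" .
    qed
    also have "\<dots> = ennreal C" using N.emeasure_space_1 by simp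
    finally show ?thesis by (simp add: le_less_trans)
  qed
  have meas_T: "(\<lambda>\<xi>. S a (translate t \<xi>)) \<in> borel_measurable N"
    by (rule measurable_compose[OF _ measurable_S[OF a]]) (rule measurable_translate_N, auto)
  have measD: "(\<lambda>\<xi>. ?D \<xi>) \<in> borel_measurable N"
    using meas_T measurable_S[OF a] by measurable
  have bd: "cmod (S a \<xi>) \<le> C" if "\<xi> \<in> X" for \<xi>
    using norm_S_le[OF that a] C(2)[OF X_in_cube[OF that] a] by simp
  have int: "integrable N (\<lambda>\<xi>. ?D \<xi>)"
  proof (rule integrable_bounded_N[OF measD, where C="C + C"])
    show "norm (?D \<xi>) \<le> C + C" if "\<xi> \<in> X" for \<xi>
      using norm_triangle_ineq4[of "S a (translate t \<xi>)" "S a \<xi>"] bd[OF that] bd[OF translate_in_X[OF that, of t]] by simp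
  qed
  let ?E = "\<integral>\<xi>. ?D \<xi> \<partial>N"
  have "ennreal ?E + 2 * emeasure \<gamma> {t}
     = (\<integral>\<^sup>+\<xi>. ennreal (?D \<xi>) + 2 * ?G t t \<xi> \<partial>N)"
    using int meas measD
    by (subst nn_integral_add) (auto simp: nn_integral_cmult lin nn_integral_eq_integral)
  also have "\<dots> \<le> (\<integral>\<^sup>+\<xi>. ?G t 0 \<xi>
       + ?G 0 0 \<xi> \<partial>N)"
    by (rule nn_integral_mono) (use gauss_wave_sum_translate_diff[OF X_in_cube r_pos a] in simp)
  also have "\<dots> = emeasure \<gamma> {0} + emeasure \<gamma> {0}"
    using meas by (subst nn_integral_add) (simp_all only: lin)
  finally have "ennreal ?E + 2 * ennreal (measure \<gamma> {t}) \<le> ennreal (measure \<gamma> {0}) + ennreal (measure \<gamma> {0})"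
    unfolding emeasure_eq_ennreal_measure[OF fin[THEN less_imp_neq, unfolded infinity_ennreal_def]] .
  moreover have "ennreal (?E + 2 * measure \<gamma> {t}) = ennreal ?E + 2 * ennreal (measure \<gamma> {t})"
    by (subst ennreal_plus) (simp_all add: ennreal_mult')
  moreover have "ennreal (measure \<gamma> {0} + measure \<gamma> {0}) = ennreal (measure \<gamma> {0}) + ennreal (measure \<gamma> {0})"
    by (rule ennreal_plus) simp_all
  ultimately have "ennreal (?E + 2 * measure \<gamma> {t}) \<le> ennreal (measure \<gamma> {0} + measure \<gamma> {0})"
    by (simp only:)
  then have "?E + 2 * measure \<gamma> {t} \<le> measure \<gamma> {0} + measure \<gamma> {0}" by (subst (asm) ennreal_le_iff) auto
  then show ?thesis by simp
qed

end

section \<open>Ergodicity and the inequality\<close>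

text \<open>For c above the expectation, Y > c cannot hold almost surely and therefore has
  probability 0. Hence Y is almost surely at most its expectation, and the nonnegative difference
  has expectation 0. Upper level sets alone suffice.\<close>

lemma (in prob_space) AE_eq_expectation_if_trivial:
  fixes Y :: "'a \<Rightarrow> real"
  assumes Y: "integrable M Y" and triv: "\<And>c. prob {\<omega> \<in> space M. c < Y \<omega>} = 0 \<or> prob {\<omega> \<in> space M. c < Y \<omega>} = 1"
  shows "AE \<omega> in M. Y \<omega> = expectation Y"
proof -
  have [measurable]: "Y \<in> borel_measurable M" using Y by simp
  have le: "AE \<omega> in M. Y \<omega> \<le> c" if c: "c > expectation Y" for c
  proof -
    have "prob {\<omega> \<in> space M. c < Y \<omega>} \<noteq> 1"
    proof
      assume "prob {\<omega> \<in> space M. c < Y \<omega>} = 1"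
      then have "AE \<omega> in M. c < Y \<omega>" by (subst (asm) prob_Collect_eq_1) auto
      then have "c \<le> expectation Y" by (intro integral_ge_const Y) (auto elim: eventually_mono)
      with c show False by simp
    qed
    then have "prob {\<omega> \<in> space M. c < Y \<omega>} = 0" using triv[of c] by auto
    then have "AE \<omega> in M. \<not> c < Y \<omega>" by (subst (asm) prob_Collect_eq_0) auto
    then show ?thesis by (auto elim: eventually_mono)
  qed
  have "AE \<omega> in M. \<forall>n. Y \<omega> \<le> expectation Y + 1 / real (Suc n)"
    unfolding AE_all_countable by (intro allI le) simp
  then have ub: "AE \<omega> in M. Y \<omega> \<le> expectation Y"
  proof eventually_elim
    case (elim \<omega>)
    show ?case
    proof (rule field_le_epsilon)
      fix e :: real assume "e > 0"
      then obtain n where "1 / real (Suc n) < e" using nat_approx_posE by auto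
      then show "Y \<omega> \<le> expectation Y + e" using elim by (meson add_left_mono less_imp_le order_trans)
    qed
  qed
  have "expectation (\<lambda>\<omega>. expectation Y - Y \<omega>) = 0" using Y by (simp add: prob_space)
  moreover have "AE \<omega> in M. 0 \<le> expectation Y - Y \<omega>" using ub by (auto elim: eventually_mono)
  ultimately have "AE \<omega> in M. expectation Y - Y \<omega> = 0"
    using Y by (subst (asm) integral_nonneg_eq_0_iff_AE) auto
  then show ?thesis by (auto elim: eventually_mono)
qed

context palm_fourier
begin

text \<open>Expanding the squared modulus gives \<open>cross\<close> terms, whose expectations are
  values of \<open>J\<close>; nonnegativity of the variance passes from the second moment to the
  first.\<close>

lemma expectation_norm_diff_le:
  assumes a: "a \<ge> 1" and c: "c \<ge> 1"
  shows "integrable N (\<lambda>\<xi>. cmod (S a \<xi> - S c \<xi>))"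
    and "(\<integral>\<xi>. cmod (S a \<xi> - S c \<xi>) \<partial>N)\<^sup>2 \<le> J (a + a) + J (c + c) - 2 * J (a + c)"
proof -
  let ?Y = "\<lambda>\<xi>. cmod (S a \<xi> - S c \<xi>)"
  note [measurable] = measurable_S[OF a] measurable_S[OF c]
  have Y_meas: "?Y \<in> borel_measurable N" by measurable
  have sq: "(?Y \<xi>)\<^sup>2 = cross a a \<xi> + cross c c \<xi> - 2 * cross a c \<xi>" for \<xi>
    unfolding cross_def cmod_power2 by (simp add: power2_eq_square algebra_simps)
  have i2: "integrable N (\<lambda>\<xi>. (?Y \<xi>)\<^sup>2)"
    unfolding sq by (intro Bochner_Integration.integrable_diff Bochner_Integration.integrable_add integrable_mult_right expectation_cross(1) a c)
  show i1: "integrable N ?Y" by (rule N.square_integrable_imp_integrable[OF Y_meas i2])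
  have "(\<integral>\<xi>. ?Y \<xi> \<partial>N)\<^sup>2 \<le> (\<integral>\<xi>. (?Y \<xi>)\<^sup>2 \<partial>N)"
    using N.variance_positive[of ?Y] N.variance_eq[OF i1 i2] by linarith
  also have "\<dots> = J (a + a) + J (c + c) - 2 * J (a + c)"
    unfolding sq by (simp add: expectation_cross a c)
  finally show "(\<integral>\<xi>. ?Y \<xi> \<partial>N)\<^sup>2 \<le> J (a + a) + J (c + c) - 2 * J (a + c)" .
qed

text \<open>The parameter n + 1 is at least 1 for every n, as the uniform Gaussian bounds
  require.\<close>

definition amp :: "nat \<Rightarrow> 'a measure \<Rightarrow> real" where
  "amp n \<xi> = cmod (S (real n + 1) \<xi>)"

lemma amp_measurable [measurable]: "amp n \<in> borel_measurable N"
  unfolding amp_def using measurable_S[of "real n + 1"] by measurable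

lemma amp_bound:
  obtains C where "C > 0" "\<forall>n \<xi>. \<xi> \<in> X \<longrightarrow> \<bar>amp n \<xi>\<bar> \<le> C"
    "\<forall>n t \<xi>. \<xi> \<in> X \<longrightarrow> cmod (S (real n + 1) (translate t \<xi>) - wave k t * S (real n + 1) \<xi>)
        \<le> sqrt (pi / (2 * (real n + 1))) * (norm t * C)"
proof -
  obtain C where C0: "C > 0" and C1: "\<forall>\<xi>::'a measure. \<forall>a. \<xi> \<in> Mp_cube r \<longrightarrow> a \<ge> 1 \<longrightarrow> (\<integral>x. gauss a x \<partial>\<xi>) \<le> C"
    by (rule integral_gauss_bound)
  \<comment> \<open>The constant of the translation error; it is also at least C, so a single
    constant serves both bounds.\<close>
  let ?C = "sqrt 2 ^ DIM('a) * (2 * C)"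
  have C: "C \<le> ?C"
  proof -
    have "1 * C \<le> sqrt 2 ^ DIM('a) * C" using C0 by (intro mult_right_mono one_le_power) auto
    moreover have "?C = 2 * (sqrt 2 ^ DIM('a) * C)" by simp
    ultimately show ?thesis using C0 by linarith
  qed
  have "\<bar>amp n \<xi>\<bar> \<le> ?C" if "\<xi> \<in> X" for n \<xi>
    using norm_S_le[OF that, of "real n + 1"] C1[rule_format, OF X_in_cube[OF that], of "real n + 1"] C
    by (simp add: amp_def)
  moreover have "cmod (S (real n + 1) (translate t \<xi>) - wave k t * S (real n + 1) \<xi>)
        \<le> sqrt (pi / (2 * (real n + 1))) * (norm t * ?C)" if "\<xi> \<in> X" for n t \<xi>
    using gauss_wave_sum_translate_error[OF X_in_cube[OF that] r_pos _ C1[rule_format], of "real n + 1" k t]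
    by (simp add: mult.assoc)
  ultimately show thesis using C0 C by (intro that[of ?C]) auto
qed

lemma shift_error_tendsto: "(\<lambda>n. sqrt (pi / (2 * (real n + 1))) * K) \<longlonglongrightarrow> 0"
proof -
  have "(\<lambda>n. sqrt (pi / 2 * inverse (real (Suc n))) * K) \<longlonglongrightarrow> sqrt (pi / 2 * 0) * K"
    by (intro tendsto_intros LIMSEQ_inverse_real_of_nat)
  moreover have eq: "pi / 2 * inverse (real (Suc n)) = pi / (2 * (real n + 1))" for n
    by (simp add: field_simps)
  ultimately show ?thesis unfolding eq by simp
qed

text \<open>The reverse triangle inequality transfers the L^1 Cauchy property from the sums to their
  moduli, and an L^1 Cauchy sequence has an almost everywhere Cauchy subsequence.\<close>

lemma amp_subsequence:
  obtains \<rho> :: "nat \<Rightarrow> nat" where "strict_mono \<rho>" "AE \<xi> in N. Cauchy (\<lambda>i. amp (\<rho> i) \<xi>)"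
proof -
  have int: "integrable N (amp n)" for n
  proof -
    obtain C where "\<forall>n \<xi>. \<xi> \<in> X \<longrightarrow> \<bar>amp n \<xi>\<bar> \<le> C" by (rule amp_bound)
    then show ?thesis by (intro integrable_bounded_N[where C=C]) auto
  qed
  show thesis
  proof (rule cauchy_L1_AE_cauchy_subseq[OF int _ that])
    fix e :: real assume e: "e > 0"
    let ?L = "measure \<nu> {k}"
    \<comment> \<open>The combination J + J - 2 * J to be estimated has coefficients of total
      modulus 4 that cancel at the common limit, so an error below e^2 / 4 in each value keeps it
      below e^2.\<close>
    have "eventually (\<lambda>q. dist (J q) ?L < e\<^sup>2 / 4) at_top"
      using J_tendsto e by (intro tendstoD) auto
    then obtain Q where Q: "\<And>q. q \<ge> Q \<Longrightarrow> dist (J q) ?L < e\<^sup>2 / 4" by (auto simp: eventually_at_top_linorder)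
    obtain n0 where n0: "real n0 \<ge> Q" using real_arch_simple by blast
    have "(\<integral>\<xi>. norm (amp i \<xi> - amp j \<xi>) \<partial>N) < e" if ij: "i \<ge> n0" "j \<ge> n0" for i j
    proof -
      let ?a = "real i + 1" and ?c = "real j + 1"
      have ac: "?a \<ge> 1" "?c \<ge> 1" by auto
      have "(\<integral>\<xi>. norm (amp i \<xi> - amp j \<xi>) \<partial>N) \<le> (\<integral>\<xi>. cmod (S ?a \<xi> - S ?c \<xi>) \<partial>N)"
        by (intro integral_mono integrable_norm Bochner_Integration.integrable_diff int expectation_norm_diff_le(1) ac)
          (auto simp: amp_def norm_triangle_ineq3)
      also have "\<dots> < e"
      proof (rule power2_less_imp_less)
        have "Q \<le> ?a + ?a" "Q \<le> ?c + ?c" "Q \<le> ?a + ?c" using ij n0 by linarith+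
        from this[THEN Q] have "dist (J (?a + ?a)) ?L < e\<^sup>2 / 4" "dist (J (?c + ?c)) ?L < e\<^sup>2 / 4" "dist (J (?a + ?c)) ?L < e\<^sup>2 / 4"
          by this
        then have "J (?a + ?a) + J (?c + ?c) - 2 * J (?a + ?c) < e\<^sup>2"
          unfolding dist_real_def by linarith
        then show "(\<integral>\<xi>. cmod (S ?a \<xi> - S ?c \<xi>) \<partial>N)\<^sup>2 < e\<^sup>2"
          using expectation_norm_diff_le(2)[OF ac] by linarith
      qed (use e in simp)
      finally show ?thesis .
    qed
    then show "\<exists>n0. \<forall>i\<ge>n0. \<forall>j\<ge>n0. (\<integral>\<xi>. norm (amp i \<xi> - amp j \<xi>) \<partial>N) < e" by blast
  qed
qed

text \<open>
  Ergodicity is only assumed for strictly invariant sets, so the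
  event that the limit exceeds \<open>c\<close> is replaced by one that makes sense, and is invariant,
  for every configuration.
\<close>

lemma amp_level_set_trivial:
  fixes \<rho> :: "nat \<Rightarrow> nat"
  assumes \<rho>: "strict_mono \<rho>"
  defines "A c \<equiv> {\<xi> \<in> X. \<exists>m. \<forall>J. \<exists>j\<ge>J. c + 1 / real (Suc m) < amp (\<rho> j) \<xi>}"
  shows "A c \<in> sets N" "N.prob (A c) = 0 \<or> N.prob (A c) = 1"
proof -
  \<comment> \<open>The event says that the limit superior of the amplitudes along the subsequence
    exceeds c, written with countable quantifiers only.\<close>
  have A_eq: "A c = {\<xi> \<in> space N. \<exists>m. \<forall>J. \<exists>j\<in>{J..}. c + 1 / real (Suc m) < amp (\<rho> j) \<xi>}"
    unfolding A_def space_N by (simp only: Bex_def atLeast_iff)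
  show AN: "A c \<in> sets N" unfolding A_eq by measurable
  then have A\<mu>: "A c \<in> sets \<mu>" by (simp add: sets_N sets_eq)
  obtain C where C: "\<forall>n t \<xi>. \<xi> \<in> X \<longrightarrow> cmod (S (real n + 1) (translate t \<xi>) - wave k t * S (real n + 1) \<xi>)
        \<le> sqrt (pi / (2 * (real n + 1))) * (norm t * C)" by (rule amp_bound)
  have inv: "translate t \<xi> \<in> A c" if \<xi>: "\<xi> \<in> A c" for t \<xi>
  proof -
    have \<xi>X: "\<xi> \<in> X" using \<xi> by (simp add: A_def)
    obtain m where m: "\<And>J. \<exists>j\<ge>J. c + 1 / real (Suc m) < amp (\<rho> j) \<xi>" using \<xi> by (auto simp: A_def)
    \<comment> \<open>Half of the margin 1 / (m + 1) is spent on the translation error, which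
      eventually drops below that half; the other half remains as the margin of the
      translate.\<close>
    define m' where "m' = 2 * m + 1"
    have m': "1 / real (Suc m) = 2 * (1 / real (Suc m'))" by (simp add: m'_def field_simps)
    have "(\<lambda>j. sqrt (pi / (2 * (real (\<rho> j) + 1))) * (norm t * C)) \<longlonglongrightarrow> 0"
      using LIMSEQ_subseq_LIMSEQ[OF shift_error_tendsto \<rho>] by (simp add: o_def)
    then have "eventually (\<lambda>j. sqrt (pi / (2 * (real (\<rho> j) + 1))) * (norm t * C) < 1 / real (Suc m')) sequentially"
      by (rule order_tendstoD) simp
    then obtain J0 where J0: "\<And>j. j \<ge> J0 \<Longrightarrow> sqrt (pi / (2 * (real (\<rho> j) + 1))) * (norm t * C) < 1 / real (Suc m')"
      by (auto simp: eventually_sequentially)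
    have "\<exists>j\<ge>J. c + 1 / real (Suc m') < amp (\<rho> j) (translate t \<xi>)" for J
    proof -
      obtain j where j: "j \<ge> max J J0" "c + 1 / real (Suc m) < amp (\<rho> j) \<xi>" using m by blast
      let ?a = "real (\<rho> j) + 1"
      have "amp (\<rho> j) \<xi> = cmod (wave k t * S ?a \<xi>)" by (simp add: amp_def norm_mult)
      also have "\<dots> \<le> cmod (S ?a (translate t \<xi>)) + cmod (S ?a (translate t \<xi>) - wave k t * S ?a \<xi>)"
        using norm_triangle_ineq4[of "S ?a (translate t \<xi>)" "S ?a (translate t \<xi>) - wave k t * S ?a \<xi>"] by simp
      also have "\<dots> \<le> amp (\<rho> j) (translate t \<xi>) + sqrt (pi / (2 * ?a)) * (norm t * C)"
        using C \<xi>X by (simp add: amp_def)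
      also have "\<dots> < amp (\<rho> j) (translate t \<xi>) + 1 / real (Suc m')" using J0 j(1) by simp
      finally have "c + 1 / real (Suc m') < amp (\<rho> j) (translate t \<xi>)" using j(2) m' by linarith
      then show ?thesis using j(1) by (intro exI[of _ j]) simp
    qed
    then show ?thesis using translate_in_X[OF \<xi>X] by (auto simp: A_def)
  qed
  have "translate t -` A c \<inter> Mp = A c" for t
  proof (intro equalityI subsetI)
    fix \<xi> assume "\<xi> \<in> translate t -` A c \<inter> Mp"
    then have "translate (- t) (translate t \<xi>) \<in> A c" "\<xi> \<in> Mp" using inv by auto
    then show "\<xi> \<in> A c" by (simp add: translate_translate translate_0)
  next
    fix \<xi> assume \<xi>: "\<xi> \<in> A c"
    then have "\<xi> \<in> X" by (simp add: A_def)
    then show "\<xi> \<in> translate t -` A c \<inter> Mp" using inv[OF \<xi>] X_in_Mp by simp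
  qed
  then have "emeasure \<mu> (A c) = 0 \<or> emeasure \<mu> (A c) = 1" using ergodic[OF A\<mu>] by blast
  moreover have "emeasure N (A c) = emeasure \<mu> (A c)"
    unfolding N_def using X_sets by (intro emeasure_restrict_space) (auto simp: A_def sets.Int_space_eq2)
  ultimately show "N.prob (A c) = 0 \<or> N.prob (A c) = 1"
    by (auto simp: measure_def)
qed

text \<open>The almost sure limit is a constant m by ergodicity, and bounded convergence applies to
  the first and to the second moments. The second moments are values of \<open>J\<close> and
  identify m^2 as the mass of k; nonnegativity of the amplitudes then selects the root.\<close>

theorem amp_limit:
  obtains \<rho> :: "nat \<Rightarrow> nat" where "strict_mono \<rho>"
    "(\<lambda>j. \<integral>\<xi>. amp (\<rho> j) \<xi> \<partial>N) \<longlonglongrightarrow> sqrt (measure \<nu> {k})"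
proof -
  obtain \<rho> :: "nat \<Rightarrow> nat" where \<rho>: "strict_mono \<rho>" and cau: "AE \<xi> in N. Cauchy (\<lambda>i. amp (\<rho> i) \<xi>)"
    by (rule amp_subsequence)
  obtain C where C: "C > 0" "\<forall>n \<xi>. \<xi> \<in> X \<longrightarrow> \<bar>amp n \<xi>\<bar> \<le> C" by (rule amp_bound)
  define Y where "Y \<xi> = lim (\<lambda>i. amp (\<rho> i) \<xi>)" for \<xi>
  have Y_meas [measurable]: "Y \<in> borel_measurable N" unfolding Y_def by measurable
  have lim: "AE \<xi> in N. (\<lambda>i. amp (\<rho> i) \<xi>) \<longlonglongrightarrow> Y \<xi>"
    using cau unfolding Y_def by (auto simp: Cauchy_convergent_iff convergent_LIMSEQ_iff elim: eventually_mono)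
  have bd: "AE \<xi> in N. norm (amp n \<xi>) \<le> C" for n using C(2) by (auto intro!: AE_I2)
  have Y_bd: "AE \<xi> in N. \<bar>Y \<xi>\<bar> \<le> C"
    using lim AE_space
  proof eventually_elim
    case (elim \<xi>)
    have "(\<lambda>i. \<bar>amp (\<rho> i) \<xi>\<bar>) \<longlonglongrightarrow> \<bar>Y \<xi>\<bar>" using elim(1) by (rule tendsto_rabs)
    then show ?case using C(2) elim(2) by (intro LIMSEQ_le_const2) auto
  qed
  have iY: "integrable N Y" using Y_bd by (intro N.integrable_const_bound[where B=C]) auto
  have "N.prob {\<xi> \<in> space N. c < Y \<xi>} = 0 \<or> N.prob {\<xi> \<in> space N. c < Y \<xi>} = 1" for c
  proof -
    let ?A = "{\<xi> \<in> X. \<exists>m. \<forall>J. \<exists>j\<ge>J. c + 1 / real (Suc m) < amp (\<rho> j) \<xi>}"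
    have "AE \<xi> in N. \<xi> \<in> {\<xi> \<in> space N. c < Y \<xi>} \<longleftrightarrow> \<xi> \<in> ?A"
      using lim AE_space
    proof eventually_elim
      case (elim \<xi>)
      \<comment> \<open>The margin 1 / (m + 1) lets the strict inequality survive the limit:
        amplitudes that infinitely often exceed c + 1 / (m + 1) only give a weak inequality for Y,
        which is still strict against c.\<close>
      have "c < Y \<xi> \<longleftrightarrow> (\<exists>m. \<forall>J. \<exists>j\<ge>J. c + 1 / real (Suc m) < amp (\<rho> j) \<xi>)"
      proof
        assume "c < Y \<xi>"
        then have "0 < Y \<xi> - c" by simp
        then obtain m where "1 / real (Suc m) < Y \<xi> - c" using nat_approx_posE by metis
        then have "c + 1 / real (Suc m) < Y \<xi>" by linarith
        then have "eventually (\<lambda>j. c + 1 / real (Suc m) < amp (\<rho> j) \<xi>) sequentially"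
          using elim(1) by (intro order_tendstoD)
        then obtain j0 where "\<And>j. j \<ge> j0 \<Longrightarrow> c + 1 / real (Suc m) < amp (\<rho> j) \<xi>" by (auto simp: eventually_sequentially)
        then have "\<exists>j\<ge>J. c + 1 / real (Suc m) < amp (\<rho> j) \<xi>" for J by (intro exI[of _ "max J j0"]) simp
        then show "\<exists>m. \<forall>J. \<exists>j\<ge>J. c + 1 / real (Suc m) < amp (\<rho> j) \<xi>" by blast
      next
        assume "\<exists>m. \<forall>J. \<exists>j\<ge>J. c + 1 / real (Suc m) < amp (\<rho> j) \<xi>"
        then obtain m where m: "\<And>J. \<exists>j\<ge>J. c + 1 / real (Suc m) < amp (\<rho> j) \<xi>" by blast
        have "c + 1 / real (Suc m) \<le> Y \<xi>"
        proof (rule ccontr)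
          assume "\<not> c + 1 / real (Suc m) \<le> Y \<xi>"
          then have "Y \<xi> < c + 1 / real (Suc m)" by (simp only: not_le)
          then have "eventually (\<lambda>j. amp (\<rho> j) \<xi> < c + 1 / real (Suc m)) sequentially"
            using elim(1) by (intro order_tendstoD)
          then obtain j0 where j0: "\<And>j. j \<ge> j0 \<Longrightarrow> amp (\<rho> j) \<xi> < c + 1 / real (Suc m)" by (auto simp: eventually_sequentially)
          obtain j where "j \<ge> j0" "c + 1 / real (Suc m) < amp (\<rho> j) \<xi>" using m by blast
          then show False using j0[of j] by simp
        qed
        moreover have "0 < 1 / real (Suc m)" by simp
        ultimately show "c < Y \<xi>" by linarith
      qed
      then show ?case using elim(2) by simp
    qed
    moreover have "{\<xi> \<in> space N. c < Y \<xi>} \<in> sets N" by measurable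
    ultimately have "N.prob {\<xi> \<in> space N. c < Y \<xi>} = N.prob ?A"
      by (rule N.finite_measure_eq_AE[OF _ _ amp_level_set_trivial(1)[OF \<rho>]])
    with amp_level_set_trivial(2)[OF \<rho>, of c] show ?thesis by (simp only:)
  qed
  then have const: "AE \<xi> in N. Y \<xi> = N.expectation Y"
    by (rule N.AE_eq_expectation_if_trivial[OF iY])
  define m where "m = N.expectation Y"
  have lim_m: "AE \<xi> in N. (\<lambda>i. amp (\<rho> i) \<xi>) \<longlonglongrightarrow> m"
    using lim const unfolding m_def by eventually_elim simp
  have l1: "(\<lambda>j. \<integral>\<xi>. amp (\<rho> j) \<xi> \<partial>N) \<longlonglongrightarrow> (\<integral>\<xi>. m \<partial>N)"
    by (rule integral_dominated_convergence[where w="\<lambda>_. C"]) (use lim_m bd in auto)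
  then have l1: "(\<lambda>j. \<integral>\<xi>. amp (\<rho> j) \<xi> \<partial>N) \<longlonglongrightarrow> m" by (simp add: N.prob_space[simplified])
  have "(\<lambda>j. \<integral>\<xi>. (amp (\<rho> j) \<xi>)\<^sup>2 \<partial>N) \<longlonglongrightarrow> (\<integral>\<xi>. m\<^sup>2 \<partial>N)"
  proof (rule integral_dominated_convergence[where w="\<lambda>_. C\<^sup>2"])
    show "AE \<xi> in N. (\<lambda>j. (amp (\<rho> j) \<xi>)\<^sup>2) \<longlonglongrightarrow> m\<^sup>2" using lim_m by eventually_elim (rule tendsto_power)
    show "AE \<xi> in N. norm ((amp (\<rho> j) \<xi>)\<^sup>2) \<le> C\<^sup>2" for j
      using bd[of "\<rho> j"] by eventually_elim (simp add: power_mono amp_def)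
  qed auto
  then have l2: "(\<lambda>j. \<integral>\<xi>. (amp (\<rho> j) \<xi>)\<^sup>2 \<partial>N) \<longlonglongrightarrow> m\<^sup>2" by (simp add: N.prob_space[simplified])
  have sq: "(\<integral>\<xi>. (amp n \<xi>)\<^sup>2 \<partial>N) = J ((real n + 1) + (real n + 1))" for n
  proof -
    have "(amp n \<xi>)\<^sup>2 = cross (real n + 1) (real n + 1) \<xi>" for \<xi>
      unfolding amp_def cross_def cmod_power2 by (simp add: power2_eq_square)
    then show ?thesis by (simp add: expectation_cross(2))
  qed
  have "filterlim (\<lambda>j. (real (\<rho> j) + 1) + (real (\<rho> j) + 1)) at_top sequentially"
  proof (rule filterlim_at_top_mono)
    show "filterlim (\<lambda>j. real (\<rho> j)) at_top sequentially"
      using filterlim_compose[OF filterlim_real_sequentially filterlim_subseq[OF \<rho>]] .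
  qed (auto intro!: always_eventually)
  then have "(\<lambda>j. J ((real (\<rho> j) + 1) + (real (\<rho> j) + 1))) \<longlonglongrightarrow> measure \<nu> {k}"
    by (rule filterlim_compose[OF J_tendsto])
  then have "m\<^sup>2 = measure \<nu> {k}" using l2 unfolding sq by (rule LIMSEQ_unique[rotated])
  moreover have "0 \<le> m"
    by (rule LIMSEQ_le_const[OF l1]) (auto simp: amp_def intro!: exI[of _ 0] integral_nonneg_AE)
  ultimately have "m = sqrt (measure \<nu> {k})" by (metis real_sqrt_unique)
  then show thesis using \<rho> l1 by (intro that) auto
qed

text \<open>Almost sure convergence has already been spent in \<open>amp_limit\<close>; what remains
  is an inequality between expectations for each n, whose error term vanishes along the
  subsequence.\<close>

theorem bragg_bound:
  "cmod (wave k t - 1) * sqrt (measure \<nu> {k}) \<le> 2 * (measure \<gamma> {0} - measure \<gamma> {t})"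
proof -
  obtain \<rho> :: "nat \<Rightarrow> nat" where \<rho>: "strict_mono \<rho>"
    and lim: "(\<lambda>j. \<integral>\<xi>. amp (\<rho> j) \<xi> \<partial>N) \<longlonglongrightarrow> sqrt (measure \<nu> {k})" by (rule amp_limit)
  obtain C where C: "\<forall>n \<xi>. \<xi> \<in> X \<longrightarrow> \<bar>amp n \<xi>\<bar> \<le> C"
    "\<forall>n t \<xi>. \<xi> \<in> X \<longrightarrow> cmod (S (real n + 1) (translate t \<xi>) - wave k t * S (real n + 1) \<xi>)
        \<le> sqrt (pi / (2 * (real n + 1))) * (norm t * C)" by (rule amp_bound)
  \<comment> \<open>The uniform error made when the sum over the translate is replaced by
    \<open>wave k t\<close> times the original sum.\<close>
  define \<kappa> where "\<kappa> n = sqrt (pi / (2 * (real n + 1))) * (norm t * C)" for n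
  have bound: "cmod (wave k t - 1) * (\<integral>\<xi>. amp n \<xi> \<partial>N) \<le> 2 * (measure \<gamma> {0} - measure \<gamma> {t}) + \<kappa> n" for n
  proof -
    let ?a = "real n + 1"
    have a: "?a \<ge> 1" by simp
    have int: "integrable N (amp n)" using C(1) by (intro integrable_bounded_N[where C=C]) auto
    have measD: "(\<lambda>\<xi>. cmod (S ?a (translate t \<xi>) - S ?a \<xi>)) \<in> borel_measurable N"
    proof -
      have "(\<lambda>\<xi>. S ?a (translate t \<xi>)) \<in> borel_measurable N"
        by (rule measurable_compose[OF _ measurable_S[OF a]]) (rule measurable_translate_N, auto)
      then show ?thesis using measurable_S[OF a] by measurable
    qed
    have intD: "integrable N (\<lambda>\<xi>. cmod (S ?a (translate t \<xi>) - S ?a \<xi>))"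
    proof (rule integrable_bounded_N[OF measD, where C="C + C"])
      show "norm (cmod (S ?a (translate t \<xi>) - S ?a \<xi>)) \<le> C + C" if "\<xi> \<in> X" for \<xi>
        using norm_triangle_ineq4[of "S ?a (translate t \<xi>)" "S ?a \<xi>"] C(1)[rule_format, OF that, of n]
          C(1)[rule_format, OF translate_in_X[OF that, of t], of n] by (simp add: amp_def)
    qed
    have "cmod (wave k t - 1) * (\<integral>\<xi>. amp n \<xi> \<partial>N) = (\<integral>\<xi>. cmod (wave k t - 1) * amp n \<xi> \<partial>N)" by simp
    also have "\<dots> \<le> (\<integral>\<xi>. cmod (S ?a (translate t \<xi>) - S ?a \<xi>) + \<kappa> n \<partial>N)"
    proof (rule integral_mono)
      fix \<xi> assume "\<xi> \<in> space N"
      then have \<xi>: "\<xi> \<in> X" by simp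
      have "cmod (wave k t - 1) * amp n \<xi> = cmod (wave k t * S ?a \<xi> - S ?a \<xi>)"
        by (simp add: amp_def norm_mult[symmetric] left_diff_distrib)
      also have "\<dots> = cmod ((S ?a (translate t \<xi>) - S ?a \<xi>) - (S ?a (translate t \<xi>) - wave k t * S ?a \<xi>))" by simp
      also have "\<dots> \<le> cmod (S ?a (translate t \<xi>) - S ?a \<xi>) + cmod (S ?a (translate t \<xi>) - wave k t * S ?a \<xi>)"
        by (rule norm_triangle_ineq4)
      also have "\<dots> \<le> cmod (S ?a (translate t \<xi>) - S ?a \<xi>) + \<kappa> n"
        using C(2) \<xi> by (simp add: \<kappa>_def)
      finally show "cmod (wave k t - 1) * amp n \<xi> \<le> cmod (S ?a (translate t \<xi>) - S ?a \<xi>) + \<kappa> n" .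
    qed (use int intD in auto)
    also have "\<dots> = (\<integral>\<xi>. cmod (S ?a (translate t \<xi>) - S ?a \<xi>) \<partial>N) + \<kappa> n"
      using intD by (simp add: N.prob_space[simplified])
    also have "\<dots> \<le> 2 * (measure \<gamma> {0} - measure \<gamma> {t}) + \<kappa> n"
      using expectation_translate_diff[OF a, of t] by simp
    finally show ?thesis .
  qed
  have l1: "(\<lambda>j. 2 * (measure \<gamma> {0} - measure \<gamma> {t}) + \<kappa> (\<rho> j)) \<longlonglongrightarrow> 2 * (measure \<gamma> {0} - measure \<gamma> {t}) + 0"
    using LIMSEQ_subseq_LIMSEQ[OF shift_error_tendsto[of "norm t * C"] \<rho>]
    by (intro tendsto_add tendsto_const) (simp add: \<kappa>_def o_def)
  have l2: "(\<lambda>j. cmod (wave k t - 1) * (\<integral>\<xi>. amp (\<rho> j) \<xi> \<partial>N)) \<longlonglongrightarrow> cmod (wave k t - 1) * sqrt (measure \<nu> {k})"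
    by (intro tendsto_mult tendsto_const lim)
  have "cmod (wave k t - 1) * sqrt (measure \<nu> {k}) \<le> 2 * (measure \<gamma> {0} - measure \<gamma> {t}) + 0"
    by (rule LIMSEQ_le[OF l2 l1]) (use bound in blast)
  then show ?thesis by simp
qed

end

theorem proposition13:
  fixes \<mu> :: "(real ^ 'd) measure measure"
    and X :: "(real ^ 'd) measure set"
    and B :: "(real ^ 'd) set"
    and \<nu> :: "(real ^ 'd) measure"
    and k t :: "real ^ 'd"
  assumes process: "ergodic_point_process \<mu> X"
    and flc: "AE \<xi> in \<mu>. \<xi> \<in> X \<longrightarrow> finite_local_complexity (points \<xi>)"
    and B: "B \<in> sets borel" "bounded B" "emeasure lborel B > 0"
    and fourier: "has_fourier_transform (first_moment (palm_measure \<mu> X B)) \<nu>"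
  shows "cmod (exp (2 * pi * \<i> * of_real (k \<bullet> t)) - 1) * sqrt (measure \<nu> {k})
           \<le> 2 * (measure (first_moment (palm_measure \<mu> X B)) {0}
                - measure (first_moment (palm_measure \<mu> X B)) {t})"
proof -
  interpret ergodic_point_process \<mu> X by (rule process)
  \<comment> \<open>Uniform discreteness supplies the edge length on which the whole locale
    hierarchy is parametrised.\<close>
  obtain r where "r > 0" "X \<subseteq> Mp_cube r" using uniformly_discrete by blast
  then interpret palm_fourier \<mu> X r B \<nu> k
    by unfold_locales (use B fourier in auto)
  have "exp (2 * pi * \<i> * of_real (k \<bullet> t)) = wave k t"
    by (simp add: wave_def cis_conv_exp mult_ac)
  then show ?thesis using bragg_bound[of t] by simp
qed
end
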